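(* Let $K$ be a field. For the following finite racks $X$ and $2$-cocycles $q$ (with the indicated restrictions on $K$; no restriction means $K$ is arbitrary), the Nichols algebra $\mathcal{B}(X,q)$ over $K$ has the following truncated point spaces. (1) $X=(12)^{\mathbb{S}_3}$, $q\equiv -1$: $\Gamma_2=\emptyset$. (2) $X=(12)^{\mathbb{S}_3}$, $q\equiv\zeta_3$ with $\zeta_3\in K$ a primitive cubic root of unity, $\mathrm{char}(K)=2$: $\Gamma_2\neq\emptyset$ and $\Gamma_3=\emptyset$. (3) $X=\mathcal{T}$, $q\equiv 1$, $\mathrm{char}(K)=2$: $\Gamma_2=\emptyset$. (4) $X=\mathcal{T}$, $q\equiv -1$, $\mathrm{char}(K)\neq 2$: $\Gamma_2=\emptyset$. (5) $X=\mathcal{T}$, $q=\psi$, where $K$ contains a primitive cubic root of unity $\zeta$: $\Gamma_2\neq\emptyset$ and $\Gamma_3=\emptyset$. (6) $X=\mathrm{Aff}(5,2)$, $q\equiv -1$: $\Gamma_2=\emptyset$. (7) $X=\mathrm{Aff}(5,3)$, $q\equiv -1$: $\Gamma_2=\emptyset$. (8) $X=(12)^{\mathbb{S}_4}$, $q=\chi$: $\Gamma_2=\emptyset$. (9) $X=(12)^{\mathbb{S}_4}$, $q\equiv -1$: $\Gamma_2=\emptyset$. (10) $X=(1234)^{\mathbb{S}_4}$, $q\equiv -1$: $\Gamma_2=\emptyset$. (11) $X=\mathrm{Aff}(7,3)$, $q\equiv -1$: $\Gamma_2=\emptyset$. (12) $X=\mathrm{Aff}(7,5)$, $q\equiv -1$: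 $\Gamma_2=\emptyset$. (13) $X=(12)^{\mathbb{S}_5}$, $q=\chi$: $\Gamma_2=\emptyset$. (14) $X=(12)^{\mathbb{S}_5}$, $q\equiv -1$: $\Gamma_2=\emptyset$. In particular, $\Gamma_3(\mathcal{B}(X,q))=\emptyset$ in all of these cases.
   Context: Racks. For a group $G$ and $g\in G$, $g^G$ denotes the conjugacy class of $g$ in $G$, regarded as a rack with $x\triangleright y=xyx^{-1}$. $\mathbb{S}_n$ and $\mathbb{A}_n$ are the symmetric and alternating groups. $\mathcal{T}=(123)^{\mathbb{A}_4}=\{(243),(123),(134),(142)\}$. For a prime $p$ and $\alpha\in\mathbb{F}_p^\times$, $\alpha\ne1$, the affine rack $\mathrm{Aff}(p,\alpha)$ is the set $\{x_g: g\in\mathbb{F}_p\}$ with $x_g\triangleright x_h=x_{(1-\alpha)g+\alpha h}$. Cocycles. A $2$-cocycle of a finite rack $X$ over $K$ is a map $q\colon X\times X\to K^\times$, $(x,y)\mapsto q_{x,y}$, with $q_{x,y\triangleright z}\,q_{y,z}=q_{x\triangleright y,x\triangleright z}\,q_{x,z}$ for all $x,y,z\in X$; $q\equiv\gamma$ denotes the constant cocycle with value $\gamma$. The cocycle $\chi$ on $(12)^{\mathbb{S}_n}$ is: for $\tau=(i\,j)$ with $i<j$, $\chi(\sigma,\tau)=1$ if $\sigma(i)<\sigma(j)$, and $\chi(\sigma,\tau)=-1$ otherwise. The cocycle $\psi$ on $\mathcal{T}$ is: with $\zeta$ a primitive cubic root of unity, $\psi(x,y)=\zeta$ if $x=(243)$,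 or $y=(243)$, or $x=y$; and $\psi(x,y)=-\zeta$ otherwise (i.e. when $x\ne y$ are both in $\{(123),(134),(142)\}$). Nichols algebras. Let $V=KX$ be the vector space with basis $X$ and let $c\in \mathrm{GL}(V\otimes V)$, $c(x\otimes y)=q_{x,y}\,(x\triangleright y)\otimes x$. On $V^{\otimes n}$ let $c_i$ act as $c$ on the tensor factors $i,i+1$ and as the identity elsewhere. Define $\mathcal{S}_1=I$ and $\mathcal{S}_{n+1}=(I\otimes\mathcal{S}_n)(I+c_1+c_1c_2+\cdots+c_1c_2\cdots c_n)$; in particular $\mathcal{S}_2=I+c_1$. The Nichols algebra is the graded algebra $\mathcal{B}(X,q)=K\oplus V\oplus\bigoplus_{n\ge 2}V^{\otimes n}/\ker\mathcal{S}_n$, a quotient of the tensor algebra $T(V)$. (The algebras listed are all currently known finite-dimensional Nichols algebras arising from simple Yetter--Drinfeld modules over non-abelian groups; their known dimensions are, in order, $12, 432, 36, 72, 5184, 1280, 1280, 576, 576, 576, 326592, 326592, 8294400, 8294400$.) Truncated point modules. For a connected graded $K$-algebra $A$ generated in degree one by finitely many elements, an $n$-truncated point module is a graded (left) $A$-module generated in degree $0$ with Hilbert series $1+t+\cdots+t^n$. $\Gamma_n=\Gamma_n(A)$ denotes the set of $n$-truncated point modules over $A$ up to graded isomorphism. *)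

theory Defs
  imports "HOL-Algebra.Sym_Groups" "HOL-Algebra.Module" "HOL-Algebra.QuotRing"
begin

section \<open>Racks and cocycles\<close>

record 'a rack = "'a partial_object" +
  act :: "'a \<Rightarrow> 'a \<Rightarrow> 'a" (infixl \<open>\<rhd>\<index>\<close> 70)

definition conj_rack :: "('g, 'r) monoid_scheme \<Rightarrow> 'g \<Rightarrow> 'g rack" where
  "conj_rack G g =
     \<lparr>carrier = {h \<otimes>\<^bsub>G\<^esub> g \<otimes>\<^bsub>G\<^esub> inv\<^bsub>G\<^esub> h | h. h \<in> carrier G},
      act = (\<lambda>x y. x \<otimes>\<^bsub>G\<^esub> y \<otimes>\<^bsub>G\<^esub> inv\<^bsub>G\<^esub> x)\<rparr>"

definition transposition_rack :: "nat \<Rightarrow> (nat \<Rightarrow> nat) rack" where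
  "transposition_rack n = conj_rack (sym_group n) (cycle_of_list [1, 2])"

definition four_cycle_rack :: "(nat \<Rightarrow> nat) rack" where
  "four_cycle_rack = conj_rack (sym_group 4) (cycle_of_list [1, 2, 3, 4])"

text \<open>The rack $(1\,2\,3)^{A_4}$ with four elements; it contains $(2\,4\,3)$.\<close>

definition tetrahedron_rack :: "(nat \<Rightarrow> nat) rack" where
  "tetrahedron_rack = conj_rack (alt_group 4) (cycle_of_list [1, 2, 3])"

text \<open>\<open>x\<^sub>g\<close> is identified with the representative of \<open>g\<close> in \<open>{0, \<dots>, p - 1}\<close>.\<close>

definition affine_rack :: "int \<Rightarrow> int \<Rightarrow> int rack" where
  "affine_rack p \<alpha> =
     \<lparr>carrier = {0..<p}, act = (\<lambda>g h. ((1 - \<alpha>) * g + \<alpha> * h) mod p)\<rparr>"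

text \<open>Only used when \<open>\<tau>\<close> is a transposition, in which case \<open>i\<close> and \<open>j\<close> are unique.\<close>

definition chi :: "(nat \<Rightarrow> nat) \<Rightarrow> (nat \<Rightarrow> nat) \<Rightarrow> 'k::field" where
  "chi \<sigma> \<tau> = (if \<exists>i j. i < j \<and> \<tau> = cycle_of_list [i, j] \<and> \<sigma> i < \<sigma> j then 1 else - 1)"

definition psi :: "'k::field \<Rightarrow> (nat \<Rightarrow> nat) \<Rightarrow> (nat \<Rightarrow> nat) \<Rightarrow> 'k" where
  "psi \<zeta> x y =
     (if x = cycle_of_list [2, 4, 3] \<or> y = cycle_of_list [2, 4, 3] \<or> x = y then \<zeta> else - \<zeta>)"

definition primitive_root_of_unity :: "nat \<Rightarrow> 'k::field \<Rightarrow> bool" where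
  "primitive_root_of_unity n \<zeta> \<longleftrightarrow>
     n > 0 \<and> \<zeta> ^ n = 1 \<and> (\<forall>k. 0 < k \<and> k < n \<longrightarrow> \<zeta> ^ k \<noteq> 1)"


section \<open>The tensor algebra of the vector space with basis \<open>X\<close>\<close>

text \<open>
  The word \<open>[x\<^sub>1, \<dots>, x\<^sub>n]\<close> stands for the basis vector \<open>x\<^sub>1 \<otimes> \<dots> \<otimes> x\<^sub>n\<close>, and a tensor is the
  finitely supported function giving its coefficients with respect to this basis.
\<close>

definition word_tensor :: "'x list \<Rightarrow> 'x list \<Rightarrow> 'k::field" where
  "word_tensor w = (\<lambda>u. if u = w then 1 else 0)"

definition tensor_algebra :: "'x set \<Rightarrow> ('x list \<Rightarrow> 'k::field) ring" where
  "tensor_algebra X =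
     \<lparr>carrier = {f. finite {w. f w \<noteq> 0} \<and> {w. f w \<noteq> 0} \<subseteq> lists X},
      mult = (\<lambda>f g w. \<Sum>i\<le>length w. f (take i w) * g (drop i w)),
      one = word_tensor [],
      zero = (\<lambda>w. 0),
      add = (\<lambda>f g w. f w + g w)\<rparr>"

definition tensor_power :: "'x set \<Rightarrow> nat \<Rightarrow> ('x list \<Rightarrow> 'k::field) set" where
  "tensor_power X n =
     {f \<in> carrier (tensor_algebra X). \<forall>w. f w \<noteq> 0 \<longrightarrow> length w = n}"

definition homogeneous_part :: "nat \<Rightarrow> ('x list \<Rightarrow> 'k::field) \<Rightarrow> 'x list \<Rightarrow> 'k" where
  "homogeneous_part n f = (\<lambda>w. if length w = n then f w else 0)"

definition linear_extension ::
    "('x list \<Rightarrow> 'x list \<Rightarrow> 'k) \<Rightarrow> ('x list \<Rightarrow> 'k::field) \<Rightarrow> 'x list \<Rightarrow> 'k" where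
  "linear_extension \<phi> f = (\<lambda>u. \<Sum>w | f w \<noteq> 0. f w * \<phi> w u)"


section \<open>Nichols algebras\<close>

text \<open>
  The braiding on positions \<open>i\<close> and \<open>Suc i\<close> of a word. List positions start at \<open>0\<close>, so this is
  $c_{i+1}$ if tensor factors are counted from \<open>1\<close>.
\<close>

definition braiding ::
    "'x rack \<Rightarrow> ('x \<Rightarrow> 'x \<Rightarrow> 'k::field) \<Rightarrow> nat \<Rightarrow> ('x list \<Rightarrow> 'k) \<Rightarrow> 'x list \<Rightarrow> 'k" where
  "braiding X q i = linear_extension
     (\<lambda>w u. q (w ! i) (w ! Suc i) *
              word_tensor (w[i := (w ! i) \<rhd>\<^bsub>X\<^esub> (w ! Suc i), Suc i := w ! i]) u)"

text \<open>The composite $c_1 c_2 \cdots c_k$, in which $c_k$ is applied first.\<close>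

primrec braiding_chain ::
    "'x rack \<Rightarrow> ('x \<Rightarrow> 'x \<Rightarrow> 'k::field) \<Rightarrow> nat \<Rightarrow> ('x list \<Rightarrow> 'k) \<Rightarrow> 'x list \<Rightarrow> 'k" where
  "braiding_chain X q 0 = id"
| "braiding_chain X q (Suc k) = braiding_chain X q k \<circ> braiding X q k"

text \<open>
  \<open>id_tensor F\<close> is $I \otimes F$ on tensors of positive degree: writing
  $f = \sum_x x \otimes f_x$, the component $f_x$ is \<open>\<lambda>v. f (x # v)\<close>.
\<close>

definition id_tensor ::
    "(('x list \<Rightarrow> 'k) \<Rightarrow> 'x list \<Rightarrow> 'k) \<Rightarrow> ('x list \<Rightarrow> 'k::field) \<Rightarrow> 'x list \<Rightarrow> 'k" where
  "id_tensor F f = (\<lambda>w. case w of [] \<Rightarrow> 0 | x # u \<Rightarrow> F (\<lambda>v. f (x # v)) u)"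

text \<open>
  The $n$-th quantum symmetrizer. In degree \<open>0\<close> it is taken to be the identity, so that
  degrees \<open>0\<close> and \<open>1\<close> of the Nichols algebra are \<open>K\<close> and \<open>V\<close>.
\<close>

fun quantum_symmetrizer ::
    "'x rack \<Rightarrow> ('x \<Rightarrow> 'x \<Rightarrow> 'k::field) \<Rightarrow> nat \<Rightarrow> ('x list \<Rightarrow> 'k) \<Rightarrow> 'x list \<Rightarrow> 'k" where
  "quantum_symmetrizer X q 0 f = f"
| "quantum_symmetrizer X q (Suc 0) f = f"
| "quantum_symmetrizer X q (Suc (Suc n)) f =
     id_tensor (quantum_symmetrizer X q (Suc n))
       (\<lambda>w. \<Sum>k\<le>Suc n. braiding_chain X q k f w)"

definition nichols_ideal ::
    "'x rack \<Rightarrow> ('x \<Rightarrow> 'x \<Rightarrow> 'k::field) \<Rightarrow> ('x list \<Rightarrow> 'k) set" where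
  "nichols_ideal X q =
     {f \<in> carrier (tensor_algebra (carrier X)).
        \<forall>n. quantum_symmetrizer X q n (homogeneous_part n f) = (\<lambda>w. 0)}"

text \<open>A graded unital \<open>K\<close>-algebra: a ring with the structure map from \<open>K\<close> and the graded pieces.\<close>

record ('k, 'a) graded_algebra = "'a ring" +
  scalar :: "'k \<Rightarrow> 'a"
  degree_piece :: "nat \<Rightarrow> 'a set"

definition nichols_algebra ::
    "'x rack \<Rightarrow> ('x \<Rightarrow> 'x \<Rightarrow> 'k::field) \<Rightarrow> ('k, ('x list \<Rightarrow> 'k) set) graded_algebra" where
  "nichols_algebra X q =
     (let T = tensor_algebra (carrier X); I = nichols_ideal X q; B = T Quot I in
       \<lparr>carrier = carrier B, mult = mult B, one = one B, zero = zero B, add = add B,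
        scalar = (\<lambda>c. I +>\<^bsub>T\<^esub> (\<lambda>w. c * word_tensor [] w)),
        degree_piece = (\<lambda>n. (\<lambda>f. I +>\<^bsub>T\<^esub> f) ` tensor_power (carrier X) n)\<rparr>)"


section \<open>Truncated point modules\<close>

text \<open>
  The module locale of the library is restricted to commutative rings. As there, the fields
  \<open>mult\<close> and \<open>one\<close> of a module record are ignored.
\<close>

locale left_module = R?: ring R + M?: abelian_group M for R (structure) and M (structure) +
  assumes smult_closed:
      "\<lbrakk>a \<in> carrier R; x \<in> carrier M\<rbrakk> \<Longrightarrow> a \<odot>\<^bsub>M\<^esub> x \<in> carrier M"
    and smult_l_distr:
      "\<lbrakk>a \<in> carrier R; b \<in> carrier R; x \<in> carrier M\<rbrakk> \<Longrightarrow>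
       (a \<oplus> b) \<odot>\<^bsub>M\<^esub> x = a \<odot>\<^bsub>M\<^esub> x \<oplus>\<^bsub>M\<^esub> b \<odot>\<^bsub>M\<^esub> x"
    and smult_r_distr:
      "\<lbrakk>a \<in> carrier R; x \<in> carrier M; y \<in> carrier M\<rbrakk> \<Longrightarrow>
       a \<odot>\<^bsub>M\<^esub> (x \<oplus>\<^bsub>M\<^esub> y) = a \<odot>\<^bsub>M\<^esub> x \<oplus>\<^bsub>M\<^esub> a \<odot>\<^bsub>M\<^esub> y"
    and smult_assoc:
      "\<lbrakk>a \<in> carrier R; b \<in> carrier R; x \<in> carrier M\<rbrakk> \<Longrightarrow>
       (a \<otimes> b) \<odot>\<^bsub>M\<^esub> x = a \<odot>\<^bsub>M\<^esub> (b \<odot>\<^bsub>M\<^esub> x)"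
    and smult_one: "x \<in> carrier M \<Longrightarrow> \<one> \<odot>\<^bsub>M\<^esub> x = x"

record ('a, 'm) graded_module = "('a, 'm) module" +
  piece :: "int \<Rightarrow> 'm set"

definition graded_left_module ::
    "('k::field, 'a) graded_algebra \<Rightarrow> ('a, 'm) graded_module \<Rightarrow> bool" where
  "graded_left_module A M \<longleftrightarrow>
     left_module A M \<and>
     (\<forall>i. subgroup (piece M i) (add_monoid M)) \<and>
     (\<forall>x \<in> carrier M. \<exists>!f. (\<forall>i. f i \<in> piece M i) \<and> finite {i. f i \<noteq> \<zero>\<^bsub>M\<^esub>} \<and>
         x = (\<Oplus>\<^bsub>M\<^esub>i \<in> {i. f i \<noteq> \<zero>\<^bsub>M\<^esub>}. f i)) \<and>
     (\<forall>j i. \<forall>a \<in> degree_piece A j. \<forall>x \<in> piece M i. a \<odot>\<^bsub>M\<^esub> x \<in> piece M (int j + i))"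

definition generated_in_degree_zero ::
    "('k::field, 'a) graded_algebra \<Rightarrow> ('a, 'm) graded_module \<Rightarrow> bool" where
  "generated_in_degree_zero A M \<longleftrightarrow>
     (\<forall>N. submodule N A M \<and> piece M 0 \<subseteq> N \<longrightarrow> N = carrier M)"

text \<open>\<open>W\<close> has a \<open>K\<close>-basis with \<open>d\<close> elements.\<close>

definition has_dimension ::
    "('k::field, 'a) graded_algebra \<Rightarrow> ('a, 'm) graded_module \<Rightarrow> 'm set \<Rightarrow> nat \<Rightarrow> bool" where
  "has_dimension A M W d \<longleftrightarrow>
     (\<exists>b. (\<forall>j<d. b j \<in> W) \<and>
        (\<forall>x \<in> W. \<exists>!c. c \<in> extensional {..<d} \<and>
           x = (\<Oplus>\<^bsub>M\<^esub>j \<in> {..<d}. scalar A (c j) \<odot>\<^bsub>M\<^esub> b j)))"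

definition truncated_point_module ::
    "nat \<Rightarrow> ('k::field, 'a) graded_algebra \<Rightarrow> ('a, 'm) graded_module \<Rightarrow> bool" where
  "truncated_point_module n A M \<longleftrightarrow>
     graded_left_module A M \<and> generated_in_degree_zero A M \<and>
     (\<forall>i. has_dimension A M (piece M i) (if 0 \<le> i \<and> i \<le> int n then 1 else 0))"

definition graded_isomorphic ::
    "('k::field, 'a) graded_algebra \<Rightarrow> ('a, 'm) graded_module \<Rightarrow> ('a, 'm) graded_module \<Rightarrow> bool"
  where
  "graded_isomorphic A M N \<longleftrightarrow>
     (\<exists>\<phi>. bij_betw \<phi> (carrier M) (carrier N) \<and>
        (\<forall>x \<in> carrier M. \<forall>y \<in> carrier M. \<phi> (x \<oplus>\<^bsub>M\<^esub> y) = \<phi> x \<oplus>\<^bsub>N\<^esub> \<phi> y) \<and>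
        (\<forall>a \<in> carrier A. \<forall>x \<in> carrier M. \<phi> (a \<odot>\<^bsub>M\<^esub> x) = a \<odot>\<^bsub>N\<^esub> \<phi> x) \<and>
        (\<forall>i. \<phi> ` piece M i = piece N i))"

text \<open>
  $\Gamma_n(A)$, for modules whose elements are taken from the type \<open>'m\<close>. A truncated point module
  is finite-dimensional over \<open>K\<close>, so every one has an isomorphic copy inside \<open>nat \<Rightarrow> 'k\<close>, and
  with this choice of \<open>'m\<close> no isomorphism class is missed.
\<close>

definition point_space ::
    "'m itself \<Rightarrow> nat \<Rightarrow> ('k::field, 'a) graded_algebra \<Rightarrow> ('a, 'm) graded_module set set" where
  "point_space _ n A =
     {M. truncated_point_module n A M} //
     {(M, N). truncated_point_module n A M \<and> truncated_point_module n A N \<and>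
              graded_isomorphic A M N}"

end

theory Submission
  imports Defs
begin

text \<open>
  A truncated point module with homogeneous basis $m_0, \dots, m_n$ is a sequence of nonzero
  functions $\alpha_0, \dots, \alpha_{n-1}$ on the rack, where $x\, m_i = \alpha_i(x)\, m_{i+1}$, and every
  relation $\sum r_{xy}\, x \otimes y$ of degree two gives $\sum r_{xy}\, \alpha_{i+1}(x) \alpha_i(y) = 0$.
  If $x^2 = 0$ holds for all \<open>x\<close>, the supports of $\alpha_0$ and $\alpha_1$ are disjoint; since every other
  relation runs through an orbit of at most three pairs under $(x, y) \mapsto (x \rhd y, x)$, it then has a
  single nonvanishing term, a contradiction. (For the affine racks over $F_5$ the orbits have
  length four, and iterating the relation exhausts the rack.) In the two cases with $x^3 = 0$ the same
  relations leave only pairs of supports that are equal singletons or both contain all elements but a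
  common one, so three consecutive supports always share an element \<open>x\<close>, against $x^3 = 0$;
  and $K[t]/(t^3)$ with a single letter acting as \<open>t\<close> is a 2-truncated point module.

  The relations of a Nichols algebra are handled through skew derivations: a tensor is a
  relation iff all its iterated skew derivatives have zero constant term, and the twisted Leibniz rule
  shows that these tensors form an ideal.
\<close>

section \<open>The ring structure of the tensor algebra\<close>

text \<open>The quotient by the kernels of the symmetrizers is a ring only if these kernels form a
  two-sided ideal, and the recursion for the symmetrizers hides this by peeling off tensor factors
  from one side. Read coefficientwise, each step of the recursion is a derivative, so a coefficient
  of the n-th symmetrizer is an n-fold derivative. Self-distributivity and the cocycle identity are
  what lets derivatives pass the twists of the Leibniz rule.

  Emptiness asks only for some elements of the ideal: orbits of the braiding on pairs, and cubes of
  letters. Existence asks for the opposite, that no element of the ideal has a nonzero coefficient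
  at 1, x or x^2; this rests on 1 + q_{x,x} \<noteq> 0.

  An orbit of three pairs carries a relation when the product of its cocycle values is -1. This is
  (-1)^3 for the constant -1, \<zeta>^3 in characteristic two, and -\<zeta>^3 for
  \<open>psi\<close>; the restrictions on the field come from here.\<close>

definition conv :: "('x list \<Rightarrow> 'k::field) \<Rightarrow> ('x list \<Rightarrow> 'k) \<Rightarrow> 'x list \<Rightarrow> 'k" where
  "conv f g w = (\<Sum>i\<le>length w. f (take i w) * g (drop i w))"

lemma conv_Nil [simp]: "conv f g [] = f [] * g []"
  by (simp add: conv_def)

text \<open>Splitting off the first letter turns the sum over all cuts of a word into a recursion on
  the word, which drives the later inductions.\<close>

lemma conv_Cons: "conv f g (a # w) = f [] * g (a # w) + conv (\<lambda>v. f (a # v)) g w"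
  unfolding conv_def length_Cons sum.atMost_Suc_shift by simp

lemma conv_add_left: "conv (\<lambda>w. f w + f' w) g v = conv f g v + conv f' g v"
  by (simp add: conv_def distrib_right sum.distrib)

lemma conv_add_right: "conv f (\<lambda>w. g w + g' w) v = conv f g v + conv f g' v"
  by (simp add: conv_def distrib_left sum.distrib)

lemma conv_scale_left: "conv (\<lambda>w. c * f w) g v = c * conv f g v"
  by (simp add: conv_def sum_distrib_left mult.assoc)

lemma conv_zero_left [simp]: "conv (\<lambda>w. 0) g v = 0"
  by (simp add: conv_def)

text \<open>The left factor is read only at prefixes of \<open>v\<close>. Twists are under control
  only on words over the rack, hence the restriction to \<open>lists A\<close>.\<close>

lemma conv_cong_left:
  "(\<And>u. u \<in> lists A \<Longrightarrow> f u = f' u) \<Longrightarrow> v \<in> lists A \<Longrightarrow> conv f g v = conv f' g v"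
  unfolding conv_def by (intro sum.cong refl) (auto dest: in_set_takeD)

lemma conv_assoc: "conv (conv f g) h w = conv f (conv g h) w"
proof (induction w arbitrary: f rule: list.induct)
  case (Cons a w)
  have "(\<lambda>v. conv f g (a # v)) = (\<lambda>v. f [] * g (a # v) + conv (\<lambda>v. f (a # v)) g v)"
    by (simp add: conv_Cons)
  then show ?case
    by (simp add: conv_Cons Cons conv_add_left conv_scale_left distrib_left mult.assoc)
qed (simp add: mult.assoc)

lemma conv_one_left:
  fixes g :: "'x list \<Rightarrow> 'k::field"
  shows "conv (word_tensor []) g w = g w"
proof (cases w)
  case (Cons a v)
  have "(\<lambda>v. word_tensor [] (a # v)) = (\<lambda>v. 0 :: 'k)" by (simp add: word_tensor_def)
  then show ?thesis by (simp add: Cons conv_Cons word_tensor_def)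
qed (simp add: word_tensor_def)

lemma conv_one_right: "conv f (word_tensor []) w = f w"
  by (induction w arbitrary: f) (simp_all add: conv_Cons word_tensor_def)

lemma conv_scalar_left: "conv (\<lambda>w. c * word_tensor [] w) g = (\<lambda>w. c * g w)"
  by (simp add: fun_eq_iff conv_scale_left conv_one_left)

text \<open>Together with \<open>conv_scalar_left\<close>: scalars are central, so later the
  operators on a module are linear over the field.\<close>

lemma conv_scalar_right: "conv f (\<lambda>w. c * word_tensor [] w) = (\<lambda>w. c * f w)"
proof
  fix w
  have "conv f (\<lambda>w. c * word_tensor [] w) w = c * conv f (word_tensor []) w"
    by (simp add: conv_def sum_distrib_left mult.left_commute)
  then show "conv f (\<lambda>w. c * word_tensor [] w) w = c * f w" by (simp add: conv_one_right)
qed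

lemma conv_letter:
  "conv (word_tensor [x]) (word_tensor w) = (word_tensor (x # w) :: _ \<Rightarrow> 'k::field)"
proof
  fix v show "conv (word_tensor [x]) (word_tensor w) v = (word_tensor (x # w) v :: 'k)"
  proof (cases v)
    case (Cons a u)
    have "(\<lambda>v. word_tensor [x] (a # v)) = (\<lambda>v. (if a = x then 1 else 0) * word_tensor [] v :: 'k)"
      by (simp add: word_tensor_def fun_eq_iff)
    then have "conv (word_tensor [x]) (word_tensor w) (a # u) =
        (word_tensor [x] [] * word_tensor w (a # u) + (if a = x then 1 else 0) * word_tensor w u :: 'k)"
      by (simp only: conv_Cons conv_scalar_left)
    then show ?thesis by (simp add: Cons word_tensor_def)
  qed (simp add: word_tensor_def)
qed

text \<open>The product does not mention \<open>X\<close>, so identities can be proved for arbitrary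
  coefficient functions and membership in the carrier separately.\<close>

lemma mult_tensor: "mult (tensor_algebra X) = conv"
  by (simp add: tensor_algebra_def conv_def fun_eq_iff)

lemma tensor_simps [simp]:
  "one (tensor_algebra X) = word_tensor []"
  "zero (tensor_algebra X) = (\<lambda>w. 0)"
  "add (tensor_algebra X) = (\<lambda>f g w. f w + g w)"
  by (simp_all add: tensor_algebra_def)

lemma tensor_carrier:
  "f \<in> carrier (tensor_algebra X) \<longleftrightarrow> finite {w. f w \<noteq> 0} \<and> {w. f w \<noteq> 0} \<subseteq> lists X"
  by (simp add: tensor_algebra_def)

lemma tensor_carrier_outside:
  "f \<in> carrier (tensor_algebra X) \<Longrightarrow> w \<notin> lists X \<Longrightarrow> f w = 0"
  by (auto simp: tensor_carrier)

lemma tensor_conv_closed: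
  fixes f g :: "'x list \<Rightarrow> 'k::field"
  assumes "f \<in> carrier (tensor_algebra X)" "g \<in> carrier (tensor_algebra X)"
  shows "conv f g \<in> carrier (tensor_algebra X)"
proof -
  have sub: "{w. conv f g w \<noteq> 0} \<subseteq> (\<lambda>(u, v). u @ v) ` ({w. f w \<noteq> 0} \<times> {w. g w \<noteq> 0})"
  proof
    fix w assume "w \<in> {w. conv f g w \<noteq> 0}"
    then obtain i where "f (take i w) * g (drop i w) \<noteq> 0"
      unfolding conv_def by (auto elim: sum.not_neutral_contains_not_neutral)
    then show "w \<in> (\<lambda>(u, v). u @ v) ` ({w. f w \<noteq> 0} \<times> {w. g w \<noteq> 0})"
      by (intro image_eqI[of _ _ "(take i w, drop i w)"]) auto
  qed
  have "(\<lambda>(u, v). u @ v) ` ({w. f w \<noteq> 0} \<times> {w. g w \<noteq> 0}) \<subseteq> lists X"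
    using assms unfolding tensor_carrier by (auto 0 3 simp del: in_lists_conv_set)
  with assms show ?thesis
    unfolding tensor_carrier by (intro conjI finite_subset[OF sub] subset_trans[OF sub]) auto
qed

lemma tensor_add_closed:
  assumes "f \<in> carrier (tensor_algebra X)" "g \<in> carrier (tensor_algebra X)"
  shows "(\<lambda>w. f w + g w) \<in> carrier (tensor_algebra X)"
proof -
  have sub: "{w. f w + g w \<noteq> 0} \<subseteq> {w. f w \<noteq> 0} \<union> {w. g w \<noteq> 0}" by auto
  with assms show ?thesis
    unfolding tensor_carrier using finite_subset[OF sub] by auto
qed

lemma tensor_scale_closed:
  "f \<in> carrier (tensor_algebra X) \<Longrightarrow> (\<lambda>w. c * f w) \<in> carrier (tensor_algebra X)"
  unfolding tensor_carrier by (auto intro: finite_subset[of _ "{w. f w \<noteq> 0}"])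

lemma word_tensor_closed: "w \<in> lists X \<Longrightarrow> word_tensor w \<in> carrier (tensor_algebra X)"
  by (auto simp: tensor_carrier word_tensor_def)

lemma tensor_zero_closed: "(\<lambda>w. 0) \<in> carrier (tensor_algebra X)"
  by (simp add: tensor_carrier)

lemma ring_tensor_algebra: "ring (tensor_algebra X :: ('x list \<Rightarrow> 'k::field) ring)"
proof (intro ringI abelian_groupI monoidI)
  fix f :: "'x list \<Rightarrow> 'k" assume f: "f \<in> carrier (tensor_algebra X)"
  show "\<exists>g\<in>carrier (tensor_algebra X). g \<oplus>\<^bsub>tensor_algebra X\<^esub> f = \<zero>\<^bsub>tensor_algebra X\<^esub>"
    by (rule bexI[OF _ tensor_scale_closed[OF f, of "- 1"]]) simp
qed (simp_all add: mult_tensor tensor_add_closed tensor_zero_closed tensor_conv_closed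
  word_tensor_closed conv_add_left conv_add_right conv_assoc conv_one_left conv_one_right
  add.assoc add.commute fun_eq_iff)

lemma tensor_minus:
  assumes "f \<in> carrier (tensor_algebra X)"
  shows "\<ominus>\<^bsub>tensor_algebra X\<^esub> f = (\<lambda>w. - f w)"
proof -
  interpret ring "tensor_algebra X" by (rule ring_tensor_algebra)
  have "(\<lambda>w. - f w) \<in> carrier (tensor_algebra X)"
    using tensor_scale_closed[OF assms, of "- 1"] by simp
  with assms show ?thesis by (intro minus_equality) simp_all
qed

section \<open>Expansion in words and induction on tensors\<close>

lemma word_expansion:
  assumes "finite {w. f w \<noteq> 0}"
  shows "f = (\<lambda>u. \<Sum>w | f w \<noteq> 0. f w * word_tensor w u)"
proof
  fix u
  have "(\<Sum>w | f w \<noteq> 0. f w * word_tensor w u) = (\<Sum>w | f w \<noteq> 0. if w = u then f w else 0)"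
    by (intro sum.cong) (auto simp: word_tensor_def)
  also have "\<dots> = f u" using assms by (simp add: sum.delta)
  finally show "f u = (\<Sum>w | f w \<noteq> 0. f w * word_tensor w u)" ..
qed

text \<open>Scalars and letters generate the tensor algebra as a ring. The rule reduces stability of
  a subgroup of a module under the whole algebra to scalars and letters.\<close>

lemma tensor_algebra_induct [consumes 1, case_names zero add scalar letter mult]:
  fixes f :: "'x list \<Rightarrow> 'k::field"
  assumes f: "f \<in> carrier (tensor_algebra X)"
    and zero: "P (\<lambda>w. 0)"
    and add: "\<And>f g. f \<in> carrier (tensor_algebra X) \<Longrightarrow> g \<in> carrier (tensor_algebra X) \<Longrightarrow>
      P f \<Longrightarrow> P g \<Longrightarrow> P (\<lambda>w. f w + g w)"
    and scalar: "\<And>c. P (\<lambda>w. c * word_tensor [] w)"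
    and letter: "\<And>x. x \<in> X \<Longrightarrow> P (word_tensor [x])"
    and mult: "\<And>f g. f \<in> carrier (tensor_algebra X) \<Longrightarrow> g \<in> carrier (tensor_algebra X) \<Longrightarrow>
      P f \<Longrightarrow> P g \<Longrightarrow> P (conv f g)"
  shows "P f"
proof -
  have word: "P (word_tensor w)" if "w \<in> lists X" for w
    using that
  proof (induction w rule: list.induct)
    case Nil
    show ?case using scalar[of 1] by simp
  next
    case (Cons x w)
    then show ?case
      using mult[of "word_tensor [x]" "word_tensor w"] letter[of x]
      by (simp add: conv_letter word_tensor_closed)
  qed
  have monomial: "P (\<lambda>u. c * word_tensor w u)" if "w \<in> lists X" for c w
    using mult[of "\<lambda>w. c * word_tensor [] w" "word_tensor w"] scalar[of c] word[OF that] that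
    by (simp add: conv_scalar_left word_tensor_closed tensor_scale_closed)
  have "(\<lambda>u. \<Sum>w\<in>W. f w * word_tensor w u) \<in> carrier (tensor_algebra X) \<and>
      P (\<lambda>u. \<Sum>w\<in>W. f w * word_tensor w u)" if "finite W" "W \<subseteq> lists X" for W
    using that
  proof (induction W rule: finite_induct)
    case empty
    then show ?case by (simp add: zero tensor_zero_closed)
  next
    case (insert w W)
    then have "w \<in> lists X" by simp
    with insert show ?case
      using add[OF tensor_scale_closed[OF word_tensor_closed[of w X]], of _ "f w"] monomial[of w "f w"]
      by (simp add: tensor_add_closed tensor_scale_closed word_tensor_closed)
  qed
  from this[of "{w. f w \<noteq> 0}"] f have "P (\<lambda>u. \<Sum>w | f w \<noteq> 0. f w * word_tensor w u)"
    by (auto simp: tensor_carrier)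
  with f show ?thesis using word_expansion[of f] by (simp add: tensor_carrier)
qed


section \<open>Racks with a cocycle and skew derivations\<close>

locale rack_cocycle =
  fixes X :: "'x rack" (structure) and q :: "'x \<Rightarrow> 'x \<Rightarrow> 'k::field"
  assumes finite_carrier: "finite (carrier X)"
    and act_closed: "x \<in> carrier X \<Longrightarrow> y \<in> carrier X \<Longrightarrow> x \<rhd> y \<in> carrier X"
    and act_inj: "x \<in> carrier X \<Longrightarrow> inj_on (act X x) (carrier X)"
    and act_distrib: "x \<in> carrier X \<Longrightarrow> y \<in> carrier X \<Longrightarrow> z \<in> carrier X \<Longrightarrow>
      x \<rhd> (y \<rhd> z) = (x \<rhd> y) \<rhd> (x \<rhd> z)"
    and cocycle: "x \<in> carrier X \<Longrightarrow> y \<in> carrier X \<Longrightarrow> z \<in> carrier X \<Longrightarrow>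
      q x (y \<rhd> z) * q y z = q (x \<rhd> y) (x \<rhd> z) * q x z"
begin

text \<open>Left translations are bijective because the carrier is finite, and this is their
  inverse; only its values on the carrier are meaningful.\<close>

definition linv :: "'x \<Rightarrow> 'x \<Rightarrow> 'x" where
  "linv a x = inv_into (carrier X) (act X a) x"

lemma act_image: "a \<in> carrier X \<Longrightarrow> act X a ` carrier X = carrier X"
  using endo_inj_surj[OF finite_carrier, of "act X a"] act_closed act_inj by auto

lemma linv_closed: "a \<in> carrier X \<Longrightarrow> x \<in> carrier X \<Longrightarrow> linv a x \<in> carrier X"
  unfolding linv_def using act_image by (metis inv_into_into)

lemma act_linv: "a \<in> carrier X \<Longrightarrow> x \<in> carrier X \<Longrightarrow> a \<rhd> linv a x = x"
  unfolding linv_def using act_image by (metis f_inv_into_f)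

lemma linv_eq_iff:
  "a \<in> carrier X \<Longrightarrow> x \<in> carrier X \<Longrightarrow> y \<in> carrier X \<Longrightarrow> linv a x = y \<longleftrightarrow> x = a \<rhd> y"
  using act_linv act_inj linv_closed by (metis inj_onD)

text \<open>
  \<open>skew_deriv x f\<close> is the component $f_x$ of
  $(I + c_1 + c_1c_2 + \dots + c_1 \cdots c_n) f = \sum_x x \otimes f_x$.
\<close>

fun skew_deriv :: "'x \<Rightarrow> ('x list \<Rightarrow> 'k) \<Rightarrow> 'x list \<Rightarrow> 'k" where
  "skew_deriv x f [] = f [x]"
| "skew_deriv x f (a # v) =
     f (x # a # v) + q a (linv a x) * skew_deriv (linv a x) (\<lambda>w. f (a # w)) v"

lemma skew_deriv_add:
  "skew_deriv x (\<lambda>w. f w + g w) v = skew_deriv x f v + skew_deriv x g v"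
proof (induction v arbitrary: x f g rule: list.induct)
  case (Cons a v)
  show ?case by (simp add: Cons distrib_left)
qed simp

lemma skew_deriv_scale: "skew_deriv x (\<lambda>w. c * f w) v = c * skew_deriv x f v"
  by (induction x f v rule: skew_deriv.induct) (simp_all add: algebra_simps)

text \<open>A derivative at \<open>v\<close> reads only words over the rack that are one letter
  longer than \<open>v\<close>. This also isolates homogeneous parts later.\<close>

lemma skew_deriv_cong:
  assumes "\<And>w. w \<in> lists (carrier X) \<Longrightarrow> length w = Suc (length v) \<Longrightarrow> f w = g w"
    and "v \<in> lists (carrier X)" "x \<in> carrier X"
  shows "skew_deriv x f v = skew_deriv x g v"
  using assms
proof (induction v arbitrary: x f g rule: list.induct)
  case (Cons a v)
  have "skew_deriv (linv a x) (\<lambda>w. f (a # w)) v = skew_deriv (linv a x) (\<lambda>w. g (a # w)) v"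
    using Cons.prems linv_closed by (intro Cons.IH) auto
  with Cons.prems show ?case by simp
qed simp

text \<open>The first letter of \<open>u\<close> is differentiated first, in the order in which the
  symmetrizer splits off tensor factors. With this order the value at \<open>[]\<close> is a
  coefficient of the symmetrizer at \<open>u\<close> and not at its reverse.\<close>

fun skew_derivs :: "'x list \<Rightarrow> ('x list \<Rightarrow> 'k) \<Rightarrow> 'x list \<Rightarrow> 'k" where
  "skew_derivs [] f = f"
| "skew_derivs (x # u) f = skew_derivs u (skew_deriv x f)"

lemma skew_derivs_add:
  "skew_derivs u (\<lambda>w. f w + g w) v = skew_derivs u f v + skew_derivs u g v"
proof (induction u arbitrary: f g rule: list.induct)
  case (Cons x u)
  have "skew_deriv x (\<lambda>w. f w + g w) = (\<lambda>v. skew_deriv x f v + skew_deriv x g v)"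
    by (simp add: fun_eq_iff skew_deriv_add)
  then show ?case by (simp add: Cons)
qed simp

lemma skew_derivs_scale: "skew_derivs u (\<lambda>w. c * f w) v = c * skew_derivs u f v"
proof (induction u arbitrary: f rule: list.induct)
  case (Cons x u)
  have "skew_deriv x (\<lambda>w. c * f w) = (\<lambda>v. c * skew_deriv x f v)"
    by (simp add: fun_eq_iff skew_deriv_scale)
  then show ?case by (simp add: Cons)
qed simp

lemma skew_derivs_zero: "skew_derivs u (\<lambda>w. 0) v = 0"
  using skew_derivs_scale[of u 0 "\<lambda>w. 0" v] by simp

lemma skew_derivs_sum:
  "skew_derivs u (\<lambda>w. \<Sum>i\<in>A. f i w) v = (\<Sum>i\<in>A. skew_derivs u (f i) v)"
  by (induction A rule: infinite_finite_induct) (simp_all add: skew_derivs_zero skew_derivs_add)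

lemma skew_derivs_cong:
  assumes "\<And>w. w \<in> lists (carrier X) \<Longrightarrow> length w = length u + length v \<Longrightarrow> f w = g w"
    and "v \<in> lists (carrier X)" "u \<in> lists (carrier X)"
  shows "skew_derivs u f v = skew_derivs u g v"
  using assms
proof (induction u arbitrary: f g rule: list.induct)
  case (Cons x u)
  have "skew_derivs u (skew_deriv x f) v = skew_derivs u (skew_deriv x g) v"
  proof (rule Cons.IH)
    fix w assume "w \<in> lists (carrier X)" "length w = length u + length v"
    then show "skew_deriv x f w = skew_deriv x g w"
      using Cons.prems(3) by (intro skew_deriv_cong Cons.prems(1)) auto
  qed (use Cons.prems in auto)
  then show ?case by simp
qed simp

section \<open>Moving letters past words and the twisted Leibniz rule\<close>

definition word_act :: "'x list \<Rightarrow> 'x \<Rightarrow> 'x" where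
  "word_act w y = foldr (act X) w y"

primrec word_coeff :: "'x list \<Rightarrow> 'x \<Rightarrow> 'k" where
  "word_coeff [] y = 1"
| "word_coeff (x # w) y = q x (word_act w y) * word_coeff w y"

lemma word_act_simps [simp]: "word_act [] y = y" "word_act (x # w) y = x \<rhd> word_act w y"
  by (simp_all add: word_act_def)

lemma word_act_closed: "w \<in> lists (carrier X) \<Longrightarrow> y \<in> carrier X \<Longrightarrow> word_act w y \<in> carrier X"
  by (induction w) (auto intro: act_closed)

text \<open>
  Moving a letter \<open>y\<close> from right to left past \<open>w\<close> produces
  \<open>word_coeff w y\<close> times the letter \<open>word_act w y\<close> followed by \<open>w\<close>;
  \<open>twist x y\<close> selects the words for which the result begins with \<open>x\<close>.
\<close>

definition twist :: "'x \<Rightarrow> 'x \<Rightarrow> ('x list \<Rightarrow> 'k) \<Rightarrow> 'x list \<Rightarrow> 'k" where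
  "twist x y f w = (if word_act w y = x then word_coeff w y * f w else 0)"

lemma twist_Cons:
  assumes "a \<in> carrier X" "w \<in> lists (carrier X)" "x \<in> carrier X" "y \<in> carrier X"
  shows "twist x y f (a # w) = q a (linv a x) * twist (linv a x) y (\<lambda>v. f (a # v)) w"
  using assms word_act_closed[OF assms(2,4)] linv_eq_iff[of a x "word_act w y"]
  by (auto simp: twist_def)

text \<open>A letter taken out of the right factor must pass the whole left factor, which changes
  it. Hence the sum over all original letters \<open>y\<close>, where \<open>twist x y\<close> keeps
  the words of \<open>f\<close> that turn \<open>y\<close> into \<open>x\<close>.\<close>

lemma skew_deriv_conv:
  assumes "v \<in> lists (carrier X)" "x \<in> carrier X"
  shows "skew_deriv x (conv f g) v =
    conv (skew_deriv x f) g v + (\<Sum>y\<in>carrier X. conv (twist x y f) (skew_deriv y g) v)"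
  using assms
proof (induction v arbitrary: x f rule: list.induct)
  case Nil
  have "(\<Sum>y\<in>carrier X. twist x y f [] * g [y]) = (\<Sum>y\<in>carrier X. if y = x then f [] * g [x] else 0)"
    by (intro sum.cong) (auto simp: twist_def)
  also have "\<dots> = f [] * g [x]" using Nil finite_carrier by simp
  finally show ?case by (simp add: conv_Cons)
next
  case (Cons a u)
  define z where "z = linv a x"
  have X: "a \<in> carrier X" "u \<in> lists (carrier X)" "x \<in> carrier X" "z \<in> carrier X"
    using Cons.prems linv_closed[of a x] by (auto simp: z_def)
  let ?fa = "\<lambda>v. f (a # v)" and ?ga = "\<lambda>v. g (a # v)"
  \<comment> \<open>The empty prefix contributes only for \<open>y = x\<close>. In the other
    prefixes the moving letter passes \<open>a\<close> last, and must be \<open>z\<close> just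
    before.\<close>
  have "conv (twist x y f) (skew_deriv y g) (a # u) =
      (if y = x then f [] * skew_deriv x g (a # u) else 0) +
      q a z * conv (twist z y ?fa) (skew_deriv y g) u" if "y \<in> carrier X" for y
  proof -
    have "conv (\<lambda>v. twist x y f (a # v)) (skew_deriv y g) u =
        conv (\<lambda>v. q a z * twist z y ?fa v) (skew_deriv y g) u"
      using X that by (intro conv_cong_left[where A = "carrier X"]) (auto simp: twist_Cons z_def)
    moreover have "twist x y f [] = (if y = x then f [] else 0)" by (simp add: twist_def)
    ultimately show ?thesis by (simp add: conv_Cons conv_scale_left)
  qed
  then have S: "(\<Sum>y\<in>carrier X. conv (twist x y f) (skew_deriv y g) (a # u)) =
      f [] * skew_deriv x g (a # u) +
      q a z * (\<Sum>y\<in>carrier X. conv (twist z y ?fa) (skew_deriv y g) u)"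
    using X finite_carrier by (simp add: sum.distrib sum_distrib_left)
  have L: "skew_deriv z (\<lambda>w. conv f g (a # w)) u =
      f [] * skew_deriv z ?ga u + skew_deriv z (conv ?fa g) u"
    by (simp add: conv_Cons skew_deriv_add skew_deriv_scale)
  have D: "conv (skew_deriv x f) g (a # u) = f [x] * g (a # u) +
      (conv (\<lambda>v. f (x # a # v)) g u + q a z * conv (skew_deriv z ?fa) g u)"
    by (simp add: conv_Cons z_def conv_add_left conv_scale_left)
  show ?case
    using Cons.IH[OF X(2,4), of ?fa]
    by (simp add: S D L z_def[symmetric]) (simp add: conv_Cons algebra_simps)
qed

text \<open>The braid equation in terms of coefficients: letting \<open>y\<close> pass a word and
  then extracting \<open>z\<close> amounts to extracting \<open>z\<close> first, letting
  \<open>y\<close> pass the rest, and finally passing \<open>z\<close>.\<close>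

lemma skew_deriv_twist:
  assumes "v \<in> lists (carrier X)" "x \<in> carrier X" "y \<in> carrier X" "z \<in> carrier X"
  shows "skew_deriv z (twist x y f) v =
    q z (linv z x) * twist (linv z x) y (skew_deriv z f) v"
  using assms
proof (induction v arbitrary: x z f rule: list.induct)
  case Nil
  then show ?case using linv_eq_iff[of z x y] by (auto simp: twist_def)
next
  case (Cons a u)
  define t s x' where "t = linv a z" and "s = linv a x" and "x' = linv z x"
  define r where "r = linv t s"
  have X: "a \<in> carrier X" "u \<in> lists (carrier X)" "x \<in> carrier X" "y \<in> carrier X" "z \<in> carrier X"
    "t \<in> carrier X" "s \<in> carrier X" "x' \<in> carrier X" "r \<in> carrier X"
    using Cons.prems linv_closed by (auto simp: t_def s_def x'_def r_def)
  have e: "a \<rhd> t = z" "a \<rhd> s = x" "z \<rhd> x' = x" "t \<rhd> r = s"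
    using X act_linv by (auto simp: t_def s_def x'_def r_def)
  \<comment> \<open>The letter \<open>r\<close> ends as \<open>x\<close> whether it passes
    \<open>t\<close> and then \<open>a\<close>, or \<open>a\<close> and then \<open>z\<close>. The
    cocycle identity at \<open>a\<close>, \<open>t\<close>, \<open>r\<close> equates the
    coefficients of the two routes.\<close>
  have "z \<rhd> (a \<rhd> r) = z \<rhd> x'" using act_distrib[of a t r] X e by simp
  then have x': "a \<rhd> r = x'" using X act_inj[of z] act_closed by (auto dest: inj_onD)
  then have r: "linv a x' = r" using X linv_eq_iff by simp
  have co: "q a s * q t r = q z x' * q a r" using cocycle[of a t r] X e x' by simp
  let ?fa = "\<lambda>v. f (a # v)" and ?faa = "\<lambda>v. f (z # a # v)"
  have 1: "twist x y f (z # a # u) = q z x' * (q a r * twist r y ?faa u)"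
    using X r by (simp add: twist_Cons x'_def)
  have "skew_deriv t (\<lambda>w. twist x y f (a # w)) u = skew_deriv t (\<lambda>w. q a s * twist s y ?fa w) u"
    using X by (intro skew_deriv_cong) (auto simp: twist_Cons s_def)
  then have 2: "skew_deriv t (\<lambda>w. twist x y f (a # w)) u =
      q a s * (q t r * twist r y (skew_deriv t ?fa) u)"
    using Cons.IH[of s t ?fa] X by (simp add: skew_deriv_scale r_def)
  have 3: "twist x' y (skew_deriv z f) (a # u) = q a r *
      (twist r y ?faa u + q a t * twist r y (skew_deriv t ?fa) u)"
    using X r by (simp add: twist_Cons t_def[symmetric]) (simp add: twist_def algebra_simps)
  have "skew_deriv z (twist x y f) (a # u) = q z x' * (q a r * twist r y ?faa u) +
      q a t * ((q a s * q t r) * twist r y (skew_deriv t ?fa) u)"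
    using 1 2 by (simp add: t_def mult.assoc)
  then show ?case unfolding co x'_def[symmetric] 3 by (simp add: algebra_simps)
qed

section \<open>The two-sided ideal of tensors with vanishing derivatives\<close>

definition null :: "('x list \<Rightarrow> 'k) set" where
  "null = {f. \<forall>u\<in>lists (carrier X). skew_derivs u f [] = 0}"

lemma null_skew_deriv: "f \<in> null \<Longrightarrow> x \<in> carrier X \<Longrightarrow> skew_deriv x f \<in> null"
  unfolding null_def by (simp flip: skew_derivs.simps(2))

text \<open>A derivative of a twist is a multiple of a twist of a derivative with another target
  letter, so the induction has to vary both \<open>f\<close> and \<open>x\<close>.\<close>

lemma null_twist:
  assumes "f \<in> null" "x \<in> carrier X" "y \<in> carrier X"
  shows "twist x y f \<in> null"
proof -
  have "skew_derivs u (twist x y f) [] = 0" if "u \<in> lists (carrier X)" for u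
    using that assms
  proof (induction u arbitrary: f x rule: list.induct)
    case Nil
    then have "f [] = 0" by (auto simp: null_def dest: bspec[of _ _ "[]"])
    then show ?case by (simp add: twist_def)
  next
    case (Cons z u)
    let ?x = "linv z x"
    have "skew_derivs u (skew_deriv z (twist x y f)) [] =
        skew_derivs u (\<lambda>v. q z ?x * twist ?x y (skew_deriv z f) v) []"
      using Cons.prems by (intro skew_derivs_cong skew_deriv_twist) auto
    also have "\<dots> = q z ?x * skew_derivs u (twist ?x y (skew_deriv z f)) []"
      by (rule skew_derivs_scale)
    also have "\<dots> = 0"
      using Cons.prems by (simp add: Cons.IH null_skew_deriv linv_closed)
    finally show ?case by simp
  qed
  then show ?thesis by (simp add: null_def)
qed

lemma skew_derivs_conv_Cons:
  assumes "u \<in> lists (carrier X)" "x \<in> carrier X"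
  shows "skew_derivs (x # u) (conv f g) [] =
    skew_derivs u (conv (skew_deriv x f) g) [] +
    (\<Sum>y\<in>carrier X. skew_derivs u (conv (twist x y f) (skew_deriv y g)) [])"
proof -
  have "skew_derivs (x # u) (conv f g) [] = skew_derivs u (\<lambda>v. conv (skew_deriv x f) g v +
      (\<Sum>y\<in>carrier X. conv (twist x y f) (skew_deriv y g) v)) []"
    using assms by (auto intro!: skew_derivs_cong skew_deriv_conv)
  then show ?thesis by (simp add: skew_derivs_add skew_derivs_sum)
qed

text \<open>Every summand of the Leibniz rule keeps a left factor in \<open>null\<close>, by
  stability under derivatives and twists.\<close>

lemma null_conv_left:
  assumes "f \<in> null" shows "conv f g \<in> null"
proof -
  have "skew_derivs u (conv f g) [] = 0" if "u \<in> lists (carrier X)" for u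
    using that assms
  proof (induction u arbitrary: f g rule: list.induct)
    case Nil
    then show ?case by (auto simp: null_def dest: bspec[of _ _ "[]"])
  next
    case (Cons x u)
    then show ?case
      by (subst skew_derivs_conv_Cons) (simp_all add: null_skew_deriv null_twist)
  qed
  then show ?thesis by (simp add: null_def)
qed

text \<open>Here the right factor stays in \<open>null\<close>; the left one is arbitrary and
  absorbs the twists.\<close>

lemma null_conv_right:
  assumes "g \<in> null" shows "conv f g \<in> null"
proof -
  have "skew_derivs u (conv f g) [] = 0" if "u \<in> lists (carrier X)" for u
    using that assms
  proof (induction u arbitrary: f g rule: list.induct)
    case Nil
    then show ?case by (auto simp: null_def dest: bspec[of _ _ "[]"])
  next
    case (Cons x u)
    then show ?case
      by (subst skew_derivs_conv_Cons) (simp_all add: null_skew_deriv)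
  qed
  then show ?thesis by (simp add: null_def)
qed

end


section \<open>The defining ideal of a Nichols algebra\<close>

context rack_cocycle
begin

lemma tensor_power_iff:
  "f \<in> tensor_power (carrier X) n \<longleftrightarrow>
    (\<forall>w. f w \<noteq> 0 \<longrightarrow> w \<in> lists (carrier X) \<and> length w = n)"
proof
  assume "\<forall>w. f w \<noteq> 0 \<longrightarrow> w \<in> lists (carrier X) \<and> length w = n"
  moreover from this have "finite {w. f w \<noteq> 0}"
    by (intro finite_subset[OF _ finite_lists_length_eq[OF finite_carrier, of n]]) auto
  ultimately show "f \<in> tensor_power (carrier X) n"
    by (auto simp: tensor_power_def tensor_carrier)
qed (auto simp: tensor_power_def tensor_carrier)

lemma tensor_power_Cons:
  "f \<in> tensor_power (carrier X) (Suc n) \<Longrightarrow> (\<lambda>v. f (a # v)) \<in> tensor_power (carrier X) n"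
  by (auto simp: tensor_power_iff)

text \<open>The braiding permutes words up to scalars, so exactly one word contributes to the
  coefficient at \<open>u\<close>: the one obtained by undoing the exchange.\<close>

lemma braiding_apply:
  assumes f: "f \<in> tensor_power (carrier X) n" and i: "Suc i < n"
  shows "braiding X q i f u =
    (if u \<in> lists (carrier X) \<and> length u = n
     then q (u ! Suc i) (linv (u ! Suc i) (u ! i)) *
       f (u[i := u ! Suc i, Suc i := linv (u ! Suc i) (u ! i)])
     else 0)"
proof -
  let ?t = "\<lambda>w. w[i := (w ! i) \<rhd> (w ! Suc i), Suc i := w ! i]"
  have supp: "w \<in> lists (carrier X) \<and> length w = n" if "f w \<noteq> 0" for w
    using f that by (simp add: tensor_power_iff)
  have fin: "finite {w. f w \<noteq> 0}"
    using f by (simp add: tensor_power_def tensor_carrier)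
  show ?thesis
  proof (cases "u \<in> lists (carrier X) \<and> length u = n")
    case True
    define b x where "b = u ! Suc i" and "x = linv b (u ! i)"
    have mem: "b \<in> carrier X" "u ! i \<in> carrier X" "x \<in> carrier X"
      using True i linv_closed by (auto simp: b_def x_def in_lists_conv_set)
    let ?w = "u[i := b, Suc i := x]"
    have eq: "?t w = u \<longleftrightarrow> w = ?w" if w: "w \<in> lists (carrier X)" "length w = n" for w
    proof
      assume "?t w = u"
      then have "u ! i = (w ! i) \<rhd> (w ! Suc i)" "b = w ! i"
        using w i unfolding b_def by (auto simp: nth_list_update)
      moreover have "w ! i \<in> carrier X" "w ! Suc i \<in> carrier X"
        using w i by (auto simp: in_lists_conv_set)
      ultimately have "x = w ! Suc i" unfolding x_def using mem linv_eq_iff by simp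
      then show "w = ?w" using w i \<open>b = w ! i\<close> \<open>?t w = u\<close>
        by (intro nth_equalityI) (auto simp: nth_list_update)
    next
      assume "w = ?w"
      then have "w ! i = b" "w ! Suc i = x" using True i by (auto simp: nth_list_update)
      then show "?t w = u" using True i \<open>w = ?w\<close> act_linv[OF mem(1,2)]
        by (intro nth_equalityI) (auto simp: nth_list_update b_def x_def)
    qed
    have at: "?w ! i = b" "?w ! Suc i = x" using True i by (auto simp: nth_list_update)
    have "braiding X q i f u = (\<Sum>w | f w \<noteq> 0. if w = ?w then f ?w * q b x else 0)"
      unfolding braiding_def linear_extension_def
    proof (intro sum.cong refl)
      fix w assume "w \<in> {w. f w \<noteq> 0}"
      then have "?t w = u \<longleftrightarrow> w = ?w" using supp eq by simp
      then show "f w * (q (w ! i) (w ! Suc i) * word_tensor (?t w) u) =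
          (if w = ?w then f ?w * q b x else 0)"
        using at by (cases "w = ?w") (simp_all add: word_tensor_def)
    qed
    also have "\<dots> = q b x * f ?w" using fin by simp
    finally show ?thesis using True by (simp add: b_def x_def)
  next
    case False
    have "u \<noteq> ?t w" if "f w \<noteq> 0" for w
    proof -
      from supp[OF that] have w: "\<forall>j<n. w ! j \<in> carrier X" "length w = n" by auto
      then have "\<forall>j<n. ?t w ! j \<in> carrier X"
        using i act_closed by (auto simp: nth_list_update)
      with w have "?t w \<in> lists (carrier X) \<and> length (?t w) = n"
        by (auto simp: in_set_conv_nth)
      with False show ?thesis by auto
    qed
    then have "braiding X q i f u = 0"
      unfolding braiding_def linear_extension_def
      by (intro sum.neutral) (simp add: word_tensor_def)
    with False show ?thesis by auto
  qed
qed

lemma braiding_zero: "braiding X q i (\<lambda>w. 0) = (\<lambda>w. 0)"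
  by (simp add: braiding_def linear_extension_def)

lemma braiding_closed:
  assumes "f \<in> tensor_power (carrier X) n" "Suc i < n"
  shows "braiding X q i f \<in> tensor_power (carrier X) n"
  unfolding tensor_power_iff by (simp add: braiding_apply[OF assms])

lemma braiding_Suc_Cons:
  assumes f: "f \<in> tensor_power (carrier X) (Suc n)" and i: "Suc i < n"
  shows "braiding X q (Suc i) f (a # w) = braiding X q i (\<lambda>v. f (a # v)) w"
proof (cases "a \<in> carrier X")
  case True
  then show ?thesis
    using braiding_apply[OF f, of "Suc i"] braiding_apply[OF tensor_power_Cons[OF f] i] i by simp
next
  case False
  then have "f (a # v) = 0" for v using f by (auto simp: tensor_power_iff)
  then show ?thesis
    using False braiding_apply[OF f, of "Suc i"] i by (simp add: braiding_zero)
qed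

lemma braiding_chain_closed:
  "f \<in> tensor_power (carrier X) n \<Longrightarrow> k < n \<Longrightarrow>
    braiding_chain X q k f \<in> tensor_power (carrier X) n"
  by (induction k arbitrary: f) (auto intro: braiding_closed)

text \<open>The chain is defined by appending its last factor. An induction on words must isolate
  c_1 instead; the other factors then act behind the first letter.\<close>

lemma braiding_chain_Suc:
  assumes "f \<in> tensor_power (carrier X) (Suc n)" "k < n"
  shows "braiding_chain X q (Suc k) f = braiding X q 0 (id_tensor (braiding_chain X q k) f)"
  using assms
proof (induction k arbitrary: f)
  case 0
  then have "f [] = 0" by (auto simp: tensor_power_iff)
  then have "id_tensor id f = f" by (auto simp: id_tensor_def fun_eq_iff split: list.split)
  then show ?case by (simp add: id_def)
next
  case (Suc k)
  have "(\<lambda>v. braiding X q (Suc k) f (a # v)) = braiding X q k (\<lambda>v. f (a # v))" for a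
    using braiding_Suc_Cons[OF Suc.prems(1)] Suc.prems(2) by (simp add: fun_eq_iff)
  then have "id_tensor (braiding_chain X q k) (braiding X q (Suc k) f) =
      id_tensor (braiding_chain X q (Suc k)) f"
    by (simp add: id_tensor_def fun_eq_iff split: list.split)
  then show ?case
    using Suc.IH[OF braiding_closed[OF Suc.prems(1)], of "Suc k"] Suc.prems(2) by (simp add: comp_def)
qed

text \<open>The summand k = 0 is the coefficient of \<open>f\<close> itself. All others share the
  factor of c_1, and what remains is the same sum for the tail: this is the recursion of
  \<open>skew_deriv\<close>.\<close>

lemma sum_braiding_chain:
  assumes "f \<in> tensor_power (carrier X) (Suc n)" "x \<in> carrier X"
    "v \<in> lists (carrier X)" "length v = n"
  shows "(\<Sum>k\<le>n. braiding_chain X q k f (x # v)) = skew_deriv x f v"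
  using assms
proof (induction n arbitrary: f x v)
  case (Suc n)
  from Suc.prems obtain a u where v: "v = a # u" "a \<in> carrier X" "u \<in> lists (carrier X)" "length u = n"
    by (cases v) auto
  let ?x = "linv a x" and ?f = "\<lambda>w. f (a # w)"
  have x: "?x \<in> carrier X" using Suc.prems v linv_closed by simp
  have f: "?f \<in> tensor_power (carrier X) (Suc n)" by (rule tensor_power_Cons[OF Suc.prems(1)])
  have "braiding_chain X q (Suc k) f (x # a # u) = q a ?x * braiding_chain X q k ?f (?x # u)"
    if "k \<le> n" for k
  proof -
    have "id_tensor (braiding_chain X q k) f \<in> tensor_power (carrier X) (Suc (Suc n))"
      unfolding tensor_power_iff
    proof (intro allI impI)
      fix w assume w: "id_tensor (braiding_chain X q k) f w \<noteq> 0"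
      then obtain b t where bt: "w = b # t" by (cases w) (auto simp: id_tensor_def)
      have "braiding_chain X q k (\<lambda>v. f (b # v)) \<in> tensor_power (carrier X) (Suc n)"
        using that by (intro braiding_chain_closed tensor_power_Cons Suc.prems) simp
      then have t: "t \<in> lists (carrier X)" "length t = Suc n"
        using w bt unfolding tensor_power_iff by (auto simp: id_tensor_def)
      have "b \<in> carrier X"
      proof (rule ccontr)
        assume "b \<notin> carrier X"
        then have "(\<lambda>v. f (b # v)) = (\<lambda>v. 0)"
          using Suc.prems(1) by (auto simp: tensor_power_iff fun_eq_iff)
        moreover have "braiding_chain X q k (\<lambda>v. 0) = (\<lambda>v. 0)" for k
          by (induction k) (simp_all add: braiding_zero)
        ultimately show False using w bt by (simp add: id_tensor_def)
      qed
      with t bt show "w \<in> lists (carrier X) \<and> length w = Suc (Suc n)" by auto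
    qed
    from braiding_apply[OF this, of 0 "x # a # u"] show ?thesis
      using Suc.prems v that by (simp add: braiding_chain_Suc[OF Suc.prems(1)] id_tensor_def
          del: braiding_chain.simps)
  qed
  then have "(\<Sum>k\<le>n. braiding_chain X q (Suc k) f (x # a # u)) = q a ?x * skew_deriv ?x ?f u"
    using Suc.IH[OF f x v(3,4)] by (simp add: sum_distrib_left[symmetric] del: braiding_chain.simps)
  then show ?case
    unfolding v sum.atMost_Suc_shift by simp
qed simp

text \<open>For a fixed first letter the inner sum is one derivative, and the smaller symmetrizer
  differentiates it along the remaining letters.\<close>

lemma quantum_symmetrizer_eq:
  assumes "f \<in> tensor_power (carrier X) n"
  shows "quantum_symmetrizer X q n f u =
    (if u \<in> lists (carrier X) \<and> length u = n then skew_derivs u f [] else 0)"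
  using assms
proof (induction n arbitrary: f u rule: induct_nat_012)
  case 0
  then show ?case by (auto simp: tensor_power_iff)
next
  case 1
  then show ?case by (auto simp: tensor_power_iff length_Suc_conv)
next
  case (ge2 n)
  show ?case
  proof (cases u)
    case (Cons x v)
    define g where "g = (\<lambda>v. \<Sum>k\<le>Suc n. braiding_chain X q k f (x # v))"
    have chain: "braiding_chain X q k f (x # w) \<noteq> 0 \<Longrightarrow>
        x \<in> carrier X \<and> w \<in> lists (carrier X) \<and> length w = Suc n" if "k \<le> Suc n" for k w
      using braiding_chain_closed[OF ge2.prems, of k] that by (auto simp: tensor_power_iff)
    then have g0: "x \<in> carrier X \<and> w \<in> lists (carrier X) \<and> length w = Suc n" if "g w \<noteq> 0" for w
    proof -
      from that obtain k where "k \<le> Suc n" "braiding_chain X q k f (x # w) \<noteq> 0"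
        unfolding g_def by (metis atMost_iff sum.not_neutral_contains_not_neutral)
      then show ?thesis by (rule chain)
    qed
    then have "g \<in> tensor_power (carrier X) (Suc n)" by (simp add: tensor_power_iff)
    note IH = ge2.IH(2)[OF this, of v]
    have "quantum_symmetrizer X q (Suc (Suc n)) f u = quantum_symmetrizer X q (Suc n) g v"
      by (simp add: Cons id_tensor_def g_def)
    also have "\<dots> = (if u \<in> lists (carrier X) \<and> length u = Suc (Suc n) then skew_derivs u f [] else 0)"
    proof (cases "x \<in> carrier X")
      case True
      have "skew_derivs v g [] = skew_derivs v (skew_deriv x f) []"
        if "v \<in> lists (carrier X)" "length v = Suc n"
        using that True ge2.prems
        by (intro skew_derivs_cong) (simp_all add: g_def sum_braiding_chain del: sum.atMost_Suc)
      with IH True show ?thesis by (simp add: Cons)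
    next
      case False
      with g0 have "g = (\<lambda>w. 0)" by (auto simp: fun_eq_iff)
      with IH False show ?thesis by (simp add: Cons skew_derivs_zero)
    qed
    finally show ?thesis .
  qed (simp add: id_tensor_def)
qed

text \<open>The derivative along \<open>u\<close> at the empty word sees only the part of degree
  \<open>length u\<close>, so the conditions in all degrees merge into one.\<close>

lemma nichols_ideal_eq: "nichols_ideal X q = carrier (tensor_algebra (carrier X)) \<inter> null"
proof -
  have "(\<forall>n. quantum_symmetrizer X q n (homogeneous_part n f) = (\<lambda>w. 0)) \<longleftrightarrow> f \<in> null"
    if f: "f \<in> carrier (tensor_algebra (carrier X))" for f
  proof -
    have "homogeneous_part n f \<in> tensor_power (carrier X) n" for n
      using tensor_carrier_outside[OF f] by (auto simp: tensor_power_iff homogeneous_part_def)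
    note qs = quantum_symmetrizer_eq[OF this]
    have "skew_derivs u (homogeneous_part n f) [] = skew_derivs u f []"
      if "u \<in> lists (carrier X)" "length u = n" for u n
      using that by (intro skew_derivs_cong) (auto simp: homogeneous_part_def)
    then show ?thesis by (auto simp: fun_eq_iff qs null_def)
  qed
  then show ?thesis by (auto simp: nichols_ideal_def)
qed

lemma nichols_ideal_zero: "(\<lambda>w. 0) \<in> nichols_ideal X q"
  by (simp add: nichols_ideal_eq tensor_zero_closed null_def skew_derivs_zero)

lemma ideal_nichols_ideal: "ideal (nichols_ideal X q) (tensor_algebra (carrier X))"
proof (rule idealI[OF ring_tensor_algebra])
  interpret T: ring "tensor_algebra (carrier X) :: ('x list \<Rightarrow> 'k) ring"
    by (rule ring_tensor_algebra)
  show "subgroup (nichols_ideal X q) (add_monoid (tensor_algebra (carrier X)))"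
  proof (rule T.add.subgroupI)
    fix f g :: "'x list \<Rightarrow> 'k" assume "f \<in> nichols_ideal X q" "g \<in> nichols_ideal X q"
    then show "f \<oplus>\<^bsub>tensor_algebra (carrier X)\<^esub> g \<in> nichols_ideal X q"
      by (simp add: nichols_ideal_eq tensor_add_closed null_def skew_derivs_add)
  next
    fix f :: "'x list \<Rightarrow> 'k" assume f: "f \<in> nichols_ideal X q"
    then have "(\<lambda>w. - 1 * f w) \<in> nichols_ideal X q"
      unfolding nichols_ideal_eq null_def by (simp only: Int_iff tensor_scale_closed
        skew_derivs_scale mem_Collect_eq) simp
    with f show "\<ominus>\<^bsub>tensor_algebra (carrier X)\<^esub> f \<in> nichols_ideal X q"
      by (simp add: nichols_ideal_eq tensor_minus)
  qed (use nichols_ideal_zero in \<open>auto simp: nichols_ideal_eq\<close>)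
next
  fix f g :: "'x list \<Rightarrow> 'k"
  assume "f \<in> nichols_ideal X q" "g \<in> carrier (tensor_algebra (carrier X))"
  then show "g \<otimes>\<^bsub>tensor_algebra (carrier X)\<^esub> f \<in> nichols_ideal X q"
    and "f \<otimes>\<^bsub>tensor_algebra (carrier X)\<^esub> g \<in> nichols_ideal X q"
    by (simp_all add: nichols_ideal_eq mult_tensor tensor_conv_closed null_conv_left null_conv_right)
qed

section \<open>The Nichols algebra as a quotient ring\<close>

definition proj :: "('x list \<Rightarrow> 'k) \<Rightarrow> ('x list \<Rightarrow> 'k) set" where
  "proj f = nichols_ideal X q +>\<^bsub>tensor_algebra (carrier X)\<^esub> f"

lemma nichols_simps:
  "carrier (nichols_algebra X q) = proj ` carrier (tensor_algebra (carrier X))"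
  "one (nichols_algebra X q) = proj (word_tensor [])"
  "zero (nichols_algebra X q) = proj (\<lambda>w. 0)"
  "scalar (nichols_algebra X q) c = proj (\<lambda>w. c * word_tensor [] w)"
  "degree_piece (nichols_algebra X q) n = proj ` tensor_power (carrier X) n"
proof -
  interpret I: ideal "nichols_ideal X q" "tensor_algebra (carrier X)"
    by (rule ideal_nichols_ideal)
  show "zero (nichols_algebra X q) = proj (\<lambda>w. 0)"
    using I.a_rcos_zero[OF ideal_nichols_ideal nichols_ideal_zero]
    by (simp add: nichols_algebra_def FactRing_def Let_def proj_def)
qed (auto simp: nichols_algebra_def FactRing_def Let_def proj_def A_RCOSETS_def' image_def)

lemma proj_add:
  assumes "f \<in> carrier (tensor_algebra (carrier X))" "g \<in> carrier (tensor_algebra (carrier X))"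
  shows "proj f \<oplus>\<^bsub>nichols_algebra X q\<^esub> proj g = proj (\<lambda>w. f w + g w)"
proof -
  interpret I: ideal "nichols_ideal X q" "tensor_algebra (carrier X)"
    by (rule ideal_nichols_ideal)
  show ?thesis
    using I.a_rcos_sum[OF assms] by (simp add: nichols_algebra_def FactRing_def Let_def proj_def)
qed

lemma proj_mult:
  assumes "f \<in> carrier (tensor_algebra (carrier X))" "g \<in> carrier (tensor_algebra (carrier X))"
  shows "proj f \<otimes>\<^bsub>nichols_algebra X q\<^esub> proj g = proj (conv f g)"
proof -
  interpret I: ideal "nichols_ideal X q" "tensor_algebra (carrier X)"
    by (rule ideal_nichols_ideal)
  show ?thesis
    using I.rcoset_mult_add[OF assms]
    by (simp add: nichols_algebra_def FactRing_def Let_def proj_def mult_tensor)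
qed

lemma proj_self:
  assumes "f \<in> carrier (tensor_algebra (carrier X))" shows "f \<in> proj f"
proof -
  interpret I: ideal "nichols_ideal X q" "tensor_algebra (carrier X)"
    by (rule ideal_nichols_ideal)
  show ?thesis unfolding proj_def by (rule I.a_rcos_self[OF assms])
qed

lemma proj_memD:
  assumes "g \<in> proj f" obtains h where "h \<in> nichols_ideal X q" "g = (\<lambda>w. h w + f w)"
  using assms unfolding proj_def by (auto simp: a_r_coset_def')

lemma proj_ideal:
  assumes "f \<in> nichols_ideal X q" shows "proj f = proj (\<lambda>w. 0)"
proof -
  interpret I: ideal "nichols_ideal X q" "tensor_algebra (carrier X)"
    by (rule ideal_nichols_ideal)
  show ?thesis unfolding proj_def
    using I.a_rcos_const[OF assms] I.a_rcos_const[OF nichols_ideal_zero] by simp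
qed

text \<open>The algebra is a larger record than the quotient ring, so the axioms are verified anew
  on representatives.\<close>

lemma ring_nichols_algebra: "ring (nichols_algebra X q)"
proof -
  interpret T: ring "tensor_algebra (carrier X) :: ('x list \<Rightarrow> 'k) ring"
    by (rule ring_tensor_algebra)
  have conv_eqs: "conv (conv f g) h = conv f (conv g h)"
    "conv (word_tensor []) f = f" "conv f (word_tensor []) = f"
    "conv (\<lambda>w. f w + g w) h = (\<lambda>w. conv f h w + conv g h w)"
    "conv f (\<lambda>w. g w + h w) = (\<lambda>w. conv f g w + conv f h w)" for f g h :: "'x list \<Rightarrow> 'k"
    by (simp_all add: fun_eq_iff conv_assoc conv_one_left conv_one_right conv_add_left conv_add_right)
  show ?thesis
  proof (intro ringI abelian_groupI monoidI)
    fix a assume "a \<in> carrier (nichols_algebra X q)"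
    then obtain f where f: "a = proj f" "f \<in> carrier (tensor_algebra (carrier X))"
      by (auto simp: nichols_simps)
    then show "\<exists>b\<in>carrier (nichols_algebra X q).
        b \<oplus>\<^bsub>nichols_algebra X q\<^esub> a = \<zero>\<^bsub>nichols_algebra X q\<^esub>"
      using tensor_scale_closed[OF f(2), of "- 1"]
      by (intro bexI[of _ "proj (\<lambda>w. - 1 * f w)"])
        (auto simp: nichols_simps proj_add simp del: mult_minus_left mult_minus1)
  qed (auto simp: nichols_simps proj_add proj_mult tensor_add_closed tensor_conv_closed
      tensor_zero_closed word_tensor_closed add_ac conv_eqs)
qed

end


section \<open>Truncated point modules as sequences of points\<close>

text \<open>
  In a truncated point module with homogeneous basis $m_0, m_1, \dots$, a letter \<open>x\<close> acts by
  $x\, m_i = \alpha_i(x)\, m_{i+1}$; then the word \<open>w\<close> sends $m_j$ to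
  \<open>path \<alpha> j w\<close> times $m_{j + |w|}$.
\<close>

primrec path :: "(nat \<Rightarrow> 'x \<Rightarrow> 'k::field) \<Rightarrow> nat \<Rightarrow> 'x list \<Rightarrow> 'k" where
  "path \<alpha> j [] = 1"
| "path \<alpha> j (x # w) = \<alpha> (j + length w) x * path \<alpha> j w"

locale point_module = rack_cocycle X q for X :: "'x rack" and q :: "'x \<Rightarrow> 'x \<Rightarrow> 'k::field" +
  fixes M :: "(('x list \<Rightarrow> 'k) set, 'm) graded_module" and n :: nat
  assumes truncated: "truncated_point_module n (nichols_algebra X q) M"
begin

abbreviation "A \<equiv> nichols_algebra X q"
abbreviation "T \<equiv> carrier (tensor_algebra (carrier X) :: ('x list \<Rightarrow> 'k) ring)"

lemma graded: "graded_left_module A M"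
  using truncated by (simp add: truncated_point_module_def)

sublocale L: left_module A M
  using graded by (simp add: graded_left_module_def)

definition op :: "('x list \<Rightarrow> 'k) \<Rightarrow> 'm \<Rightarrow> 'm" where
  "op f v = proj f \<odot>\<^bsub>M\<^esub> v"

text \<open>A module carries no separate action of the field; scalars act through degree zero of the
  algebra.\<close>

definition scale :: "'k \<Rightarrow> 'm \<Rightarrow> 'm" where
  "scale c v = op (\<lambda>w. c * word_tensor [] w) v"

lemma proj_closed: "f \<in> T \<Longrightarrow> proj f \<in> carrier A"
  by (simp add: nichols_simps)

lemma unit_closed: "(\<lambda>w. c * word_tensor [] w) \<in> T"
  by (simp add: tensor_scale_closed word_tensor_closed)

lemma op_closed: "f \<in> T \<Longrightarrow> v \<in> carrier M \<Longrightarrow> op f v \<in> carrier M"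
  by (simp add: op_def L.smult_closed proj_closed)

lemma op_add:
  "f \<in> T \<Longrightarrow> g \<in> T \<Longrightarrow> v \<in> carrier M \<Longrightarrow> op (\<lambda>w. f w + g w) v = op f v \<oplus>\<^bsub>M\<^esub> op g v"
  by (simp add: op_def L.smult_l_distr proj_closed flip: proj_add)

lemma op_add_right:
  "f \<in> T \<Longrightarrow> u \<in> carrier M \<Longrightarrow> v \<in> carrier M \<Longrightarrow> op f (u \<oplus>\<^bsub>M\<^esub> v) = op f u \<oplus>\<^bsub>M\<^esub> op f v"
  by (simp add: op_def L.smult_r_distr proj_closed)

lemma op_conv: "f \<in> T \<Longrightarrow> g \<in> T \<Longrightarrow> v \<in> carrier M \<Longrightarrow> op (conv f g) v = op f (op g v)"
  by (simp add: op_def L.smult_assoc proj_closed flip: proj_mult)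

lemma op_zero: "v \<in> carrier M \<Longrightarrow> op (\<lambda>w. 0) v = \<zero>\<^bsub>M\<^esub>"
  using op_add[of "\<lambda>w. 0" "\<lambda>w. 0" v] op_closed[of "\<lambda>w. 0" v]
  by (simp add: tensor_zero_closed)

lemma op_ideal: "f \<in> nichols_ideal X q \<Longrightarrow> v \<in> carrier M \<Longrightarrow> op f v = \<zero>\<^bsub>M\<^esub>"
  using op_zero by (simp add: op_def proj_ideal)

lemma op_zero_right: "f \<in> T \<Longrightarrow> op f \<zero>\<^bsub>M\<^esub> = \<zero>\<^bsub>M\<^esub>"
  using op_add_right[of f "\<zero>\<^bsub>M\<^esub>" "\<zero>\<^bsub>M\<^esub>"] op_closed[of f "\<zero>\<^bsub>M\<^esub>"] by simp

lemma op_finsum: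
  assumes "f \<in> T" "finite J" "p \<in> J \<rightarrow> carrier M"
  shows "op f (finsum M p J) = finsum M (\<lambda>i. op f (p i)) J"
  using assms(2,3)
proof (induction J rule: finite_induct)
  case (insert i J)
  then have "(\<lambda>i. op f (p i)) \<in> J \<rightarrow> carrier M" "op f (p i) \<in> carrier M"
    using assms(1) op_closed by auto
  with insert assms(1) show ?case by (simp add: op_add_right)
qed (simp add: op_zero_right[OF assms(1)])

lemma scale_closed: "v \<in> carrier M \<Longrightarrow> scale c v \<in> carrier M"
  by (simp add: scale_def op_closed unit_closed)

lemma scale_zero: "v \<in> carrier M \<Longrightarrow> scale 0 v = \<zero>\<^bsub>M\<^esub>"
  by (simp add: scale_def op_zero)

lemma scale_zero_right: "scale c \<zero>\<^bsub>M\<^esub> = \<zero>\<^bsub>M\<^esub>"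
  by (simp add: scale_def op_zero_right unit_closed)

lemma scale_one: "v \<in> carrier M \<Longrightarrow> scale 1 v = v"
  using L.smult_one[of v] by (simp add: scale_def op_def nichols_simps)

lemma scale_add: "v \<in> carrier M \<Longrightarrow> scale (c + d) v = scale c v \<oplus>\<^bsub>M\<^esub> scale d v"
  by (simp add: scale_def unit_closed distrib_right flip: op_add)

lemma op_scale: "f \<in> T \<Longrightarrow> v \<in> carrier M \<Longrightarrow> op (\<lambda>w. c * f w) v = scale c (op f v)"
  by (simp add: scale_def unit_closed conv_scalar_left flip: op_conv)

lemma scale_op: "f \<in> T \<Longrightarrow> v \<in> carrier M \<Longrightarrow> op f (scale c v) = scale c (op f v)"
  by (simp add: scale_def unit_closed conv_scalar_left conv_scalar_right flip: op_conv)

lemma scale_scale: "v \<in> carrier M \<Longrightarrow> scale c (scale d v) = scale (c * d) v"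
  using op_scale[of "\<lambda>w. d * word_tensor [] w" v c]
  by (simp add: scale_def unit_closed mult.assoc)

section \<open>Graded pieces and their bases\<close>

lemma piece_subgroup: "subgroup (piece M i) (add_monoid M)"
  using graded by (simp add: graded_left_module_def)

lemma piece_carrier: "v \<in> piece M i \<Longrightarrow> v \<in> carrier M"
  using subgroup.subset[OF piece_subgroup] by auto

lemma piece_zero: "\<zero>\<^bsub>M\<^esub> \<in> piece M i"
  using subgroup.one_closed[OF piece_subgroup] by simp

lemma piece_add: "u \<in> piece M i \<Longrightarrow> v \<in> piece M i \<Longrightarrow> u \<oplus>\<^bsub>M\<^esub> v \<in> piece M i"
  using subgroup.m_closed[OF piece_subgroup] by simp

lemma piece_op: "f \<in> tensor_power (carrier X) m \<Longrightarrow> v \<in> piece M i \<Longrightarrow> op f v \<in> piece M (int m + i)"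
  using graded by (simp add: graded_left_module_def op_def nichols_simps)

lemma piece_letter:
  assumes "x \<in> carrier X" "v \<in> piece M i"
  shows "op (word_tensor [x]) v \<in> piece M (i + 1)"
proof -
  have "word_tensor [x] \<in> tensor_power (carrier X) 1"
    using assms(1) by (auto simp: tensor_power_iff word_tensor_def)
  from piece_op[OF this assms(2)] show ?thesis by (simp add: add.commute)
qed

lemma piece_scale:
  assumes "v \<in> piece M i" shows "scale c v \<in> piece M i"
proof -
  have "(\<lambda>w. c * word_tensor [] w) \<in> tensor_power (carrier X) 0"
    by (auto simp: tensor_power_iff word_tensor_def)
  from piece_op[OF this assms] show ?thesis by (simp add: scale_def)
qed

text \<open>The grading axiom sums over the exact support of a family. A common finite index set
  makes families with different supports comparable.\<close>

lemma decomposition_unique: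
  assumes "\<And>i. f i \<in> piece M i" "\<And>i. g i \<in> piece M i" "finite J"
    "\<And>i. i \<notin> J \<Longrightarrow> f i = \<zero>\<^bsub>M\<^esub>" "\<And>i. i \<notin> J \<Longrightarrow> g i = \<zero>\<^bsub>M\<^esub>"
    "finsum M f J = finsum M g J"
  shows "f = g"
proof -
  have *: "finite {i. h i \<noteq> \<zero>\<^bsub>M\<^esub>} \<and> finsum M h {i. h i \<noteq> \<zero>\<^bsub>M\<^esub>} = finsum M h J"
    if h: "\<And>i. h i \<in> piece M i" "\<And>i. i \<notin> J \<Longrightarrow> h i = \<zero>\<^bsub>M\<^esub>" for h
  proof -
    have "{i. h i \<noteq> \<zero>\<^bsub>M\<^esub>} \<subseteq> J" using h(2) by auto
    then show ?thesis
      using assms(3) finite_subset piece_carrier[OF h(1)]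
      by (intro conjI L.M.add.finprod_mono_neutral_cong_left) auto
  qed
  have "finsum M f J \<in> carrier M" using piece_carrier[OF assms(1)] by (intro L.M.finsum_closed) auto
  then have "\<exists>!h. (\<forall>i. h i \<in> piece M i) \<and> finite {i. h i \<noteq> \<zero>\<^bsub>M\<^esub>} \<and>
      finsum M f J = finsum M h {i. h i \<noteq> \<zero>\<^bsub>M\<^esub>}"
    using graded unfolding graded_left_module_def by blast
  moreover have "finsum M f J = finsum M f {i. f i \<noteq> \<zero>\<^bsub>M\<^esub>}" "finite {i. f i \<noteq> \<zero>\<^bsub>M\<^esub>}"
    using *[of f] assms by auto
  moreover have "finsum M f J = finsum M g {i. g i \<noteq> \<zero>\<^bsub>M\<^esub>}" "finite {i. g i \<noteq> \<zero>\<^bsub>M\<^esub>}"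
    using *[of g] assms by auto
  ultimately show "f = g" using assms(1,2) by blast
qed

text \<open>A coordinate function that is extensional on one index is the same as its value at 0, so
  uniqueness passes to scalars.\<close>

lemma piece_basis:
  assumes "i \<le> n"
  shows "\<exists>e\<in>piece M (int i). \<forall>v\<in>piece M (int i). \<exists>!c. v = scale c e"
proof -
  have "has_dimension A M (piece M (int i)) 1"
  proof -
    have "has_dimension A M (piece M (int i)) (if 0 \<le> int i \<and> int i \<le> int n then 1 else 0)"
      using truncated unfolding truncated_point_module_def by blast
    with assms show ?thesis by simp
  qed
  then obtain b :: "nat \<Rightarrow> 'm" where b: "b 0 \<in> piece M (int i)"
    and u: "\<And>v. v \<in> piece M (int i) \<Longrightarrow> \<exists>!c. c \<in> extensional {..<1} \<and>
      v = (\<Oplus>\<^bsub>M\<^esub>j \<in> {..<1::nat}. scalar A (c j) \<odot>\<^bsub>M\<^esub> b j)"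
    unfolding has_dimension_def by auto
  have S: "{..<1} = {0::nat}" by auto
  have fs: "(\<Oplus>\<^bsub>M\<^esub>j \<in> {..<1::nat}. scalar A (c j) \<odot>\<^bsub>M\<^esub> b j) = scale (c 0) (b 0)" for c
    using scale_closed[OF piece_carrier[OF b]] unfolding S
    by (simp add: scale_def op_def nichols_simps)
  show ?thesis
  proof (intro bexI[of _ "b 0"] ballI b)
    fix v assume v: "v \<in> piece M (int i)"
    from u[OF v] obtain c :: "nat \<Rightarrow> 'k" where c: "v = scale (c 0) (b 0)"
      and uniq: "\<And>d. d \<in> extensional {..<1} \<Longrightarrow> v = scale (d 0) (b 0) \<Longrightarrow> d = c"
      unfolding fs Ex1_def by blast
    show "\<exists>!c. v = scale c (b 0)"
    proof (intro ex1I)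
      show "v = scale (c 0) (b 0)" by (rule c)
      fix d assume "v = scale d (b 0)"
      then have "(\<lambda>j\<in>{..<1::nat}. d) = c" by (intro uniq) auto
      from fun_cong[OF this, of 0] show "d = c 0" by simp
    qed
  qed
qed

text \<open>Generation in degree zero makes each \<open>\<alpha> i\<close> nonzero, since otherwise
  nothing would reach degree i + 1; elements of the ideal act as zero, which gives the
  equations.\<close>

theorem point_sequence:
  obtains \<alpha> :: "nat \<Rightarrow> 'x \<Rightarrow> 'k"
  where "\<And>i. i < n \<Longrightarrow> \<exists>x\<in>carrier X. \<alpha> i x \<noteq> 0"
    and "\<And>f m j. f \<in> nichols_ideal X q \<Longrightarrow> f \<in> tensor_power (carrier X) m \<Longrightarrow> j + m \<le> n \<Longrightarrow>
      (\<Sum>w | f w \<noteq> 0. f w * path \<alpha> j w) = 0"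
proof -
  have "\<exists>e. \<forall>i\<le>n. e i \<in> piece M (int i) \<and> (\<forall>v\<in>piece M (int i). \<exists>!c. v = scale c (e i))"
    using piece_basis by (intro choice) blast
  then obtain e where
    basis: "\<forall>i\<le>n. e i \<in> piece M (int i) \<and> (\<forall>v\<in>piece M (int i). \<exists>!c. v = scale c (e i))" ..
  then have e: "e i \<in> piece M (int i)" if "i \<le> n" for i
    using that by simp
  have u: "\<exists>!c. v = scale c (e i)" if "i \<le> n" "v \<in> piece M (int i)" for i v
    using basis that by simp
  have eM: "e i \<in> carrier M" if "i \<le> n" for i using e[OF that] by (rule piece_carrier)
  \<comment> \<open>Both \<open>0\<close> and \<open>c\<close> would be the coordinate of the zero
    vector.\<close>
  have zero: "c = 0" if "scale c (e i) = \<zero>\<^bsub>M\<^esub>" "i \<le> n" for c i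
    using u[OF that(2) piece_zero] that scale_zero[OF eM[OF that(2)]] by metis
  have "\<exists>\<alpha>. \<forall>i x. i < n \<longrightarrow> x \<in> carrier X \<longrightarrow>
      op (word_tensor [x]) (e i) = scale (\<alpha> i x) (e (Suc i))"
  proof (intro choice allI)
    fix i x
    show "\<exists>c. i < n \<longrightarrow> x \<in> carrier X \<longrightarrow> op (word_tensor [x]) (e i) = scale c (e (Suc i))"
      using u[of "Suc i" "op (word_tensor [x]) (e i)"] piece_letter[OF _ e, of x i]
      by (auto simp: add.commute)
  qed
  then obtain \<alpha> where \<alpha>: "\<And>i x. i < n \<Longrightarrow> x \<in> carrier X \<Longrightarrow>
      op (word_tensor [x]) (e i) = scale (\<alpha> i x) (e (Suc i))"
    by blast
  have word: "op (word_tensor w) (e j) = scale (path \<alpha> j w) (e (j + length w))"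
    if "w \<in> lists (carrier X)" "j + length w \<le> n" for j w
    using that
  proof (induction w rule: list.induct)
    case Nil
    then show ?case using scale_one[OF eM, of j] by (simp add: scale_def)
  next
    case (Cons x w)
    then have "op (word_tensor (x # w)) (e j) = op (word_tensor [x]) (op (word_tensor w) (e j))"
      unfolding conv_letter[symmetric, of x w]
      by (intro op_conv) (simp_all add: word_tensor_closed eM)
    also have "\<dots> = scale (path \<alpha> j w) (op (word_tensor [x]) (e (j + length w)))"
      using Cons by (simp add: word_tensor_closed eM scale_op)
    also have "\<dots> = scale (path \<alpha> j (x # w)) (e (Suc (j + length w)))"
      using Cons.prems by (simp add: \<alpha> scale_scale eM mult.commute)
    finally show ?case by simp
  qed
  show ?thesis
  proof
    fix j assume j: "j < n"
    show "\<exists>x\<in>carrier X. \<alpha> j x \<noteq> 0"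
    proof (rule ccontr)
      assume "\<not> (\<exists>x\<in>carrier X. \<alpha> j x \<noteq> 0)"
      then have kill: "op (word_tensor [x]) v = \<zero>\<^bsub>M\<^esub>"
        if "x \<in> carrier X" "v \<in> piece M (int j)" for x v
        using u[of j v] that j
        by (auto simp: \<alpha> scale_op word_tensor_closed eM scale_zero scale_zero_right)
      \<comment> \<open>The sum of the pieces of degree 0 to \<open>j\<close>. Letters raise the
        degree by one but kill the piece of degree \<open>j\<close>, so this is a submodule
        containing the generators, hence everything.\<close>
      define N where "N = {finsum M p {0..int j} | p. \<forall>i. p i \<in> piece M i}"
      have sub: "v \<in> carrier M" if "v \<in> N" for v
        using that piece_carrier unfolding N_def by (auto intro!: L.M.finsum_closed)
      have N_add: "v \<oplus>\<^bsub>M\<^esub> v' \<in> N" if "v \<in> N" "v' \<in> N" for v v'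
      proof -
        from that obtain p p' where p: "\<forall>i. p i \<in> piece M i" "\<forall>i. p' i \<in> piece M i"
          and v: "v = finsum M p {0..int j}" "v' = finsum M p' {0..int j}"
          unfolding N_def by blast
        have "v \<oplus>\<^bsub>M\<^esub> v' = finsum M (\<lambda>i. p i \<oplus>\<^bsub>M\<^esub> p' i) {0..int j}"
          unfolding v using p piece_carrier by (intro L.M.finsum_addf[symmetric]) auto
        then show ?thesis unfolding N_def using p piece_add by blast
      qed
      have pc: "v \<in> N" if "v \<in> piece M i" "0 \<le> i" "i \<le> int j" for v i
      proof -
        let ?p = "\<lambda>k. if i = k then v else \<zero>\<^bsub>M\<^esub>"
        have "finsum M ?p {0..int j} = v"
          using that piece_carrier[OF that(1)] by (intro L.M.add.finprod_singleton) auto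
        moreover have "\<forall>k. ?p k \<in> piece M k"
          using that piece_zero by auto
        ultimately show ?thesis unfolding N_def by (auto intro!: exI[of _ ?p])
      qed
      have fin: "finsum M g J \<in> N" if "finite J" "\<forall>i\<in>J. g i \<in> N" for g and J :: "int set"
        using that
      proof (induction J rule: finite_induct)
        case empty
        then show ?case using pc[OF piece_zero, of 0] by simp
      next
        case (insert i J)
        then show ?case using sub by (subst L.M.finsum_insert) (auto intro: N_add)
      qed
      have stable: "\<forall>v\<in>N. op f v \<in> N" if "f \<in> T" for f
        using that
      proof (induction f rule: tensor_algebra_induct)
        case zero
        show ?case using op_zero sub pc[OF piece_zero, of 0] by simp
      next
        case (add f g)
        then show ?case using op_add sub by (simp add: N_add)
      next
        case (scalar c)
        show ?case
        proof
          fix v assume "v \<in> N"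
          then obtain p where p: "\<forall>i. p i \<in> piece M i" and v: "v = finsum M p {0..int j}"
            unfolding N_def by blast
          have "op (\<lambda>w. c * word_tensor [] w) v = finsum M (\<lambda>i. scale c (p i)) {0..int j}"
            unfolding v scale_def
            by (intro op_finsum unit_closed Pi_I piece_carrier[OF p[rule_format]]) simp
          then show "op (\<lambda>w. c * word_tensor [] w) v \<in> N"
            unfolding N_def using p piece_scale by blast
        qed
      next
        case (letter x)
        show ?case
        proof
          fix v assume "v \<in> N"
          then obtain p where p: "\<forall>i. p i \<in> piece M i" and v: "v = finsum M p {0..int j}"
            unfolding N_def by blast
          have "op (word_tensor [x]) v = finsum M (\<lambda>i. op (word_tensor [x]) (p i)) {0..int j}"
            unfolding v using letter
            by (intro op_finsum word_tensor_closed Pi_I piece_carrier[OF p[rule_format]]) simp_all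
          also have "\<dots> \<in> N"
          proof (intro fin ballI)
            fix i assume i: "i \<in> {0..int j}"
            show "op (word_tensor [x]) (p i) \<in> N"
            proof (cases "i = int j")
              case True
              then show ?thesis using kill letter p pc[OF piece_zero, of 0] by simp
            next
              case False
              then show ?thesis using i letter p by (intro pc[OF piece_letter, of _ _ i]) auto
            qed
          qed simp
          finally show "op (word_tensor [x]) v \<in> N" .
        qed
      next
        case (mult f g)
        then show ?case using op_conv sub by simp
      qed
      have "submodule N A M"
      proof (intro submodule.intro submodule_axioms.intro L.M.add.subgroupI)
        show "N \<noteq> {}" using pc[OF piece_zero, of 0] by auto
        fix v assume v: "v \<in> N"
        have "scale (- 1) v \<oplus>\<^bsub>M\<^esub> v = \<zero>\<^bsub>M\<^esub>"
          using scale_add[of v "- 1" 1] scale_one scale_zero sub[OF v] by simp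
        then have "\<ominus>\<^bsub>M\<^esub> v = scale (- 1) v"
          using sub[OF v] scale_closed by (intro L.M.minus_equality) auto
        then show "\<ominus>\<^bsub>M\<^esub> v \<in> N" using bspec[OF stable[OF unit_closed] v, of "- 1"]
          by (simp only: scale_def)
      next
        fix a v assume "a \<in> carrier A" "v \<in> N"
        then show "a \<odot>\<^bsub>M\<^esub> v \<in> N" using stable by (auto simp: nichols_simps op_def)
      qed (use sub N_add in auto)
      moreover have "piece M 0 \<subseteq> N" using pc[of _ 0] by auto
      ultimately have "N = carrier M"
        using truncated by (auto simp: truncated_point_module_def generated_in_degree_zero_def)
      then have "e (Suc j) \<in> N" using eM j by simp
      then obtain p where p: "\<And>i. p i \<in> piece M i" and ep: "e (Suc j) = finsum M p {0..int j}"
        unfolding N_def by blast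
      \<comment> \<open>Two decompositions of \<open>e (Suc j)\<close>, one living in degrees up to
        \<open>j\<close> and one in degree j + 1; by uniqueness this basis vector is zero.\<close>
      let ?f = "\<lambda>i. if i \<in> {0..int j} then p i else \<zero>\<^bsub>M\<^esub>"
      let ?g = "\<lambda>i. if int (Suc j) = i then e (Suc j) else \<zero>\<^bsub>M\<^esub>"
      have "?f = ?g"
      proof (rule decomposition_unique[where J = "{0..int (Suc j)}"])
        have "finsum M ?f {0..int (Suc j)} = finsum M p {0..int j}"
          using piece_carrier[OF p] by (intro L.M.add.finprod_mono_neutral_cong_right) auto
        moreover have "finsum M ?g {0..int (Suc j)} = e (Suc j)"
          using j eM by (intro L.M.add.finprod_singleton) auto
        ultimately show "finsum M ?f {0..int (Suc j)} = finsum M ?g {0..int (Suc j)}"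
          using ep by simp
      next
        fix i show "?f i \<in> piece M i" using p piece_zero by simp
      next
        fix i show "?g i \<in> piece M i" using e[of "Suc j"] j piece_zero by auto
      qed auto
      from fun_cong[OF this, of "int (Suc j)"] have "e (Suc j) = \<zero>\<^bsub>M\<^esub>" by simp
      then have "(1::'k) = 0" using zero[of 1 "Suc j"] j scale_one[OF eM, of "Suc j"] by simp
      then show False by simp
    qed
  next
    fix f m j
    assume f: "f \<in> nichols_ideal X q" "f \<in> tensor_power (carrier X) m" and jm: "j + m \<le> n"
    have lin: "(\<lambda>u. \<Sum>w\<in>W. f w * word_tensor w u) \<in> T \<and>
        op (\<lambda>u. \<Sum>w\<in>W. f w * word_tensor w u) (e j) =
          scale (\<Sum>w\<in>W. f w * path \<alpha> j w) (e (j + m))"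
      if "finite W" "W \<subseteq> {w. f w \<noteq> 0}" for W
      using that
    proof (induction W rule: finite_induct)
      case empty
      then show ?case using jm by (simp add: tensor_zero_closed op_zero scale_zero eM)
    next
      case (insert w W)
      then have w: "w \<in> lists (carrier X)" "length w = m" using f(2) by (auto simp: tensor_power_iff)
      have "op (\<lambda>u. f w * word_tensor w u) (e j) = scale (f w * path \<alpha> j w) (e (j + m))"
        using w jm by (simp add: op_scale word_tensor_closed eM word scale_scale)
      with insert w jm show ?case
        by (simp add: tensor_add_closed tensor_scale_closed word_tensor_closed op_add eM scale_add)
    qed
    have "finite {w. f w \<noteq> 0}" using f(2) by (simp add: tensor_power_def tensor_carrier)
    with lin[of "{w. f w \<noteq> 0}"] word_expansion[of f]
    have "op f (e j) = scale (\<Sum>w | f w \<noteq> 0. f w * path \<alpha> j w) (e (j + m))" by simp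
    moreover have "op f (e j) = \<zero>\<^bsub>M\<^esub>" using jm by (intro op_ideal f eM) simp
    ultimately show "(\<Sum>w | f w \<noteq> 0. f w * path \<alpha> j w) = 0"
      using jm by (intro zero[of _ "j + m"]) simp_all
  qed
qed

end


section \<open>Relations in degrees two and three\<close>

context rack_cocycle
begin

text \<open>Derivatives along words of length other than \<open>m\<close> read only coefficients in
  the wrong degree.\<close>

lemma nichols_idealI:
  assumes f: "f \<in> tensor_power (carrier X) m"
    and "\<And>u. u \<in> lists (carrier X) \<Longrightarrow> length u = m \<Longrightarrow> skew_derivs u f [] = 0"
  shows "f \<in> nichols_ideal X q"
proof -
  have "skew_derivs u f [] = 0" if u: "u \<in> lists (carrier X)" "length u \<noteq> m" for u
  proof -
    have "skew_derivs u f [] = skew_derivs u (\<lambda>w. 0) []"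
      using f u by (intro skew_derivs_cong) (auto simp: tensor_power_iff)
    then show ?thesis by (simp add: skew_derivs_zero)
  qed
  with assms show ?thesis
    unfolding nichols_ideal_eq null_def tensor_power_def by blast
qed

text \<open>
  A set \<open>Q\<close> of pairs closed under the permutation $(x, y) \mapsto (x \rhd y, x)$ together with
  weights \<open>g\<close> which the braiding multiplies by $-1$, so that
  $\sum_{(x, y) \in Q} g(x, y)\, x \otimes y$ lies in $\ker (I + c)$.
\<close>

definition relation_weights :: "('x \<times> 'x) set \<Rightarrow> ('x \<Rightarrow> 'x \<Rightarrow> 'k) \<Rightarrow> bool" where
  "relation_weights Q g \<longleftrightarrow> Q \<subseteq> carrier X \<times> carrier X \<and>
     (\<forall>(x, y)\<in>Q. (x \<rhd>\<^bsub>X\<^esub> y, x) \<in> Q \<and> g (x \<rhd>\<^bsub>X\<^esub> y) x = - q x y * g x y)"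

definition pair_tensor :: "('x \<times> 'x) set \<Rightarrow> ('x \<Rightarrow> 'x \<Rightarrow> 'k) \<Rightarrow> 'x list \<Rightarrow> 'k" where
  "pair_tensor Q g w = (if length w = 2 \<and> (w ! 0, w ! 1) \<in> Q then g (w ! 0) (w ! 1) else 0)"

lemma pair_tensor_power:
  "relation_weights Q g \<Longrightarrow> pair_tensor Q g \<in> tensor_power (carrier X) 2"
  unfolding tensor_power_iff pair_tensor_def relation_weights_def
  by (auto simp: numeral_2_eq_2 length_Suc_conv split: if_splits)

lemma pair_tensor_ideal:
  assumes "relation_weights Q g"
  shows "pair_tensor Q g \<in> nichols_ideal X q"
proof (rule nichols_idealI[OF pair_tensor_power[OF assms]])
  let ?\<tau> = "\<lambda>(x, y). (x \<rhd>\<^bsub>X\<^esub> y, x)"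
  have Q: "Q \<subseteq> carrier X \<times> carrier X" "?\<tau> ` Q \<subseteq> Q"
    using assms by (auto simp: relation_weights_def)
  then have "finite Q" using finite_carrier by (meson finite_SigmaI finite_subset)
  moreover have "inj_on ?\<tau> Q"
    using Q(1) act_inj by (auto simp: inj_on_def)
  \<comment> \<open>By finiteness, closure under an injective map is invariance. It rules out a pair
    in \<open>Q\<close> whose preimage lies outside \<open>Q\<close>, whose weight nothing would
    cancel.\<close>
  ultimately have surj: "?\<tau> ` Q = Q" using Q(2) by (intro endo_inj_surj)
  fix u assume u: "u \<in> lists (carrier X)" "length u = 2"
  then obtain x y where xy: "u = [x, y]" "x \<in> carrier X" "y \<in> carrier X"
    by (auto simp: numeral_2_eq_2 length_Suc_conv)
  let ?z = "linv y x"
  have z: "?z \<in> carrier X" "y \<rhd>\<^bsub>X\<^esub> ?z = x" using xy linv_closed act_linv by auto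
  have "pair_tensor Q g [x, y] + q y ?z * pair_tensor Q g [y, ?z] = 0"
  proof (cases "(y, ?z) \<in> Q")
    case True
    then have "(x, y) \<in> Q \<and> g x y = - q y ?z * g y ?z"
      using assms z(2) unfolding relation_weights_def by fastforce
    with True show ?thesis by (simp add: pair_tensor_def)
  next
    case False
    have "(x, y) \<notin> Q"
    proof
      assume "(x, y) \<in> Q"
      then have "(x, y) \<in> ?\<tau> ` Q" by (simp only: surj)
      then obtain b where b: "(y, b) \<in> Q" "x = y \<rhd>\<^bsub>X\<^esub> b" by auto
      then have "?z = b" using Q(1) xy linv_eq_iff by auto
      with b(1) False show False by simp
    qed
    with False show ?thesis by (simp add: pair_tensor_def)
  qed
  then show "skew_derivs u (pair_tensor Q g) [] = 0" by (simp add: xy)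
qed

lemma pair_tensor_sum:
  assumes "finite Q"
  shows "(\<Sum>w | pair_tensor Q g w \<noteq> 0. pair_tensor Q g w * h w) = (\<Sum>(x, y)\<in>Q. g x y * h [x, y])"
proof -
  have "{w. pair_tensor Q g w \<noteq> 0} \<subseteq> (\<lambda>(x, y). [x, y]) ` Q"
  proof
    fix w assume "w \<in> {w. pair_tensor Q g w \<noteq> 0}"
    then have "length w = 2" "(w ! 0, w ! 1) \<in> Q"
      by (auto simp: pair_tensor_def split: if_splits)
    then show "w \<in> (\<lambda>(x, y). [x, y]) ` Q"
      by (auto simp: numeral_2_eq_2 length_Suc_conv intro: rev_image_eqI)
  qed
  then have "(\<Sum>w | pair_tensor Q g w \<noteq> 0. pair_tensor Q g w * h w) =
      (\<Sum>w\<in>(\<lambda>(x, y). [x, y]) ` Q. pair_tensor Q g w * h w)"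
    using assms by (intro sum.mono_neutral_left) auto
  also have "\<dots> = (\<Sum>(x, y)\<in>Q. g x y * h [x, y])"
    by (subst sum.reindex) (auto simp: inj_on_def pair_tensor_def intro!: sum.cong)
  finally show ?thesis .
qed

text \<open>The derivative of x^3 by x is (1 + q + q^2) x^2 with q = q_{x,x}, and its other
  derivatives vanish.\<close>

lemma cube_ideal:
  assumes x: "x \<in> carrier X" "x \<rhd>\<^bsub>X\<^esub> x = x" and "1 + q x x + (q x x)\<^sup>2 = 0"
  shows "word_tensor [x, x, x] \<in> nichols_ideal X q"
proof (rule nichols_idealI)
  let ?f = "word_tensor [x, x, x] :: 'x list \<Rightarrow> 'k"
  show "?f \<in> tensor_power (carrier X) 3"
    using x by (auto simp: tensor_power_iff word_tensor_def)
  have D: "skew_deriv a ?f [y, z] = 0" if "a \<in> carrier X" "y \<in> carrier X" "z \<in> carrier X" for a y z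
  proof (cases "y = x \<and> z = x")
    case True
    \<comment> \<open>Translation by \<open>x\<close> fixes \<open>x\<close>, so no other letter
      becomes \<open>x\<close> on the way; for \<open>a = x\<close> the three positions contribute
      1, q and q^2.\<close>
    have "linv x a = x \<longleftrightarrow> a = x" using linv_eq_iff that x by simp
    moreover have "linv x (linv x a) = x \<longleftrightarrow> a = x" using linv_eq_iff linv_closed that x by simp
    ultimately show ?thesis
      using True assms(3) by (auto simp: word_tensor_def power2_eq_square algebra_simps)
  qed (auto simp: word_tensor_def)
  fix u assume "u \<in> lists (carrier X)" "length u = 3"
  then obtain a b c where u: "u = [a, b, c]" "a \<in> carrier X" "b \<in> carrier X" "c \<in> carrier X"
    by (auto simp: numeral_3_eq_3 length_Suc_conv)
  \<comment> \<open>The remaining two derivatives read the first one at exactly these two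
    words.\<close>
  then have "skew_deriv a ?f [b, c] = 0" "skew_deriv a ?f [c, linv c b] = 0"
    using D linv_closed by auto
  then show "skew_derivs u ?f [] = 0" by (simp add: u(1) del: skew_deriv.simps) simp
qed


section \<open>Pairs of points\<close>

text \<open>In the word \<open>[x, y]\<close> the letter \<open>y\<close> acts first, so the earlier
  point \<open>a\<close> is evaluated at \<open>y\<close> and the later point \<open>b\<close> at
  \<open>x\<close>.\<close>

definition point_pair :: "('x \<Rightarrow> 'k) \<Rightarrow> ('x \<Rightarrow> 'k) \<Rightarrow> bool" where
  "point_pair a b \<longleftrightarrow> (\<exists>x\<in>carrier X. a x \<noteq> 0) \<and> (\<exists>x\<in>carrier X. b x \<noteq> 0) \<and>
     (\<forall>Q g. relation_weights Q g \<longrightarrow> (\<Sum>(x, y)\<in>Q. g x y * (b x * a y)) = 0)"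

text \<open>The bridge from modules to the case analysis, which from here on concerns only functions
  on the rack.\<close>

lemma truncated_point_pairs:
  fixes M :: "(('x list \<Rightarrow> 'k) set, 'm) graded_module"
  assumes "truncated_point_module n (nichols_algebra X q) M"
  obtains \<alpha> where "\<And>j. j + 2 \<le> n \<Longrightarrow> point_pair (\<alpha> j) (\<alpha> (Suc j))"
    and "\<And>x. 3 \<le> n \<Longrightarrow> x \<in> carrier X \<Longrightarrow> x \<rhd>\<^bsub>X\<^esub> x = x \<Longrightarrow> 1 + q x x + (q x x)\<^sup>2 = 0 \<Longrightarrow>
      \<alpha> 0 x = 0 \<or> \<alpha> 1 x = 0 \<or> \<alpha> 2 x = 0"
proof -
  interpret point_module X q M n by unfold_locales (rule assms)
  obtain \<alpha> :: "nat \<Rightarrow> 'x \<Rightarrow> 'k" where nz: "\<And>i. i < n \<Longrightarrow> \<exists>x\<in>carrier X. \<alpha> i x \<noteq> 0"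
    and rel: "\<And>f m j. f \<in> nichols_ideal X q \<Longrightarrow> f \<in> tensor_power (carrier X) m \<Longrightarrow> j + m \<le> n \<Longrightarrow>
      (\<Sum>w | f w \<noteq> 0. f w * path \<alpha> j w) = 0"
    using point_sequence by blast
  show ?thesis
  proof
    fix j assume j: "j + 2 \<le> n"
    have "(\<Sum>(x, y)\<in>Q. g x y * (\<alpha> (Suc j) x * \<alpha> j y)) = 0" if Q: "relation_weights Q g" for Q g
    proof -
      have "finite Q" using Q finite_carrier unfolding relation_weights_def
        by (meson finite_SigmaI finite_subset)
      from pair_tensor_sum[OF this, of g "path \<alpha> j"]
        rel[OF pair_tensor_ideal[OF Q] pair_tensor_power[OF Q] j]
      show ?thesis by (simp add: case_prod_unfold)
    qed
    with nz j show "point_pair (\<alpha> j) (\<alpha> (Suc j))" by (simp add: point_pair_def)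
  next
    fix x assume n: "3 \<le> n" and x: "x \<in> carrier X" "x \<rhd>\<^bsub>X\<^esub> x = x" "1 + q x x + (q x x)\<^sup>2 = 0"
    have "word_tensor [x, x, x] \<in> tensor_power (carrier X) 3"
      using x by (auto simp: tensor_power_iff word_tensor_def)
    from rel[OF cube_ideal[OF x] this, of 0] n
    have "(\<Sum>w | (word_tensor [x, x, x] w :: 'k) \<noteq> 0. word_tensor [x, x, x] w * path \<alpha> 0 w) = 0"
      by simp
    moreover have "{w. (word_tensor [x, x, x] w :: 'k) \<noteq> 0} = {[x, x, x]}"
      by (auto simp: word_tensor_def)
    ultimately show "\<alpha> 0 x = 0 \<or> \<alpha> 1 x = 0 \<or> \<alpha> 2 x = 0"
      by (auto simp: word_tensor_def numeral_2_eq_2)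
  qed
qed

text \<open>Any module of length at least 2 has a pair of points in degrees 0 and 1, so all these
  lengths are settled together.\<close>

lemma point_space_empty:
  assumes "\<And>a b. \<not> point_pair a b" "2 \<le> n"
  shows "point_space TYPE('m) n (nichols_algebra X q) = {}"
proof -
  have "\<not> truncated_point_module n (nichols_algebra X q) (M :: (_, 'm) graded_module)" for M
    using assms truncated_point_pairs[of n M] by (metis add_0)
  then show ?thesis by (simp add: point_space_def quotient_def)
qed

section \<open>Relations from braiding orbits of length one to four\<close>

lemma point_pair_square:
  assumes "point_pair a b" "x \<in> carrier X" "x \<rhd>\<^bsub>X\<^esub> x = x" "q x x = - 1"
  shows "b x = 0 \<or> a x = 0"
proof -
  have "relation_weights {(x, x)} (\<lambda>_ _. 1)" using assms by (simp add: relation_weights_def)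
  with assms(1) have "(\<Sum>(x, y)\<in>{(x, x)}. 1 * (b x * a y)) = 0"
    unfolding point_pair_def by blast
  then show ?thesis by simp
qed

text \<open>The weights 1 and -q_{x,y} are consistent around the orbit exactly when q_{x,y} q_{y,x}
  = 1.\<close>

lemma point_pair_commute:
  assumes "point_pair a b" "x \<in> carrier X" "y \<in> carrier X" "x \<noteq> y"
    and "x \<rhd>\<^bsub>X\<^esub> y = y" "y \<rhd>\<^bsub>X\<^esub> x = x" "q x y * q y x = 1"
  shows "b x * a y = q x y * (b y * a x)"
proof -
  define g where "g = (\<lambda>u v. if (u, v) = (x, y) then 1 else - q x y)"
  have "relation_weights {(x, y), (y, x)} g"
    using assms by (auto simp: relation_weights_def g_def mult.commute)
  with assms(1) have "(\<Sum>(u, v)\<in>{(x, y), (y, x)}. g u v * (b u * a v)) = 0"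
    unfolding point_pair_def by blast
  with assms(4) show ?thesis by (simp add: g_def)
qed

text \<open>Each step along the orbit multiplies the weight by minus a cocycle value; after three
  steps it is 1 again exactly when the product of the values is -1.\<close>

lemma point_pair_braid:
  assumes "point_pair a b" "x \<in> carrier X" "y \<in> carrier X" "x \<noteq> y" "x \<rhd>\<^bsub>X\<^esub> x = x"
    and "x \<rhd>\<^bsub>X\<^esub> y = z" "z \<rhd>\<^bsub>X\<^esub> z = z" "z \<rhd>\<^bsub>X\<^esub> x = y" "y \<rhd>\<^bsub>X\<^esub> z = x" "q x y * q z x * q y z = - 1"
  shows "b x * a y - q x y * (b z * a x) + q x y * q z x * (b y * a z) = 0"
proof -
  have z: "z \<in> carrier X" using assms act_closed by metis
  have ne: "z \<noteq> x" using assms act_inj[of x] by (metis inj_onD)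
  then have "z \<noteq> y" using assms z act_inj[of z] by (metis inj_onD)
  define g where
    "g = (\<lambda>u v. if (u, v) = (x, y) then 1 else if (u, v) = (z, x) then - q x y else q x y * q z x)"
  have "q y z * (q x y * q z x) = - 1" using assms(10) by (simp add: mult_ac)
  then have "relation_weights {(x, y), (z, x), (y, z)} g"
    using assms(2-9) z ne \<open>z \<noteq> y\<close> by (auto simp: relation_weights_def g_def mult.commute)
  with assms(1) have "(\<Sum>(u, v)\<in>{(x, y), (z, x), (y, z)}. g u v * (b u * a v)) = 0"
    unfolding point_pair_def by blast
  with assms(4) ne \<open>z \<noteq> y\<close> show ?thesis by (auto simp: g_def algebra_simps)
qed

text \<open>For the constant cocycle -1 the weights do not change along an orbit, so all four
  coefficients are 1.\<close>

lemma point_pair_four: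
  assumes "point_pair a b" "{x, y, z, w} \<subseteq> carrier X" "distinct [x, y, z, w]"
    and "x \<rhd>\<^bsub>X\<^esub> y = z" "z \<rhd>\<^bsub>X\<^esub> x = w" "w \<rhd>\<^bsub>X\<^esub> z = y" "y \<rhd>\<^bsub>X\<^esub> w = x"
    and "\<And>u v. q u v = - 1"
  shows "b x * a y + b z * a x + b w * a z + b y * a w = 0"
proof -
  have "relation_weights {(x, y), (z, x), (w, z), (y, w)} (\<lambda>_ _. 1)"
    using assms(2-8) by (simp add: relation_weights_def)
  with assms(1) have "(\<Sum>(u, v)\<in>{(x, y), (z, x), (w, z), (y, w)}. 1 * (b u * a v)) = 0"
    unfolding point_pair_def by blast
  with assms(3) show ?thesis by (simp add: algebra_simps)
qed

text \<open>The map (x, y) to (x \<rhd> y, x) is back at its start after three steps, with a cocycle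
  product that admits weights.\<close>

definition braided_pair :: "'x \<Rightarrow> 'x \<Rightarrow> bool" where
  "braided_pair x y \<longleftrightarrow> (let z = x \<rhd>\<^bsub>X\<^esub> y in
     z \<rhd>\<^bsub>X\<^esub> x = y \<and> y \<rhd>\<^bsub>X\<^esub> z = x \<and> q x y * q z x * q y z = - 1)"

definition commuting_pair :: "'x \<Rightarrow> 'x \<Rightarrow> bool" where
  "commuting_pair x y \<longleftrightarrow> x \<rhd>\<^bsub>X\<^esub> y = y \<and> y \<rhd>\<^bsub>X\<^esub> x = x \<and> q x y * q y x = 1"

text \<open>
  The relations \<open>x\<^sup>2 = 0\<close> make the supports of \<open>a\<close> and \<open>b\<close> disjoint, and then every other relation
  involving \<open>b x * a y\<close> reduces to this single term.
\<close>

lemma no_point_pair: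
  assumes idem: "\<And>x. x \<in> carrier X \<Longrightarrow> x \<rhd>\<^bsub>X\<^esub> x = x \<and> q x x = - 1"
    and pairs: "\<And>x y. x \<in> carrier X \<Longrightarrow> y \<in> carrier X \<Longrightarrow> x \<noteq> y \<Longrightarrow>
      commuting_pair x y \<or> braided_pair x y"
  shows "\<not> point_pair a b"
proof
  assume p: "point_pair a b"
  then obtain x y where x: "x \<in> carrier X" "b x \<noteq> 0" and y: "y \<in> carrier X" "a y \<noteq> 0"
    by (auto simp: point_pair_def)
  have 0: "a x = 0" "b y = 0" using point_pair_square[OF p] idem x y by auto
  then have "x \<noteq> y" using x by auto
  with pairs[OF x(1) y(1)] consider "commuting_pair x y" | "braided_pair x y" by blast
  then show False
  proof cases
    case 1
    with point_pair_commute[OF p x(1) y(1) \<open>x \<noteq> y\<close>] 0 x y show False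
      by (simp add: commuting_pair_def)
  next
    case 2
    with point_pair_braid[OF p x(1) y(1) \<open>x \<noteq> y\<close>, of "x \<rhd>\<^bsub>X\<^esub> y"] 0 x y idem act_closed
    show False by (simp add: braided_pair_def Let_def)
  qed
qed

text \<open>
  Only the supports \<open>A\<close>, \<open>B\<close> of the two points matter for the absence of 3-truncated point modules:
  no relation may reduce to a single term.
\<close>

definition support_pair :: "'x set \<Rightarrow> 'x set \<Rightarrow> bool" where
  "support_pair A B \<longleftrightarrow> A \<inter> carrier X \<noteq> {} \<and> B \<inter> carrier X \<noteq> {} \<and>
     (\<forall>x\<in>carrier X. \<forall>y\<in>carrier X. x \<noteq> y \<longrightarrow> x \<in> B \<longrightarrow> y \<in> A \<longrightarrow>
        x \<rhd>\<^bsub>X\<^esub> y \<in> B \<and> x \<in> A \<or> y \<in> B \<and> x \<rhd>\<^bsub>X\<^esub> y \<in> A)"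

text \<open>Having three elements, the rack has no singleton that contains all elements but one, so
  consecutive supports are of the same kind. Equal singletons share their point, and two excluded
  points leave a third one in all supports.\<close>

lemma point_space_empty_cubic:
  assumes idem: "\<And>x. x \<in> carrier X \<Longrightarrow> x \<rhd>\<^bsub>X\<^esub> x = x \<and> 1 + q x x + (q x x)\<^sup>2 = 0"
    and pairs: "\<And>x y. x \<in> carrier X \<Longrightarrow> y \<in> carrier X \<Longrightarrow> x \<noteq> y \<Longrightarrow> braided_pair x y"
    and card: "3 \<le> card (carrier X)"
    and supports: "\<And>A B. support_pair A B \<Longrightarrow>
      (\<exists>x. carrier X \<inter> A = {x} \<and> carrier X \<inter> B = {x}) \<or> (\<exists>x. carrier X - {x} \<subseteq> A \<inter> B)"
  shows "point_space TYPE('m) 3 (nichols_algebra X q) = {}"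
proof -
  have "False" if M: "truncated_point_module 3 (nichols_algebra X q) (M :: (_, 'm) graded_module)" for M
  proof -
    obtain \<alpha> where pp: "\<And>j. j + 2 \<le> 3 \<Longrightarrow> point_pair (\<alpha> j) (\<alpha> (Suc j))"
      and cube: "\<And>x. x \<in> carrier X \<Longrightarrow> \<alpha> 0 x = 0 \<or> \<alpha> 1 x = 0 \<or> \<alpha> 2 x = 0"
      using truncated_point_pairs[OF M] idem by (metis order_refl)
    define S where "S = (\<lambda>j. {x. \<alpha> j x \<noteq> 0})"
    have sp: "support_pair (S j) (S (Suc j))" if "j + 2 \<le> 3" for j
      unfolding support_pair_def
    proof (intro conjI ballI impI)
      show "S j \<inter> carrier X \<noteq> {}" "S (Suc j) \<inter> carrier X \<noteq> {}"
        using pp[OF that] by (auto simp: point_pair_def S_def)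
      fix x y assume *: "x \<in> carrier X" "y \<in> carrier X" "x \<noteq> y" "x \<in> S (Suc j)" "y \<in> S j"
      from point_pair_braid[OF pp[OF that] *(1-3), of "x \<rhd>\<^bsub>X\<^esub> y"] pairs[OF *(1-3)] idem *
      show "x \<rhd>\<^bsub>X\<^esub> y \<in> S (Suc j) \<and> x \<in> S j \<or> y \<in> S (Suc j) \<and> x \<rhd>\<^bsub>X\<^esub> y \<in> S j"
        by (auto simp: S_def braided_pair_def Let_def act_closed)
    qed
    have sp0: "support_pair (S 0) (S 1)" and sp1: "support_pair (S 1) (S 2)"
      using sp[of 0] sp[of 1] by (simp_all add: numeral_2_eq_2)
    have cube': "x \<notin> S 0 \<inter> S 1 \<inter> S 2" if "x \<in> carrier X" for x
      using cube[OF that] by (auto simp: S_def)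
    have big: "\<exists>z\<in>carrier X. z \<noteq> x \<and> z \<noteq> y" for x y
    proof (rule ccontr)
      assume "\<not> ?thesis"
      then have "carrier X \<subseteq> {x, y}" by auto
      then have "card (carrier X) \<le> card {x, y}" by (intro card_mono) auto
      also have "\<dots> \<le> 2" by (simp add: card_insert_if)
      finally show False using card by simp
    qed
    from supports[OF sp0] show False
    proof (elim disjE exE)
      fix x assume x: "carrier X \<inter> S 0 = {x} \<and> carrier X \<inter> S 1 = {x}"
      from supports[OF sp1] show False
      proof (elim disjE exE)
        fix y assume "carrier X \<inter> S 1 = {y} \<and> carrier X \<inter> S 2 = {y}"
        with x cube'[of x] show False by auto
      next
        fix y assume "carrier X - {y} \<subseteq> S 1 \<inter> S 2"
        with x big[of x y] show False by auto
      qed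
    next
      fix x assume x: "carrier X - {x} \<subseteq> S 0 \<inter> S 1"
      from supports[OF sp1] show False
      proof (elim disjE exE)
        fix y assume "carrier X \<inter> S 1 = {y} \<and> carrier X \<inter> S 2 = {y}"
        with x big[of x y] show False by auto
      next
        fix y assume "carrier X - {y} \<subseteq> S 1 \<inter> S 2"
        with x big[of x y] cube' show False by blast
      qed
    qed
  qed
  then show ?thesis by (auto simp: point_space_def quotient_def)
qed

end


section \<open>Supports on the racks with three and four elements\<close>

context rack_cocycle
begin

text \<open>Written out for the six ordered pairs, the condition is a propositional problem in six
  memberships.\<close>

lemma support_pair_three:
  assumes X: "carrier X = {x, y, z}" "distinct [x, y, z]"
    and act: "x \<rhd>\<^bsub>X\<^esub> y = z" "y \<rhd>\<^bsub>X\<^esub> x = z" "x \<rhd>\<^bsub>X\<^esub> z = y" "z \<rhd>\<^bsub>X\<^esub> x = y"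
      "y \<rhd>\<^bsub>X\<^esub> z = x" "z \<rhd>\<^bsub>X\<^esub> y = x"
    and "support_pair A B"
  shows "(\<exists>x. carrier X \<inter> A = {x} \<and> carrier X \<inter> B = {x}) \<or> (\<exists>x. carrier X - {x} \<subseteq> A \<inter> B)"
proof -
  have ne: "x \<noteq> y" "x \<noteq> z" "y \<noteq> x" "y \<noteq> z" "z \<noteq> x" "z \<noteq> y"
    using X(2) by auto
  have R: "u \<in> B \<and> v \<in> A \<longrightarrow> u \<rhd>\<^bsub>X\<^esub> v \<in> B \<and> u \<in> A \<or> v \<in> B \<and> u \<rhd>\<^bsub>X\<^esub> v \<in> A"
    if "u \<in> carrier X" "v \<in> carrier X" "u \<noteq> v" for u v
    using assms(9) that unfolding support_pair_def by blast
  have "x \<in> A \<or> y \<in> A \<or> z \<in> A" "x \<in> B \<or> y \<in> B \<or> z \<in> B"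
    using assms(9) unfolding support_pair_def X(1) by auto
  moreover have
    "x \<in> B \<and> y \<in> A \<longrightarrow> z \<in> B \<and> x \<in> A \<or> y \<in> B \<and> z \<in> A"
    "z \<in> B \<and> x \<in> A \<longrightarrow> y \<in> B \<and> z \<in> A \<or> x \<in> B \<and> y \<in> A"
    "y \<in> B \<and> z \<in> A \<longrightarrow> x \<in> B \<and> y \<in> A \<or> z \<in> B \<and> x \<in> A"
    "y \<in> B \<and> x \<in> A \<longrightarrow> z \<in> B \<and> y \<in> A \<or> x \<in> B \<and> z \<in> A"
    "z \<in> B \<and> y \<in> A \<longrightarrow> x \<in> B \<and> z \<in> A \<or> y \<in> B \<and> x \<in> A"
    "x \<in> B \<and> z \<in> A \<longrightarrow> y \<in> B \<and> x \<in> A \<or> z \<in> B \<and> y \<in> A"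
    using R[of x y] R[of z x] R[of y z] R[of y x] R[of z y] R[of x z]
    by (simp_all add: X(1) act ne)
  ultimately have "x \<in> A \<and> x \<in> B \<and> y \<notin> A \<and> y \<notin> B \<and> z \<notin> A \<and> z \<notin> B \<or>
      x \<notin> A \<and> x \<notin> B \<and> y \<in> A \<and> y \<in> B \<and> z \<notin> A \<and> z \<notin> B \<or>
      x \<notin> A \<and> x \<notin> B \<and> y \<notin> A \<and> y \<notin> B \<and> z \<in> A \<and> z \<in> B \<or>
      y \<in> A \<and> y \<in> B \<and> z \<in> A \<and> z \<in> B \<or>
      x \<in> A \<and> x \<in> B \<and> z \<in> A \<and> z \<in> B \<or>
      x \<in> A \<and> x \<in> B \<and> y \<in> A \<and> y \<in> B"
    by argo
  then have "carrier X \<inter> A = {x} \<and> carrier X \<inter> B = {x} \<or> carrier X \<inter> A = {y} \<and> carrier X \<inter> B = {y} \<or>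
      carrier X \<inter> A = {z} \<and> carrier X \<inter> B = {z} \<or> carrier X - {x} \<subseteq> A \<inter> B \<or>
      carrier X - {y} \<subseteq> A \<inter> B \<or> carrier X - {z} \<subseteq> A \<inter> B"
    unfolding X(1) using X(2) by (elim disjE) auto
  then show ?thesis by metis
qed

text \<open>The same propositional check for the multiplication table of the tetrahedron rack:
  twelve pairs and eight memberships.\<close>

lemma support_pair_four:
  assumes X: "carrier X = {x, y, z, w}" "distinct [x, y, z, w]"
    and act: "x \<rhd>\<^bsub>X\<^esub> y = z" "x \<rhd>\<^bsub>X\<^esub> z = w" "x \<rhd>\<^bsub>X\<^esub> w = y" "y \<rhd>\<^bsub>X\<^esub> x = w"
      "y \<rhd>\<^bsub>X\<^esub> z = x" "y \<rhd>\<^bsub>X\<^esub> w = z" "z \<rhd>\<^bsub>X\<^esub> x = y" "z \<rhd>\<^bsub>X\<^esub> y = w"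
      "z \<rhd>\<^bsub>X\<^esub> w = x" "w \<rhd>\<^bsub>X\<^esub> x = z" "w \<rhd>\<^bsub>X\<^esub> y = x" "w \<rhd>\<^bsub>X\<^esub> z = y"
    and "support_pair A B"
  shows "(\<exists>x. carrier X \<inter> A = {x} \<and> carrier X \<inter> B = {x}) \<or> (\<exists>x. carrier X - {x} \<subseteq> A \<inter> B)"
proof -
  have ne: "x \<noteq> y" "x \<noteq> z" "x \<noteq> w" "y \<noteq> x" "y \<noteq> z" "y \<noteq> w" "z \<noteq> x" "z \<noteq> y" "z \<noteq> w" "w \<noteq> x" "w \<noteq> y" "w \<noteq> z"
    using X(2) by auto
  have R: "u \<in> B \<and> v \<in> A \<longrightarrow> u \<rhd>\<^bsub>X\<^esub> v \<in> B \<and> u \<in> A \<or> v \<in> B \<and> u \<rhd>\<^bsub>X\<^esub> v \<in> A"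
    if "u \<in> carrier X" "v \<in> carrier X" "u \<noteq> v" for u v
    using assms(15) that unfolding support_pair_def by blast
  have "x \<in> A \<or> y \<in> A \<or> z \<in> A \<or> w \<in> A" "x \<in> B \<or> y \<in> B \<or> z \<in> B \<or> w \<in> B"
    using assms(15) unfolding support_pair_def X(1) by auto
  moreover have
    "x \<in> B \<and> y \<in> A \<longrightarrow> z \<in> B \<and> x \<in> A \<or> y \<in> B \<and> z \<in> A"
    "z \<in> B \<and> x \<in> A \<longrightarrow> y \<in> B \<and> z \<in> A \<or> x \<in> B \<and> y \<in> A"
    "y \<in> B \<and> z \<in> A \<longrightarrow> x \<in> B \<and> y \<in> A \<or> z \<in> B \<and> x \<in> A"
    "x \<in> B \<and> z \<in> A \<longrightarrow> w \<in> B \<and> x \<in> A \<or> z \<in> B \<and> w \<in> A"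
    "w \<in> B \<and> x \<in> A \<longrightarrow> z \<in> B \<and> w \<in> A \<or> x \<in> B \<and> z \<in> A"
    "z \<in> B \<and> w \<in> A \<longrightarrow> x \<in> B \<and> z \<in> A \<or> w \<in> B \<and> x \<in> A"
    "x \<in> B \<and> w \<in> A \<longrightarrow> y \<in> B \<and> x \<in> A \<or> w \<in> B \<and> y \<in> A"
    "y \<in> B \<and> x \<in> A \<longrightarrow> w \<in> B \<and> y \<in> A \<or> x \<in> B \<and> w \<in> A"
    "w \<in> B \<and> y \<in> A \<longrightarrow> x \<in> B \<and> w \<in> A \<or> y \<in> B \<and> x \<in> A"
    "y \<in> B \<and> w \<in> A \<longrightarrow> z \<in> B \<and> y \<in> A \<or> w \<in> B \<and> z \<in> A"
    "z \<in> B \<and> y \<in> A \<longrightarrow> w \<in> B \<and> z \<in> A \<or> y \<in> B \<and> w \<in> A"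
    "w \<in> B \<and> z \<in> A \<longrightarrow> y \<in> B \<and> w \<in> A \<or> z \<in> B \<and> y \<in> A"
    using R[of x y] R[of z x] R[of y z] R[of x z] R[of w x] R[of z w] R[of x w] R[of y x] R[of w y] R[of y w] R[of z y] R[of w z]
    by (simp_all add: X(1) act ne)
  ultimately have "x \<in> A \<and> x \<in> B \<and> y \<notin> A \<and> y \<notin> B \<and> z \<notin> A \<and> z \<notin> B \<and> w \<notin> A \<and> w \<notin> B \<or>
      x \<notin> A \<and> x \<notin> B \<and> y \<in> A \<and> y \<in> B \<and> z \<notin> A \<and> z \<notin> B \<and> w \<notin> A \<and> w \<notin> B \<or>
      x \<notin> A \<and> x \<notin> B \<and> y \<notin> A \<and> y \<notin> B \<and> z \<in> A \<and> z \<in> B \<and> w \<notin> A \<and> w \<notin> B \<or>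
      x \<notin> A \<and> x \<notin> B \<and> y \<notin> A \<and> y \<notin> B \<and> z \<notin> A \<and> z \<notin> B \<and> w \<in> A \<and> w \<in> B \<or>
      y \<in> A \<and> y \<in> B \<and> z \<in> A \<and> z \<in> B \<and> w \<in> A \<and> w \<in> B \<or>
      x \<in> A \<and> x \<in> B \<and> z \<in> A \<and> z \<in> B \<and> w \<in> A \<and> w \<in> B \<or>
      x \<in> A \<and> x \<in> B \<and> y \<in> A \<and> y \<in> B \<and> w \<in> A \<and> w \<in> B \<or>
      x \<in> A \<and> x \<in> B \<and> y \<in> A \<and> y \<in> B \<and> z \<in> A \<and> z \<in> B"
    by argo
  then have "carrier X \<inter> A = {x} \<and> carrier X \<inter> B = {x} \<or> carrier X \<inter> A = {y} \<and> carrier X \<inter> B = {y} \<or>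
      carrier X \<inter> A = {z} \<and> carrier X \<inter> B = {z} \<or> carrier X \<inter> A = {w} \<and> carrier X \<inter> B = {w} \<or>
      carrier X - {x} \<subseteq> A \<inter> B \<or> carrier X - {y} \<subseteq> A \<inter> B \<or>
      carrier X - {z} \<subseteq> A \<inter> B \<or> carrier X - {w} \<subseteq> A \<inter> B"
    unfolding X(1) using X(2) by (elim disjE) auto
  then show ?thesis by metis
qed

end


section \<open>Truncated point modules supported at a single letter\<close>

text \<open>
  \<open>letter_action x f\<close> is multiplication by $\sum_j f(x^j)\, t^j$ on polynomials of degree at
  most 2 in \<open>t\<close>, given by their coefficients.
\<close>

definition letter_action :: "'x \<Rightarrow> ('x list \<Rightarrow> 'k::field) \<Rightarrow> (nat \<Rightarrow> 'k) \<Rightarrow> nat \<Rightarrow> 'k" where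
  "letter_action x f v i = (if i \<le> 2 then \<Sum>j\<le>i. f (replicate j x) * v (i - j) else 0)"

text \<open>A residue class acts through a chosen representative; \<open>letter_module_smult\<close>
  shows that the choice does not matter.\<close>

definition letter_module :: "'x \<Rightarrow> (('x list \<Rightarrow> 'k::field) set, nat \<Rightarrow> 'k) graded_module" where
  "letter_module x =
     \<lparr>carrier = {v. \<forall>i>2. v i = 0}, mult = undefined, one = undefined, zero = (\<lambda>i. 0),
      add = (\<lambda>u v i. u i + v i),
      smult = (\<lambda>a v. letter_action x (SOME f. f \<in> a) v),
      piece = (\<lambda>d. {v. (\<forall>i>2. v i = 0) \<and> (\<forall>i. int i \<noteq> d \<longrightarrow> v i = 0)})\<rparr>"

lemma le_2_cases: "i \<le> 2 \<Longrightarrow> i = 0 \<or> i = 1 \<or> i = (2::nat)"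
  by auto

lemma letter_action_eqs:
  "letter_action x f v 0 = f [] * v 0"
  "letter_action x f v (Suc 0) = f [] * v (Suc 0) + f [x] * v 0"
  "letter_action x f v 2 = f [] * v 2 + f [x] * v (Suc 0) + f [x, x] * v 0"
  by (simp_all add: letter_action_def numeral_2_eq_2)

lemma letter_action_eqI:
  assumes "\<And>i. i > 2 \<Longrightarrow> u i = 0" "\<And>i. i > 2 \<Longrightarrow> v i = (0::'k::field)"
    and "u 0 = v 0" "u (Suc 0) = v (Suc 0)" "u 2 = v 2"
  shows "u = v"
proof
  fix i show "u i = v i"
    using assms le_2_cases[of i] by (cases "i \<le> 2") auto
qed

text \<open>Keeping only the coefficients at powers of \<open>x\<close> is an algebra homomorphism
  to polynomials in \<open>t\<close>, which sends the other letters to zero.\<close>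

lemma letter_action_conv: "letter_action x (conv f g) v = letter_action x f (letter_action x g v)"
  by (rule letter_action_eqI)
    (simp_all add: letter_action_eqs conv_Cons algebra_simps, simp_all add: letter_action_def)

lemma letter_action_one:
  assumes "\<And>i. i > 2 \<Longrightarrow> v i = 0" shows "letter_action x (word_tensor []) v = v"
  using assms by (intro letter_action_eqI)
    (simp_all add: letter_action_eqs word_tensor_def, simp_all add: letter_action_def)

lemma letter_module_simps:
  "carrier (letter_module x) = {v. \<forall>i>2. v i = 0}" "zero (letter_module x) = (\<lambda>i. 0)"
  "add (letter_module x) = (\<lambda>u v i. u i + v i)"
  "piece (letter_module x) d = {v. (\<forall>i>2. v i = 0) \<and> (\<forall>i. int i \<noteq> d \<longrightarrow> v i = 0)}"
  by (simp_all add: letter_module_def)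

lemma abelian_group_letter_module:
  "abelian_group (letter_module x :: (('x list \<Rightarrow> 'k::field) set, _) graded_module)"
proof (rule abelian_groupI)
  fix v :: "nat \<Rightarrow> 'k" assume "v \<in> carrier (letter_module x)"
  then show "\<exists>u\<in>carrier (letter_module x). u \<oplus>\<^bsub>letter_module x\<^esub> v = \<zero>\<^bsub>letter_module x\<^esub>"
    by (intro bexI[of _ "\<lambda>i. - v i"]) (auto simp: letter_module_simps)
qed (auto simp: letter_module_simps add_ac)

lemma letter_module_finsum:
  assumes "finite J" "\<And>i. i \<in> J \<Longrightarrow> f i \<in> carrier (letter_module x)"
  shows "finsum (letter_module x) f J = (\<lambda>k. \<Sum>i\<in>J. f i k)"
proof -
  interpret abelian_group "letter_module x" by (rule abelian_group_letter_module)
  show ?thesis using assms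
    by (induction J rule: finite_induct) (auto simp: letter_module_simps(2,3) Pi_iff)
qed

context rack_cocycle
begin

context
  fixes x assumes x: "x \<in> carrier X" "x \<rhd>\<^bsub>X\<^esub> x = x" "1 + q x x \<noteq> 0"
begin

abbreviation "L \<equiv> letter_module x :: (('x list \<Rightarrow> 'k) set, _) graded_module"

text \<open>This makes the action well defined. Differentiating x^2 twice by x gives 1 + q_{x,x},
  which is nonzero, so no relation involves x^2.\<close>

lemma ideal_letter_zero:
  assumes "f \<in> nichols_ideal X q"
  shows "f [] = 0" "f [x] = 0" "f [x, x] = 0"
proof -
  have "skew_derivs u f [] = 0" if "u \<in> lists (carrier X)" for u
    using assms that by (simp add: nichols_ideal_eq null_def)
  from this[of "[]"] this[of "[x]"] this[of "[x, x]"] x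
  have "f [] = 0" "f [x] = 0" "f [x, x] + q x (linv x x) * f [x, linv x x] = 0" by auto
  moreover have "linv x x = x" using linv_eq_iff x by simp
  ultimately have "(1 + q x x) * f [x, x] = 0" by (simp add: algebra_simps)
  with x(3) \<open>f [] = 0\<close> \<open>f [x] = 0\<close> show "f [] = 0" "f [x] = 0" "f [x, x] = 0" by auto
qed

lemma letter_module_smult:
  assumes "f \<in> carrier (tensor_algebra (carrier X))"
  shows "proj f \<odot>\<^bsub>L\<^esub> v = letter_action x f v"
proof -
  have "(SOME g. g \<in> proj f) \<in> proj f" using someI[of "\<lambda>g. g \<in> proj f", OF proj_self[OF assms]] .
  then obtain h where h: "h \<in> nichols_ideal X q" "(SOME g. g \<in> proj f) = (\<lambda>w. h w + f w)"
    by (rule proj_memD)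
  have "letter_action x (\<lambda>w. h w + f w) v = letter_action x f v"
    by (rule letter_action_eqI)
      (simp_all add: letter_action_eqs ideal_letter_zero[OF h(1)], simp_all add: letter_action_def)
  then show ?thesis by (simp add: letter_module_def h(2))
qed

lemma letter_action_closed: "letter_action x f v \<in> carrier L"
  by (simp add: letter_module_simps letter_action_def)

lemma left_module_letter_module: "left_module (nichols_algebra X q) L"
proof (intro left_module.intro ring_nichols_algebra abelian_group_letter_module
    left_module_axioms.intro)
  fix a u v
  assume "a \<in> carrier (nichols_algebra X q)"
  then obtain f where f: "a = proj f" "f \<in> carrier (tensor_algebra (carrier X))"
    by (auto simp: nichols_simps)
  show "a \<odot>\<^bsub>L\<^esub> v \<in> carrier L"
    by (simp add: f letter_module_smult letter_action_closed)
  show "a \<odot>\<^bsub>L\<^esub> (u \<oplus>\<^bsub>L\<^esub> v) =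
      a \<odot>\<^bsub>L\<^esub> u \<oplus>\<^bsub>L\<^esub> a \<odot>\<^bsub>L\<^esub> v"
    by (auto simp: f letter_module_smult letter_module_simps letter_action_def fun_eq_iff
        distrib_left sum.distrib)
  fix b assume "b \<in> carrier (nichols_algebra X q)"
  then obtain g where g: "b = proj g" "g \<in> carrier (tensor_algebra (carrier X))"
    by (auto simp: nichols_simps)
  show "(a \<oplus>\<^bsub>nichols_algebra X q\<^esub> b) \<odot>\<^bsub>L\<^esub> v =
      a \<odot>\<^bsub>L\<^esub> v \<oplus>\<^bsub>L\<^esub> b \<odot>\<^bsub>L\<^esub> v"
    using f(2) g(2)
    by (auto simp: f(1) g(1) proj_add tensor_add_closed letter_module_smult letter_module_simps
        letter_action_def fun_eq_iff distrib_right sum.distrib)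
  show "(a \<otimes>\<^bsub>nichols_algebra X q\<^esub> b) \<odot>\<^bsub>L\<^esub> v =
      a \<odot>\<^bsub>L\<^esub> (b \<odot>\<^bsub>L\<^esub> v)"
    using f(2) g(2)
    by (simp add: f(1) g(1) proj_mult tensor_conv_closed letter_module_smult letter_action_conv)
next
  fix v :: "nat \<Rightarrow> 'k" assume "v \<in> carrier L"
  then show "\<one>\<^bsub>nichols_algebra X q\<^esub> \<odot>\<^bsub>L\<^esub> v = v"
    by (simp add: nichols_simps word_tensor_closed letter_module_smult letter_action_one
        letter_module_simps)
qed

lemma graded_letter_module: "graded_left_module (nichols_algebra X q) L"
  unfolding graded_left_module_def
proof (intro conjI allI ballI left_module_letter_module)
  interpret M: abelian_group L
    by (rule abelian_group_letter_module)
  fix i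
  show "subgroup (piece L i) (add_monoid L)"
  proof (rule M.add.subgroupI)
    fix v :: "nat \<Rightarrow> 'k" assume v: "v \<in> piece L i"
    then have "\<ominus>\<^bsub>L\<^esub> v = (\<lambda>i. - v i)"
      by (intro M.minus_equality) (auto simp: letter_module_simps)
    with v show "\<ominus>\<^bsub>L\<^esub> v \<in> piece L i"
      by (simp add: letter_module_simps)
  qed (auto simp: letter_module_simps)
next
  fix v :: "nat \<Rightarrow> 'k" assume v: "v \<in> carrier L"
  \<comment> \<open>The only candidate: degree \<open>i\<close> carries the coefficient of t^i, and
    degrees outside 0 to 2 carry zero.\<close>
  define f where "f = (\<lambda>i k. if int k = i then v k else 0)"
  have fs: "finite {i. f i \<noteq> (\<lambda>i. 0)}"
    by (rule finite_subset[of _ "int ` {..2}"])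
      (use v in \<open>auto simp: f_def letter_module_simps fun_eq_iff image_iff split: if_splits,
        metis atMost_iff linorder_not_le\<close>)
  have supp: "finsum L g {i. g i \<noteq> \<zero>\<^bsub>L\<^esub>} = (\<lambda>k. g (int k) k)"
    if g: "\<And>i. g i \<in> piece L i" and fin: "finite {i. g i \<noteq> (\<lambda>i. 0)}"
    for g :: "int \<Rightarrow> nat \<Rightarrow> 'k"
  proof -
    have "(\<Sum>i | g i \<noteq> (\<lambda>i. 0). g i k) = g (int k) k" for k
    proof -
      have "(\<Sum>i | g i \<noteq> (\<lambda>i. 0). g i k) =
          (\<Sum>i | g i \<noteq> (\<lambda>i. 0). if i = int k then g (int k) k else 0)"
        using g by (intro sum.cong) (auto simp: letter_module_simps)
      then show ?thesis using fin by auto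
    qed
    moreover have "g i \<in> carrier L" for i
      using g[of i] by (simp add: letter_module_simps)
    ultimately show ?thesis
      using fin by (subst letter_module_finsum) (simp_all add: letter_module_simps(2))
  qed
  show "\<exists>!f. (\<forall>i. f i \<in> piece L i) \<and>
      finite {i. f i \<noteq> \<zero>\<^bsub>L\<^esub>} \<and>
      v = (\<Oplus>\<^bsub>L\<^esub>i\<in>{i. f i \<noteq> \<zero>\<^bsub>L\<^esub>}. f i)"
  proof (rule ex1I[of _ f])
    have "f i \<in> piece L i" for i using v by (simp add: f_def letter_module_simps)
    with supp[of f] fs show "(\<forall>i. f i \<in> piece L i) \<and>
      finite {i. f i \<noteq> \<zero>\<^bsub>L\<^esub>} \<and>
      v = (\<Oplus>\<^bsub>L\<^esub>i\<in>{i. f i \<noteq> \<zero>\<^bsub>L\<^esub>}. f i)"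
      by (simp add: letter_module_simps(2)) (simp add: f_def)
  next
    fix g
    assume g: "(\<forall>i. g i \<in> piece L i) \<and>
      finite {i. g i \<noteq> \<zero>\<^bsub>L\<^esub>} \<and>
      v = (\<Oplus>\<^bsub>L\<^esub>i\<in>{i. g i \<noteq> \<zero>\<^bsub>L\<^esub>}. g i)"
    then have "v = (\<lambda>k. g (int k) k)" using supp[of g] by (simp add: letter_module_simps(2))
    with g show "g = f" by (auto simp: f_def fun_eq_iff letter_module_simps)
  qed
next
  fix j i a v
  assume a: "a \<in> degree_piece (nichols_algebra X q) j" and v: "v \<in> piece L i"
  from a obtain f where f: "a = proj f" "f \<in> tensor_power (carrier X) j"
    by (auto simp: nichols_simps)
  have "letter_action x f v k = 0" if "int k \<noteq> int j + i" for k
  proof -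
    have "f (replicate l x) * v (k - l) = 0" if "l \<le> k" for l
    proof (cases "l = j")
      case True
      with that \<open>int k \<noteq> int j + i\<close> v show ?thesis by (auto simp: letter_module_simps)
    next
      case False
      with f(2) show ?thesis by (auto simp: tensor_power_iff)
    qed
    then show ?thesis by (auto simp: letter_action_def intro!: sum.neutral)
  qed
  moreover have "f \<in> carrier (tensor_algebra (carrier X))" using f(2) by (simp add: tensor_power_def)
  ultimately show "a \<odot>\<^bsub>L\<^esub> v \<in> piece L (int j + i)"
    by (simp add: f(1) letter_module_smult letter_module_simps(4)) (simp add: letter_action_def)
qed

lemma truncated_letter_module:
  "truncated_point_module 2 (nichols_algebra X q) L"
  unfolding truncated_point_module_def
proof (intro conjI allI graded_letter_module)
  let ?u = "\<lambda>d k. if k = d then 1 else 0 :: 'k"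
  show "generated_in_degree_zero (nichols_algebra X q) L"
    unfolding generated_in_degree_zero_def
  proof (intro allI impI, elim conjE)
    fix N assume N: "submodule N (nichols_algebra X q) L"
      and sub: "piece L 0 \<subseteq> N"
    interpret N: submodule N "nichols_algebra X q" "L" by (rule N)
    have "v \<in> N" if v: "v \<in> carrier L" for v
    proof -
      \<comment> \<open>The element v_0 + v_1 x + v_2 x^2 sends the polynomial 1 to
        \<open>v\<close>.\<close>
      define f where "f = (\<lambda>w. if w = [] then v 0 else if w = [x] then v 1
        else if w = [x, x] then v 2 else 0)"
      have f: "f \<in> carrier (tensor_algebra (carrier X))"
        unfolding tensor_carrier
        by (auto simp: f_def x(1) intro: finite_subset[of _ "{[], [x], [x, x]}"] split: if_splits)
      have "?u 0 \<in> N" using sub by (auto simp: letter_module_simps)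
      then have "proj f \<odot>\<^bsub>L\<^esub> ?u 0 \<in> N"
        using f by (intro N.smult_closed) (simp add: nichols_simps)
      moreover have "letter_action x f (?u 0) = v"
        using v by (intro letter_action_eqI)
          (simp_all add: letter_action_eqs f_def letter_module_simps, simp add: letter_action_def)
      ultimately show ?thesis by (simp add: letter_module_smult[OF f])
    qed
    then show "N = carrier L" using N.subset by auto
  qed
  fix i
  show "has_dimension (nichols_algebra X q) L (piece L i)
      (if 0 \<le> i \<and> i \<le> int 2 then 1 else 0)"
  proof (cases "0 \<le> i \<and> i \<le> 2")
    case False
    then have "piece L i = {\<lambda>i. 0 :: 'k}"
      by (auto simp: letter_module_simps fun_eq_iff) (metis of_nat_0_le_iff of_nat_le_iff
        of_nat_numeral linorder_not_le)
    moreover have "finsum L f {} = (\<lambda>k. 0)" for f :: "nat \<Rightarrow> nat \<Rightarrow> 'k"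
      by (subst letter_module_finsum) simp_all
    ultimately show ?thesis using False by (auto simp: has_dimension_def)
  next
    case True
    then obtain d where d: "i = int d" "d \<le> 2" by (metis nat_0_le nat_le_iff of_nat_numeral nat_int)
    have S: "{..<Suc 0} = {0}" by auto
    have sc: "(\<Oplus>\<^bsub>L\<^esub>j \<in> {..<Suc 0}. scalar (nichols_algebra X q) (c j)
        \<odot>\<^bsub>L\<^esub> ?u d) = (\<lambda>k. if k = d then c 0 else 0)" for c :: "nat \<Rightarrow> 'k"
    proof -
      have "letter_action x (\<lambda>w. c 0 * word_tensor [] w) (?u d) = (\<lambda>k. if k = d then c 0 else 0)"
        using d(2) le_2_cases[OF d(2)] by (intro letter_action_eqI)
          (auto simp: letter_action_eqs word_tensor_def, auto simp: letter_action_def)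
      then show ?thesis
        by (simp add: S letter_module_finsum nichols_simps letter_module_smult
            tensor_scale_closed word_tensor_closed letter_action_closed)
    qed
    have "\<exists>!c. c \<in> extensional {..<Suc 0} \<and> v = (\<lambda>k. if k = d then c 0 else 0)"
      if v: "v \<in> piece L i" for v :: "nat \<Rightarrow> 'k"
    proof (rule ex1I[of _ "\<lambda>j\<in>{..<Suc 0}. v d"])
      show "(\<lambda>j\<in>{..<Suc 0}. v d) \<in> extensional {..<Suc 0} \<and>
          v = (\<lambda>k. if k = d then (\<lambda>j\<in>{..<Suc 0}. v d) 0 else 0)"
        using v d by (auto simp: letter_module_simps fun_eq_iff)
      fix c assume "c \<in> extensional {..<Suc 0} \<and> v = (\<lambda>k. if k = d then c 0 else 0)"
      then show "c = (\<lambda>j\<in>{..<Suc 0}. v d)"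
        by (auto simp: fun_eq_iff extensional_def)
    qed
    moreover have "?u d \<in> piece L i"
      using d by (auto simp: letter_module_simps)
    ultimately have "has_dimension (nichols_algebra X q) L (piece L i) (Suc 0)"
      unfolding has_dimension_def by (intro exI[of _ "\<lambda>_. ?u d"]) (simp add: sc)
    with True show ?thesis by simp
  qed
qed

lemma point_space_two_nonempty: "point_space TYPE(nat \<Rightarrow> 'k) 2 (nichols_algebra X q) \<noteq> {}"
  using truncated_letter_module by (auto simp: point_space_def quotient_def)

end

end


section \<open>Conjugacy classes as racks\<close>

lemma rack_cocycle_conj_rack:
  assumes G: "group G" "finite (carrier G)" "g \<in> carrier G"
    and cocycle: "\<And>x y z. x \<in> carrier (conj_rack G g) \<Longrightarrow> y \<in> carrier (conj_rack G g) \<Longrightarrow>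
      z \<in> carrier (conj_rack G g) \<Longrightarrow>
      q x (act (conj_rack G g) y z) * q y z =
        q (act (conj_rack G g) x y) (act (conj_rack G g) x z) * q x z"
  shows "rack_cocycle (conj_rack G g) q"
proof -
  interpret group G by (rule G(1))
  let ?C = "carrier (conj_rack G g)"
  have C: "x \<in> carrier G" if "x \<in> ?C" for x using that G(3) by (auto simp: conj_rack_def)
  have act: "act (conj_rack G g) x y = x \<otimes>\<^bsub>G\<^esub> y \<otimes>\<^bsub>G\<^esub> inv\<^bsub>G\<^esub> x" for x y
    by (simp add: conj_rack_def)
  have cancel: "inv\<^bsub>G\<^esub> x \<otimes>\<^bsub>G\<^esub> (x \<otimes>\<^bsub>G\<^esub> y) = y" if "x \<in> carrier G" "y \<in> carrier G" for x y
    using that by (simp flip: m_assoc)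
  show ?thesis
  proof (unfold_locales)
    show "finite ?C" using C by (intro finite_subset[OF _ G(2)]) auto
  next
    fix x y assume xy: "x \<in> ?C" "y \<in> ?C"
    obtain h where h: "h \<in> carrier G" "y = h \<otimes>\<^bsub>G\<^esub> g \<otimes>\<^bsub>G\<^esub> inv\<^bsub>G\<^esub> h"
      using xy(2) by (auto simp: conj_rack_def)
    have x: "x \<in> carrier G" by (rule C[OF xy(1)])
    have "act (conj_rack G g) x y = (x \<otimes>\<^bsub>G\<^esub> h) \<otimes>\<^bsub>G\<^esub> g \<otimes>\<^bsub>G\<^esub> inv\<^bsub>G\<^esub> (x \<otimes>\<^bsub>G\<^esub> h)"
      using h x G(3) by (simp add: act m_assoc inv_mult_group)
    moreover have "x \<otimes>\<^bsub>G\<^esub> h \<in> carrier G" using x h(1) by simp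
    ultimately show "act (conj_rack G g) x y \<in> ?C"
      unfolding conj_rack_def by auto
  next
    fix x assume "x \<in> ?C"
    then show "inj_on (act (conj_rack G g) x) ?C"
      by (intro inj_onI) (simp add: C act)
  next
    fix x y z assume "x \<in> ?C" "y \<in> ?C" "z \<in> ?C"
    then show "act (conj_rack G g) x (act (conj_rack G g) y z) =
        act (conj_rack G g) (act (conj_rack G g) x y) (act (conj_rack G g) x z)"
      using C by (simp add: act m_assoc inv_mult_group cancel)
  qed (rule cocycle)
qed

text \<open>Conjugation relabels the entries of a cycle, so computing in the rack becomes evaluating
  a permutation on a list.\<close>

lemma conj_rack_sym_act:
  assumes "x permutes {1..n}" "distinct cs"
  shows "act (conj_rack (sym_group n) g) x (cycle_of_list cs) = cycle_of_list (map x cs)"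
  using assms conjugation_of_cycle[OF assms(2) permutes_bij[OF assms(1)]]
  by (simp add: conj_rack_def sym_group_mult sym_group_carrier)

lemma conj_rack_alt_act:
  assumes "x \<in> carrier (alt_group n)" "distinct cs"
  shows "act (conj_rack (alt_group n) g) x (cycle_of_list cs) = cycle_of_list (map x cs)"
  using assms conjugation_of_cycle[OF assms(2)] permutes_bij[of x "{1..n}"]
  by (simp add: conj_rack_def alt_group_mult alt_group_inv_equality alt_group_carrier)

lemma cycle_three_apply:
  "distinct [a, b, c] \<Longrightarrow> cycle_of_list [a, b, c] n =
    (if n = a then b else if n = b then c else if n = c then a else n)"
  by (auto simp: transpose_def)

lemma cycle_four_apply:
  "distinct [a, b, c, d] \<Longrightarrow> cycle_of_list [a, b, c, d] n =
    (if n = a then b else if n = b then c else if n = c then d else if n = d then a else n)"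
  by (auto simp: transpose_def)

lemma cycle_permutes_interval: "set cs \<subseteq> {1..n} \<Longrightarrow> cycle_of_list cs permutes {1..n}"
  using permutes_subset[OF cycle_permutes] by blast

lemma conj_rack_sym_carrier:
  assumes "distinct cs" "set cs \<subseteq> {1..n}"
  shows "carrier (conj_rack (sym_group n) (cycle_of_list cs)) =
    {cycle_of_list (map h cs) | h. h permutes {1..n}}"
proof -
  have "carrier (conj_rack (sym_group n) (cycle_of_list cs)) =
      (\<lambda>h. act (conj_rack (sym_group n) (cycle_of_list cs)) h (cycle_of_list cs)) ` {h. h permutes {1..n}}"
    by (auto simp: conj_rack_def sym_group_carrier simp del: sym_group_inv_equality)
  also have "\<dots> = (\<lambda>h. cycle_of_list (map h cs)) ` {h. h permutes {1..n}}"
    by (intro image_cong) (auto simp: conj_rack_sym_act assms)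
  finally show ?thesis by auto
qed

lemma rack_cocycle_conj_rack_sym:
  assumes "set cs \<subseteq> {1..n}"
    and "\<And>x y z. x \<in> carrier (conj_rack (sym_group n) (cycle_of_list cs)) \<Longrightarrow>
      y \<in> carrier (conj_rack (sym_group n) (cycle_of_list cs)) \<Longrightarrow>
      z \<in> carrier (conj_rack (sym_group n) (cycle_of_list cs)) \<Longrightarrow>
      q x (act (conj_rack (sym_group n) (cycle_of_list cs)) y z) * q y z =
        q (act (conj_rack (sym_group n) (cycle_of_list cs)) x y)
          (act (conj_rack (sym_group n) (cycle_of_list cs)) x z) * q x z"
  shows "rack_cocycle (conj_rack (sym_group n) (cycle_of_list cs)) q"
  using assms cycle_permutes_interval[OF assms(1)]
  by (intro rack_cocycle_conj_rack sym_group_is_group)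
    (auto simp: sym_group_carrier sym_group_def finite_permutations)


section \<open>Transpositions\<close>

lemma transposition_rack_carrier:
  assumes "2 \<le> n"
  shows "carrier (transposition_rack n) = {transpose i j | i j. i \<in> {1..n} \<and> j \<in> {1..n} \<and> i \<noteq> j}"
proof -
  have "\<exists>h. h permutes {1..n} \<and> h 1 = i \<and> h 2 = j"
    if ij: "i \<in> {1..n}" "j \<in> {1..n}" "i \<noteq> j" for i j
  proof -
    \<comment> \<open>\<open>?s\<close> sends 1 to \<open>i\<close> and is an involution; exchanging
      2 with \<open>?s j\<close> beforehand leaves 1 alone and makes 2 arrive at
      \<open>j\<close>.\<close>
    let ?s = "transpose 1 i"
    let ?h = "?s \<circ> transpose 2 (?s j)"
    have "?s j \<in> {1..n}" "?s j \<noteq> 1" using ij assms by (auto simp: transpose_def)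
    then have "?h permutes {1..n} \<and> ?h 1 = i \<and> ?h 2 = j"
      using ij assms by (auto intro!: permutes_compose permutes_swap_id)
    then show ?thesis by blast
  qed
  moreover have "h 1 \<in> {1..n} \<and> h 2 \<in> {1..n} \<and> h 1 \<noteq> h (2::nat)" if "h permutes {1..n}" for h
    using that assms permutes_in_image[OF that] inj_eq[OF permutes_inj[OF that]] by simp
  ultimately show ?thesis
    using assms unfolding transposition_rack_def
    by (subst conj_rack_sym_carrier) (auto simp del: One_nat_def, blast+)
qed

lemma transposition_rack_act:
  assumes "x \<in> carrier (transposition_rack n)" "2 \<le> n" "i \<noteq> j"
  shows "act (transposition_rack n) x (transpose i j) = transpose (x i) (x j)"
proof -
  have "x permutes {1..n}"
    using assms by (auto simp: transposition_rack_carrier intro: permutes_swap_id)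
  from conj_rack_sym_act[OF this, of "[i, j]"] assms(3) show ?thesis
    by (simp add: transposition_rack_def)
qed

lemma rack_cocycle_transpositions_const:
  assumes "2 \<le> n"
  shows "rack_cocycle (transposition_rack n) (\<lambda>_ _. c)"
  unfolding transposition_rack_def using assms by (intro rack_cocycle_conj_rack_sym) auto

section \<open>The sign cocycle on transpositions\<close>

lemma transpose_eq_cases:
  assumes "transpose i j = transpose i' j'" "i \<noteq> j"
  shows "i = i' \<and> j = j' \<or> i = j' \<and> j = i'"
  using assms(2) fun_cong[OF assms(1), of i] fun_cong[OF assms(1), of j]
  by (auto simp: transpose_def split: if_splits)

text \<open>Symmetric in \<open>i\<close> and \<open>j\<close>, so that the two points never have to
  be put in order: the value tells whether \<open>x\<close> preserves their order.\<close>

lemma chi_transpose: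
  assumes "i \<noteq> j" "inj x"
  shows "chi x (transpose i j) = (if (x i < x j) = (i < j) then 1 else - 1)"
proof -
  have "x i \<noteq> x j" using assms by (auto dest: injD)
  have "(\<exists>i' j'. i' < j' \<and> transpose i j = cycle_of_list [i', j'] \<and> x i' < x j') \<longleftrightarrow>
      (x i < x j) = (i < j)" (is "?l \<longleftrightarrow> ?r")
  proof
    assume ?l
    then obtain i' j' where "i' < j'" "transpose i j = transpose i' j'" "x i' < x j'" by auto
    with transpose_eq_cases[OF this(2) assms(1)] show ?r by auto
  next
    assume ?r
    with \<open>x i \<noteq> x j\<close> assms(1) consider "i < j" "x i < x j" | "j < i" "x j < x i" by force
    then show ?l
    proof cases
      case 1
      then show ?thesis by (intro exI[of _ i] exI[of _ j]) simp
    next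
      case 2
      then show ?thesis by (intro exI[of _ j] exI[of _ i]) (simp add: transpose_commute)
    qed
  qed
  then show ?thesis by (simp add: chi_def)
qed

text \<open>The sign of a permutation on the order of two points is multiplicative under
  composition. Both sides are the sign of x y on the points of \<open>z\<close>, because (x \<rhd>
  y) x = x y.\<close>

lemma rack_cocycle_transpositions_chi:
  assumes n: "2 \<le> n"
  shows "rack_cocycle (transposition_rack n) (\<lambda>\<sigma> \<tau>. chi \<sigma> \<tau>)"
  unfolding transposition_rack_def
proof (rule rack_cocycle_conj_rack_sym, unfold transposition_rack_def[symmetric])
  show "set [1, 2] \<subseteq> {1..n}" using n by auto
  let ?X = "transposition_rack n"
  \<comment> \<open>The trivial cocycle already gives closure of the rack.\<close>
  interpret X: rack_cocycle ?X "\<lambda>_ _. 1 :: 'a" by (rule rack_cocycle_transpositions_const[OF n])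
  fix x y z assume xyz: "x \<in> carrier ?X" "y \<in> carrier ?X" "z \<in> carrier ?X"
  then obtain i j where z: "z = transpose i j" "i \<noteq> j" by (auto simp: transposition_rack_carrier[OF n])
  obtain a b where y: "y = transpose a b" "a \<noteq> b"
    using xyz by (auto simp: transposition_rack_carrier[OF n])
  have inj: "inj w" if "w \<in> carrier ?X" for w
    using that by (auto simp: transposition_rack_carrier[OF n])
  have ne: "w i \<noteq> w j" if "w \<in> carrier ?X" for w using inj[OF that] z(2) by (auto dest: injD)
  let ?w = "act ?X x y"
  have w: "?w \<in> carrier ?X" using X.act_closed xyz by simp
  have "?w = transpose (x a) (x b)"
    using transposition_rack_act[OF xyz(1) n y(2)] y by simp
  then have wx: "?w (x k) = x (y k)" for k
    using y inj[OF xyz(1)] by (auto simp: transpose_def dest: injD)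
  show "chi x (act ?X y z) * chi y z = (chi ?w (act ?X x z) * chi x z :: 'a)"
    using ne[OF xyz(1)] ne[OF xyz(2)] z inj xyz w
    by (simp add: transposition_rack_act[OF _ n] chi_transpose wx)
qed

section \<open>Pairs of transpositions\<close>

lemma transposition_pair_cases:
  assumes "2 \<le> n" "x \<in> carrier (transposition_rack n)" "y \<in> carrier (transposition_rack n)" "x \<noteq> y"
  obtains a b c d where "distinct [a, b, c, d]" "x = transpose a b" "y = transpose c d"
  | a b c where "distinct [a, b, c]" "x = transpose a b" "y = transpose b c"
proof -
  from assms obtain a b c d where *: "x = transpose a b" "a \<noteq> b" "y = transpose c d" "c \<noteq> d"
    by (auto simp: transposition_rack_carrier)
  then consider "distinct [a, b, c, d]" | "b = c" | "b = d" | "a = c" | "a = d" by auto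
  then show ?thesis
    using that * assms(4) by cases (metis transpose_commute distinct_length_2_or_more distinct_singleton)+
qed

text \<open>Disjoint transpositions commute, and those meeting in one point form a pair as in S_3.
  The bound in \<open>disjoint\<close> makes that hypothesis vacuous for
  \<open>n = 3\<close>.\<close>

lemma transposition_pair:
  assumes n: "2 \<le> n" and rack: "rack_cocycle (transposition_rack n) q"
    and xy: "x \<in> carrier (transposition_rack n)" "y \<in> carrier (transposition_rack n)" "x \<noteq> y"
    and disjoint: "\<And>a b c d. distinct [a, b, c, d] \<Longrightarrow> {a, b, c, d} \<subseteq> {1..n} \<Longrightarrow>
      q (transpose a b) (transpose c d) * q (transpose c d) (transpose a b) = 1"
    and meet: "\<And>a b c. distinct [a, b, c] \<Longrightarrow>
      q (transpose a b) (transpose b c) * q (transpose a c) (transpose a b) *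
        q (transpose b c) (transpose a c) = - 1"
  shows "rack_cocycle.commuting_pair (transposition_rack n) q x y \<or>
    rack_cocycle.braided_pair (transposition_rack n) q x y"
proof -
  interpret rack_cocycle "transposition_rack n" q by (rule rack)
  note act = transposition_rack_act[OF _ n]
  have mem: "i \<in> {1..n} \<and> j \<in> {1..n}"
    if "transpose i j \<in> carrier (transposition_rack n)" "i \<noteq> j" for i j
    using that transpose_eq_cases[of i j] by (auto simp: transposition_rack_carrier[OF n])
  from n xy show ?thesis
  proof (cases rule: transposition_pair_cases)
    case (1 a b c d)
    have "{a, b, c, d} \<subseteq> {1..n}" using 1 xy mem[of a b] mem[of c d] by auto
    have "commuting_pair x y"
      unfolding commuting_pair_def using 1 xy act[OF xy(1), of c d] act[OF xy(2), of a b]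
        disjoint[OF 1(1) \<open>{a, b, c, d} \<subseteq> {1..n}\<close>] by auto
    then show ?thesis ..
  next
    case (2 a b c)
    have xy_eq: "act (transposition_rack n) x y = transpose a c"
      using 2 act[OF xy(1), of b c] by simp
    then have z: "transpose a c \<in> carrier (transposition_rack n)" using act_closed[OF xy(1,2)] by simp
    have "braided_pair x y"
      unfolding braided_pair_def Let_def xy_eq
      using 2 act[OF z, of a b] act[OF xy(2), of a c] meet[of a b c]
      by (auto simp: transpose_commute)
    then show ?thesis ..
  qed
qed

lemma transposition_rack_idem:
  assumes "2 \<le> n" "x \<in> carrier (transposition_rack n)"
  shows "act (transposition_rack n) x x = x"
proof -
  obtain i j where "x = transpose i j" "i \<noteq> j"
    using assms by (auto simp: transposition_rack_carrier)
  with transposition_rack_act[OF assms(2,1), of i j] show ?thesis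
    by (simp add: transpose_commute)
qed

lemma point_space_transpositions_const:
  assumes "2 \<le> n" "2 \<le> m"
  shows "point_space TYPE('m) m (nichols_algebra (transposition_rack n) (\<lambda>_ _. - 1 :: 'k::field)) = {}"
proof -
  interpret rack_cocycle "transposition_rack n" "\<lambda>_ _. - 1 :: 'k"
    by (rule rack_cocycle_transpositions_const[OF assms(1)])
  show ?thesis
  proof (intro point_space_empty no_point_pair assms(2))
    fix x y
    assume "x \<in> carrier (transposition_rack n)" "y \<in> carrier (transposition_rack n)" "x \<noteq> y"
    then show "commuting_pair x y \<or> braided_pair x y"
      by (rule transposition_pair[OF assms(1) rack_cocycle_axioms]) simp_all
  qed (simp add: transposition_rack_idem[OF assms(1)])
qed

lemma point_space_transpositions_chi:
  assumes n: "2 \<le> n" and m: "2 \<le> m"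
  shows "point_space TYPE('m) m (nichols_algebra (transposition_rack n)
    (\<lambda>\<sigma> \<tau>. chi \<sigma> \<tau> :: 'k::field)) = {}"
proof -
  let ?q = "\<lambda>\<sigma> \<tau>. chi \<sigma> \<tau> :: 'k"
  interpret rack_cocycle "transposition_rack n" ?q
    by (rule rack_cocycle_transpositions_chi[OF n])
  show ?thesis
  proof (intro point_space_empty no_point_pair m)
    fix x assume x: "x \<in> carrier (transposition_rack n)"
    then obtain i j where "x = transpose i j" "i \<noteq> j" by (auto simp: transposition_rack_carrier[OF n])
    then have "chi x x = (- 1 :: 'k)" by (auto simp: chi_transpose)
    with transposition_rack_idem[OF n x]
    show "act (transposition_rack n) x x = x \<and> chi x x = (- 1 :: 'k)" by simp
  next
    \<comment> \<open>Disjoint transpositions preserve each other's order. When they meet, the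
      factors compare (b, c) with (a, c), (a, b) with (c, b), and (a, c) with (a, b); all cancels
      but (b, c) against (c, b), which is -1.\<close>
    fix x y assume "x \<in> carrier (transposition_rack n)" "y \<in> carrier (transposition_rack n)" "x \<noteq> y"
    then show "commuting_pair x y \<or> braided_pair x y"
      by (rule transposition_pair[OF n rack_cocycle_axioms]) (auto simp: chi_transpose)
  qed
qed


section \<open>Cubic roots of unity and the cubic cocycle on S_3\<close>

lemma primitive_cubic_root:
  assumes "primitive_root_of_unity 3 (\<zeta> :: 'k::field)"
  shows "\<zeta> ^ 3 = 1" "\<zeta> \<noteq> 1" "1 + \<zeta> + \<zeta>\<^sup>2 = 0" "1 + \<zeta> \<noteq> 0" "\<zeta> * \<zeta> \<noteq> 1"
proof -
  from assms have "\<forall>k. 0 < k \<and> k < 3 \<longrightarrow> \<zeta> ^ k \<noteq> 1" and c: "\<zeta> ^ 3 = 1"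
    by (auto simp: primitive_root_of_unity_def)
  from this(1)[rule_format, of 1] this(1)[rule_format, of 2]
  show ne: "\<zeta> \<noteq> 1" and "\<zeta> * \<zeta> \<noteq> 1" by (simp_all add: power2_eq_square)
  show "\<zeta> ^ 3 = 1" by (rule c)
  have "(\<zeta> - 1) * (1 + \<zeta> + \<zeta>\<^sup>2) = 0"
    using c by (simp add: algebra_simps power2_eq_square power3_eq_cube)
  with ne show s: "1 + \<zeta> + \<zeta>\<^sup>2 = 0" by simp
  \<comment> \<open>Otherwise the preceding sum would leave \<zeta>^2 = 0, against \<zeta>^3 =
    1.\<close>
  show "1 + \<zeta> \<noteq> 0" using s c by auto
qed

lemma CHAR_two:
  assumes "CHAR('k::field) = 2" shows "(- 1 :: 'k) = 1"
proof -
  have "of_nat 2 = (0 :: 'k)" using of_nat_CHAR[where 'a = 'k] assms by simp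
  then have "1 + 1 = (0 :: 'k)" by simp
  then show ?thesis by (rule minus_unique)
qed

text \<open>The cocycle product along an orbit of three pairs is \<zeta>^3 = 1, which is the
  required -1 because the characteristic is two.\<close>

lemma point_space_S3_cubic:
  assumes char: "CHAR('k) = 2" and \<zeta>: "primitive_root_of_unity 3 (\<zeta> :: 'k::field)"
  shows "point_space TYPE(nat \<Rightarrow> 'k) 2 (nichols_algebra (transposition_rack 3) (\<lambda>_ _. \<zeta>)) \<noteq> {}"
    and "point_space TYPE('m) 3 (nichols_algebra (transposition_rack 3) (\<lambda>_ _. \<zeta>)) = {}"
proof -
  interpret rack_cocycle "transposition_rack 3" "\<lambda>_ _. \<zeta>"
    by (rule rack_cocycle_transpositions_const) simp
  note \<zeta> = primitive_cubic_root[OF \<zeta>]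
  let ?x = "transpose 1 (2::nat)" and ?y = "transpose 2 (3::nat)" and ?z = "transpose 1 (3::nat)"
  have I: "{1..3::nat} = {1, 2, 3}" by auto
  have mem: "transpose i j \<in> carrier (transposition_rack 3)" if "i \<in> {1, 2, 3}" "j \<in> {1, 2, 3}" "i \<noteq> j" for i j
    using that unfolding I[symmetric] by (subst transposition_rack_carrier) auto
  have C: "carrier (transposition_rack 3) = {?x, ?y, ?z}"
  proof
    show "{?x, ?y, ?z} \<subseteq> carrier (transposition_rack 3)" by (auto intro: mem simp del: One_nat_def)
    show "carrier (transposition_rack 3) \<subseteq> {?x, ?y, ?z}"
      by (subst transposition_rack_carrier) (auto simp: I transpose_commute simp del: One_nat_def)
  qed
  have "?x 1 = 2" "?y 1 = 1" "?z 1 = 3" by simp_all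
  then have D: "distinct [?x, ?y, ?z]" by (auto dest: fun_cong[of _ _ 1])
  have idem: "act (transposition_rack 3) x x = x" if "x \<in> carrier (transposition_rack 3)" for x
    using that by (intro transposition_rack_idem) auto
  have act: "act (transposition_rack 3) x (transpose i j) = transpose (x i) (x j)"
    if "x \<in> {?x, ?y, ?z}" "i \<noteq> j" for x i j
    using that by (intro transposition_rack_act) (auto simp: C)
  show "point_space TYPE(nat \<Rightarrow> 'k) 2 (nichols_algebra (transposition_rack 3) (\<lambda>_ _. \<zeta>)) \<noteq> {}"
    by (rule point_space_two_nonempty[of ?x]) (use idem \<zeta> C in auto)
  show "point_space TYPE('m) 3 (nichols_algebra (transposition_rack 3) (\<lambda>_ _. \<zeta>)) = {}"
  proof (rule point_space_empty_cubic)
    fix x y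
    assume xy: "x \<in> carrier (transposition_rack 3)" "y \<in> carrier (transposition_rack 3)" "x \<noteq> y"
    have "commuting_pair x y \<or> braided_pair x y"
    proof (rule transposition_pair[OF _ rack_cocycle_axioms xy])
      \<comment> \<open>Four distinct points do not fit into \<open>{1..3}\<close>.\<close>
      fix a b c d :: nat assume "distinct [a, b, c, d]" "{a, b, c, d} \<subseteq> {1..3}"
      from card_mono[OF _ this(2)] this(1) show "\<zeta> * \<zeta> = 1" by simp
    qed (use \<zeta>(1) CHAR_two[OF char] in \<open>simp_all add: power3_eq_cube\<close>)
    \<comment> \<open>A commuting pair would give \<zeta>^2 = 1.\<close>
    then show "braided_pair x y" using \<zeta>(5) by (simp add: commuting_pair_def)
  next
    show "3 \<le> card (carrier (transposition_rack 3))"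
      unfolding C using D by (simp add: card_insert_if)
  next
    fix A B assume AB: "support_pair A B"
    show "(\<exists>x. carrier (transposition_rack 3) \<inter> A = {x} \<and>
        carrier (transposition_rack 3) \<inter> B = {x}) \<or>
        (\<exists>x. carrier (transposition_rack 3) - {x} \<subseteq> A \<inter> B)"
      by (rule support_pair_three[OF C D _ _ _ _ _ _ AB]) (simp_all add: act transpose_commute)
  qed (use idem \<zeta> in auto)
qed


section \<open>Four-cycles\<close>

lemma four_cycle_rack_act:
  assumes "set cs \<subseteq> {1..4}" "distinct ds"
  shows "act four_cycle_rack (cycle_of_list cs) (cycle_of_list ds) =
    cycle_of_list (map (cycle_of_list cs) ds)"
  unfolding four_cycle_rack_def using assms
  by (intro conj_rack_sym_act cycle_permutes_interval)

lemma rotate_four: "distinct [a, b, c, d] \<Longrightarrow> cycle_of_list [a, b, c, d] = cycle_of_list [b, c, d, a]"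
  using cycle_of_list_rotate_independent[of "[a, b, c, d]" 1] by simp

text \<open>A 4-cycle on four points moves 1, and rotating its list puts 1 in front; this normal
  form leaves six lists.\<close>

lemma four_cycle_rack_carrier:
  "carrier four_cycle_rack \<subseteq> {cycle_of_list [1, a, b, c] | a b c. distinct [a, b, c] \<and> {a, b, c} = {2, 3, 4}}"
proof
  fix x assume "x \<in> carrier four_cycle_rack"
  then obtain h where h: "h permutes {1..4::nat}" "x = cycle_of_list [h 1, h 2, h 3, h 4]"
    unfolding four_cycle_rack_def by (subst (asm) conj_rack_sym_carrier) auto
  have S: "{1..4::nat} = {1, 2, 3, 4}" by auto
  have im: "{h 1, h 2, h 3, h 4} = {1, 2, 3, 4}"
    using permutes_image[OF h(1)] unfolding S by simp
  have d: "distinct [h 1, h 2, h 3, h 4]"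
    using permutes_inj[OF h(1)] by (simp add: inj_eq)
  have rot: "x = cycle_of_list [h 2, h 3, h 4, h 1]" "x = cycle_of_list [h 3, h 4, h 1, h 2]"
    "x = cycle_of_list [h 4, h 1, h 2, h 3]"
    unfolding h(2) using d rotate_four[of "h 1" "h 2" "h 3" "h 4"]
      rotate_four[of "h 2" "h 3" "h 4" "h 1"] rotate_four[of "h 3" "h 4" "h 1" "h 2"]
    by (auto simp del: cycle_of_list.simps)
  have normal: "\<exists>a b c. x = cycle_of_list [1, a, b, c] \<and> distinct [a, b, c] \<and> {a, b, c} = {2, 3, 4}"
    if "x = cycle_of_list [i, a, b, c]" "i = 1" "distinct [i, a, b, c]" "{i, a, b, c} = {1, 2, 3, 4}"
    for i a b c
  proof -
    from that(2,3) have "{a, b, c} = {i, a, b, c} - {1}" by auto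
    also have "\<dots> = {2, 3, 4}" unfolding that(4) by auto
    finally show ?thesis using that by auto
  qed
  have sets: "{h 2, h 3, h 4, h 1} = {1, 2, 3, 4}" "{h 3, h 4, h 1, h 2} = {1, 2, 3, 4}"
    "{h 4, h 1, h 2, h 3} = {1, 2, 3, 4}"
    unfolding im[symmetric] by auto
  have "1 \<in> {h 1, h 2, h 3, h 4}" unfolding im by simp
  then consider "h 1 = 1" | "h 2 = 1" | "h 3 = 1" | "h 4 = 1" by auto
  then have "\<exists>a b c. x = cycle_of_list [1, a, b, c] \<and> distinct [a, b, c] \<and> {a, b, c} = {2, 3, 4}"
  proof cases
    case 1
    from normal[OF h(2) this d im] show ?thesis .
  next
    case 2
    from normal[OF rot(1) this _ sets(1)] d show ?thesis by auto
  next
    case 3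
    from normal[OF rot(2) this _ sets(2)] d show ?thesis by auto
  next
    case 4
    from normal[OF rot(3) this _ sets(3)] d show ?thesis by auto
  qed
  then show "x \<in> {cycle_of_list [1, a, b, c] | a b c. distinct [a, b, c] \<and> {a, b, c} = {2, 3, 4}}"
    by blast
qed

text \<open>Within its class a 4-cycle commutes with itself and its inverse, and it is braided with
  the other four.\<close>

lemma point_space_four_cycles:
  assumes "2 \<le> m"
  shows "point_space TYPE('m) m (nichols_algebra four_cycle_rack (\<lambda>_ _. - 1 :: 'k::field)) = {}"
proof -
  interpret rack_cocycle four_cycle_rack "\<lambda>_ _. - 1 :: 'k"
    unfolding four_cycle_rack_def by (intro rack_cocycle_conj_rack_sym) auto
  define F :: "nat list set" where
    "F = {[1, 2, 3, 4], [1, 2, 4, 3], [1, 3, 2, 4], [1, 3, 4, 2], [1, 4, 2, 3], [1, 4, 3, 2]}"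
  have carrier: "\<exists>l\<in>F. x = cycle_of_list l" if "x \<in> carrier four_cycle_rack" for x
  proof -
    from that four_cycle_rack_carrier obtain a b c where x: "x = cycle_of_list [1, a, b, c]"
      and d: "distinct [a, b, c]" and S: "{a, b, c} = {2, 3, 4}" by blast
    have "a \<in> {2, 3, 4}" "b \<in> {2, 3, 4}" "c \<in> {2, 3, 4}" unfolding S[symmetric] by auto
    with d have "[1, a, b, c] \<in> F" by (auto simp: F_def)
    with x show ?thesis by blast
  qed
  \<comment> \<open>Relabelled cycles come out with 1 in any position; these equations rotate it
    back to the front.\<close>
  have rot: "cycle_of_list [a, b, c, 1] = cycle_of_list [1, a, b, c]"
    "cycle_of_list [a, b, 1, c] = cycle_of_list [1, c, a, b]"
    "cycle_of_list [a, 1, b, c] = cycle_of_list [1, b, c, a]"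
    if "distinct [1, a, b, c]" for a b c :: nat
    using that rotate_four[of 1 a b c] rotate_four[of a b c 1] rotate_four[of b c 1 a]
      rotate_four[of 1 c a b] rotate_four[of c a b 1] rotate_four[of a 1 b c]
    by (auto simp del: cycle_of_list.simps)
  show ?thesis
  proof (intro point_space_empty no_point_pair assms)
    fix x assume "x \<in> carrier four_cycle_rack"
    then obtain l where "l \<in> F" "x = cycle_of_list l" using carrier by blast
    then show "act four_cycle_rack x x = x \<and> - 1 = (- 1 :: 'k)"
      by (auto simp: F_def four_cycle_rack_act cycle_four_apply rot simp del: cycle_of_list.simps One_nat_def)
  next
    fix x y assume "x \<in> carrier four_cycle_rack" "y \<in> carrier four_cycle_rack" "x \<noteq> y"
    then obtain l m where lm: "l \<in> F" "x = cycle_of_list l" "m \<in> F" "y = cycle_of_list m" "l \<noteq> m"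
      using carrier by metis
    show "commuting_pair x y \<or> braided_pair x y"
      using lm(1,3,5) unfolding lm(2,4) commuting_pair_def braided_pair_def Let_def F_def
      by (auto simp: four_cycle_rack_act cycle_four_apply rot simp del: cycle_of_list.simps One_nat_def)
  qed
qed


section \<open>Affine racks\<close>

lemma rack_cocycle_affine:
  assumes "0 < p" "coprime \<alpha> p"
  shows "rack_cocycle (affine_rack p \<alpha>) (\<lambda>_ _. c)"
proof (unfold_locales)
  fix x assume "x \<in> carrier (affine_rack p \<alpha>)"
  show "inj_on (act (affine_rack p \<alpha>) x) (carrier (affine_rack p \<alpha>))"
  proof (rule inj_onI)
    fix y z assume y: "y \<in> carrier (affine_rack p \<alpha>)" and z: "z \<in> carrier (affine_rack p \<alpha>)"
      and "act (affine_rack p \<alpha>) x y = act (affine_rack p \<alpha>) x z"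
    then have "p dvd \<alpha> * (y - z)"
      by (simp add: affine_rack_def mod_eq_dvd_iff algebra_simps)
    then have "p dvd y - z" using assms(2) by (simp add: coprime_commute coprime_dvd_mult_right_iff)
    then have "y mod p = z mod p" by (simp add: mod_eq_dvd_iff)
    then show "y = z" using y z by (simp add: affine_rack_def)
  qed
next
  fix x y z :: int
  have mod_right: "(u + \<alpha> * (v mod p)) mod p = (u + \<alpha> * v) mod p" for u v
    by (metis mod_add_right_eq mod_mult_right_eq)
  have mod_left: "((1 - \<alpha>) * (u mod p) + v) mod p = ((1 - \<alpha>) * u + v) mod p" for u v
    by (metis mod_add_left_eq mod_mult_right_eq)
  show "act (affine_rack p \<alpha>) x (act (affine_rack p \<alpha>) y z) =
      act (affine_rack p \<alpha>) (act (affine_rack p \<alpha>) x y) (act (affine_rack p \<alpha>) x z)"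
    unfolding affine_rack_def rack.simps mod_right mod_left by (simp add: algebra_simps)
qed (use assms in \<open>auto simp: affine_rack_def\<close>)

text \<open>The difference of a pair is multiplied by -\<alpha> at each step of the braiding, so an
  orbit of distinct elements has as many pairs as the order of -\<alpha>. For 3 and 5 modulo 7 this
  order is three.\<close>

lemma point_space_affine_seven:
  assumes "2 \<le> m" "\<alpha> = 3 \<or> \<alpha> = 5"
  shows "point_space TYPE('m) m (nichols_algebra (affine_rack 7 \<alpha>) (\<lambda>_ _. - 1 :: 'k::field)) = {}"
proof -
  \<comment> \<open>3 and 5 are inverse to each other modulo 7, as 15 = 1 + 2 * 7.\<close>
  have co: "coprime (3 :: int) 7" "coprime (5 :: int) 7" using invertible_coprime[of 3 5 "7 :: int"] invertible_coprime[of 5 3 "7 :: int"] by simp_all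
  interpret rack_cocycle "affine_rack 7 \<alpha>" "\<lambda>_ _. - 1 :: 'k"
    using assms(2) co by (intro rack_cocycle_affine) auto
  have range: "carrier (affine_rack 7 \<alpha>) = {0, 1, 2, 3, 4, 5, 6}"
    by (auto simp: affine_rack_def)
  show ?thesis
  proof (intro point_space_empty no_point_pair assms)
    fix x assume "x \<in> carrier (affine_rack 7 \<alpha>)"
    then show "act (affine_rack 7 \<alpha>) x x = x \<and> - 1 = (- 1 :: 'k)"
      by (simp add: affine_rack_def algebra_simps)
  next
    fix x y assume "x \<in> carrier (affine_rack 7 \<alpha>)" "y \<in> carrier (affine_rack 7 \<alpha>)"
    then have "braided_pair x y"
      using assms(2) unfolding braided_pair_def Let_def range by (auto simp: affine_rack_def)
    then show "commuting_pair x y \<or> braided_pair x y" ..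
  qed
qed

text \<open>
  The relation through \<open>(x, y)\<close> with \<open>y\<close> in the support \<open>A\<close> of \<open>a\<close> and \<open>x\<close> in the support \<open>B\<close> of
  \<open>b\<close> has four terms; it forces $x \rhd y \in A$ and $(x \rhd y) \rhd x \in B$. As \<open>\<alpha>\<close> is a primitive
  root modulo 5, iterating the former shows that \<open>A\<close> contains everything but \<open>x\<close>, so \<open>A\<close> meets \<open>B\<close>.
\<close>

lemma point_space_affine_five:
  assumes m: "2 \<le> m" and \<alpha>: "\<alpha> = 2 \<or> \<alpha> = 3"
  shows "point_space TYPE('m) m (nichols_algebra (affine_rack 5 \<alpha>) (\<lambda>_ _. - 1 :: 'k::field)) = {}"
proof -
  let ?X = "affine_rack 5 \<alpha>"
  have co: "coprime (2 :: int) 5" "coprime (3 :: int) 5" using invertible_coprime[of 2 3 "5 :: int"] invertible_coprime[of 3 2 "5 :: int"] by simp_all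
  interpret rack_cocycle ?X "\<lambda>_ _. - 1 :: 'k"
    using \<alpha> co by (intro rack_cocycle_affine) auto
  have range: "carrier ?X = {0, 1, 2, 3, 4}"
    by (auto simp: affine_rack_def)
  have idem: "act ?X x x = x" if "x \<in> carrier ?X" for x
    using that by (simp add: affine_rack_def algebra_simps)
  have False if p: "point_pair a b" for a b :: "int \<Rightarrow> 'k"
  proof -
    have disj: "b x = 0 \<or> a x = 0" if "x \<in> carrier ?X" for x
      using point_pair_square[OF p that] idem[OF that] by simp
    have step: "a (act ?X x y) \<noteq> 0 \<and> b (act ?X (act ?X x y) x) \<noteq> 0"
      if "x \<in> carrier ?X" "y \<in> carrier ?X" "b x \<noteq> 0" "a y \<noteq> 0" for x y
    proof -
      \<comment> \<open>In the relation the terms with \<open>a x\<close> and with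
        \<open>b y\<close> vanish, so \<open>b x * a y\<close> and \<open>b w * a z\<close> are
        opposite and both nonzero.\<close>
      define z w where "z = act ?X x y" and "w = act ?X z x"
      have ne: "x \<noteq> y" and 0: "a x = 0" "b y = 0" using disj that by auto
      have "z \<in> carrier ?X" "w \<in> carrier ?X" using that act_closed by (auto simp: z_def w_def)
      moreover have "distinct [x, y, z, w] \<and> act ?X w z = y \<and> act ?X y w = x"
        using that(1,2) ne \<alpha> unfolding range w_def z_def
        by (auto simp: affine_rack_def)
      ultimately have "b x * a y + b z * a x + b w * a z + b y * a w = 0"
        using that by (intro point_pair_four[OF p]) (auto simp: z_def w_def)
      with 0 that show ?thesis by (auto simp: z_def[symmetric] w_def[symmetric])
    qed
    from p obtain x y where xy: "x \<in> carrier ?X" "b x \<noteq> 0" "y \<in> carrier ?X" "a y \<noteq> 0"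
      by (auto simp: point_pair_def)
    define y' y'' w where "y' = act ?X x y" and "y'' = act ?X x y'" and "w = act ?X y' x"
    have mem: "y' \<in> carrier ?X" "y'' \<in> carrier ?X" "w \<in> carrier ?X"
      using xy act_closed by (auto simp: y'_def y''_def w_def)
    have 1: "a y' \<noteq> 0" "b w \<noteq> 0" using step xy by (auto simp: y'_def w_def)
    then have 2: "a y'' \<noteq> 0" using step[OF xy(1) mem(1)] xy by (auto simp: y''_def)
    then have 3: "a (act ?X x y'') \<noteq> 0" using step[OF xy(1) mem(2)] xy by auto
    \<comment> \<open>In coordinates with x = 0 and y = 1 the translates of y are 2, 4, 3 for
      \<alpha> = 2 and 3, 4, 2 for \<alpha> = 3, while w is 3 or 4, respectively.\<close>
    have "w = y'' \<or> w = act ?X x y''"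
      using \<alpha> xy(1,3) unfolding range w_def y''_def y'_def
      by (auto simp: affine_rack_def)
    with 1 2 3 disj[OF mem(3)] show False by auto
  qed
  then show ?thesis using m by (intro point_space_empty) auto
qed


section \<open>The tetrahedron rack\<close>

text \<open>The images of \<open>[1, 2, 3]\<close> under A_4; an even permutation of four points is
  determined by three values. They separate the class of (1 2 3) from that of (1 3 2).\<close>

definition even_triples :: "nat list set" where
  "even_triples = {[2, 4, 3], [4, 3, 2], [3, 2, 4], [1, 2, 3], [2, 3, 1], [3, 1, 2],
    [1, 4, 2], [4, 2, 1], [2, 1, 4], [1, 3, 4], [3, 4, 1], [4, 1, 3]}"

text \<open>Parity is followed along a product of transpositions, so odd permutations must be
  included; starting them from \<open>[1, 3, 2]\<close> keeps the triple in the same set.\<close>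

lemma permutation_triple:
  assumes "p permutes {1..4::nat}"
  shows "map p (if evenperm p then [1, 2, 3] else [1, 3, 2]) \<in> even_triples"
proof -
  have transpose_even: "map (transpose a b) (rev l) \<in> even_triples"
    if "l \<in> even_triples" "a \<in> {1, 2, 3, 4}" "b \<in> {1, 2, 3, 4}" "a \<noteq> b" for l a b
    using that unfolding even_triples_def by (elim insertE emptyE; simp add: transpose_def)
  have rot: "[z, x, y] \<in> even_triples" if "[x, y, z] \<in> even_triples" for x y z
    using that unfolding even_triples_def by auto
  have I: "{1..4::nat} = {1, 2, 3, 4}" by auto
  have "finite {1..4::nat}" by simp
  with assms show ?thesis
  proof (induction rule: permutes_induct)
    case id
    then show ?case by (simp add: even_triples_def id_def)
  next
    case (swap a b p)
    have "permutation p" using swap.hyps by (auto simp: permutation_permutes)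
    then have ev: "evenperm (transpose a b \<circ> p) \<longleftrightarrow> \<not> evenperm p"
      using swap.hyps by (simp add: evenperm_comp permutation_swap_id evenperm_swap)
    \<comment> \<open>Reversing the list compensates the change of parity; a rotation then brings it
      to the required order.\<close>
    have "map (transpose a b) (rev (map p (if evenperm p then [1, 2, 3] else [1, 3, 2]))) \<in> even_triples"
      using swap by (intro transpose_even) (auto simp: I)
    then show ?case unfolding ev by (cases "evenperm p") (simp_all add: rot)
  qed
qed

lemma rotate_three: "distinct [a, b, c] \<Longrightarrow> cycle_of_list [b, c, a] = cycle_of_list [a, b, c]"
  using cycle_of_list_rotate_independent[of "[a, b, c]" 1] by simp

lemma three_cycle_alt:
  assumes "distinct [a, b, c]" "{a, b, c} \<subseteq> {1..n}"
  shows "cycle_of_list [a, b, c] \<in> carrier (alt_group n)"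
  using assms cycle_permutes_interval[of "[a, b, c]" n]
  by (simp add: alt_group_carrier evenperm_comp permutation_swap_id evenperm_swap)

abbreviation "t0 \<equiv> cycle_of_list [2, 4, 3 :: nat]"
abbreviation "t1 \<equiv> cycle_of_list [1, 2, 3 :: nat]"
abbreviation "t2 \<equiv> cycle_of_list [1, 4, 2 :: nat]"
abbreviation "t3 \<equiv> cycle_of_list [1, 3, 4 :: nat]"

lemma tetrahedron_normal_forms:
  "cycle_of_list [4, 3, 2] = t0" "cycle_of_list [3, 2, 4] = t0"
  "cycle_of_list [2, 3, 1] = t1" "cycle_of_list [3, 1, 2] = t1"
  "cycle_of_list [4, 2, 1] = t2" "cycle_of_list [2, 1, 4] = t2"
  "cycle_of_list [3, 4, 1] = t3" "cycle_of_list [4, 1, 3] = t3"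
  using rotate_three[of 2 4 "3::nat"] rotate_three[of 4 3 "2::nat"]
    rotate_three[of 1 2 "3::nat"] rotate_three[of 2 3 "1::nat"]
    rotate_three[of 1 4 "2::nat"] rotate_three[of 4 2 "1::nat"]
    rotate_three[of 1 3 "4::nat"] rotate_three[of 3 4 "1::nat"]
  by (simp_all del: cycle_of_list.simps One_nat_def)

lemma tetrahedron_distinct: "distinct [t0, t1, t2, t3]"
proof -
  have "t0 1 = 1" "t1 1 = 2" "t2 1 = 4" "t3 1 = 3" by (simp_all add: transpose_def)
  then show ?thesis by (auto dest: fun_cong[of _ _ 1] simp del: cycle_of_list.simps One_nat_def)
qed

lemma tetrahedron_act_cycle:
  assumes "cs \<in> {[2, 4, 3], [1, 2, 3], [1, 4, 2], [1, 3, 4]}" "distinct ds"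
  shows "act tetrahedron_rack (cycle_of_list cs) (cycle_of_list ds) =
    cycle_of_list (map (cycle_of_list cs) ds)"
  unfolding tetrahedron_rack_def using assms
  by (intro conj_rack_alt_act) (auto intro!: three_cycle_alt simp del: cycle_of_list.simps One_nat_def)

lemma tetrahedron_act:
  "act tetrahedron_rack t0 t0 = t0" "act tetrahedron_rack t0 t1 = t2"
  "act tetrahedron_rack t0 t2 = t3" "act tetrahedron_rack t0 t3 = t1"
  "act tetrahedron_rack t1 t0 = t3" "act tetrahedron_rack t1 t1 = t1"
  "act tetrahedron_rack t1 t2 = t0" "act tetrahedron_rack t1 t3 = t2"
  "act tetrahedron_rack t2 t0 = t1" "act tetrahedron_rack t2 t1 = t3"
  "act tetrahedron_rack t2 t2 = t2" "act tetrahedron_rack t2 t3 = t0"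
  "act tetrahedron_rack t3 t0 = t2" "act tetrahedron_rack t3 t1 = t0"
  "act tetrahedron_rack t3 t2 = t1" "act tetrahedron_rack t3 t3 = t3"
  by (simp_all add: tetrahedron_act_cycle cycle_three_apply tetrahedron_normal_forms
      del: cycle_of_list.simps One_nat_def)

lemma tetrahedron_carrier: "carrier tetrahedron_rack = {t0, t1, t2, t3}"
proof
  show "carrier tetrahedron_rack \<subseteq> {t0, t1, t2, t3}"
  proof
    fix x assume "x \<in> carrier tetrahedron_rack"
    then obtain h where h: "h \<in> carrier (alt_group 4)" "x = act tetrahedron_rack h t1"
      by (auto simp: tetrahedron_rack_def conj_rack_def)
    then have "x = cycle_of_list (map h [1, 2, 3])"
      unfolding tetrahedron_rack_def by (subst (asm) conj_rack_alt_act) auto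
    moreover have "map h [1, 2, 3] \<in> even_triples"
      using permutation_triple[of h] h(1) by (simp add: alt_group_carrier)
    ultimately obtain l where "x = cycle_of_list l" "l \<in> even_triples" by blast
    then show "x \<in> {t0, t1, t2, t3}"
      unfolding even_triples_def by (auto simp: tetrahedron_normal_forms simp del: cycle_of_list.simps One_nat_def)
  qed
  \<comment> \<open>For the other inclusion, conjugating \<open>t1\<close> by \<open>t1\<close>,
    \<open>t0\<close>, \<open>t2\<close>, \<open>t3\<close> gives \<open>t1\<close>,
    \<open>t2\<close>, \<open>t3\<close>, \<open>t0\<close>.\<close>
  have "act tetrahedron_rack h t1 \<in> carrier tetrahedron_rack" if "h \<in> carrier (alt_group 4)" for h
    using that by (auto simp: tetrahedron_rack_def conj_rack_def)
  note closed = this[OF three_cycle_alt]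
  have "t1 \<in> carrier tetrahedron_rack" "t2 \<in> carrier tetrahedron_rack"
    "t3 \<in> carrier tetrahedron_rack" "t0 \<in> carrier tetrahedron_rack"
    using closed[of 1 2 3] closed[of 2 4 3] closed[of 1 4 2] closed[of 1 3 4]
    by (simp_all add: tetrahedron_act del: cycle_of_list.simps One_nat_def)
  then show "{t0, t1, t2, t3} \<subseteq> carrier tetrahedron_rack" by blast
qed

lemma rack_cocycle_tetrahedron:
  assumes "\<And>x y z. x \<in> {t0, t1, t2, t3} \<Longrightarrow> y \<in> {t0, t1, t2, t3} \<Longrightarrow> z \<in> {t0, t1, t2, t3} \<Longrightarrow>
    q x (act tetrahedron_rack y z) * q y z =
      q (act tetrahedron_rack x y) (act tetrahedron_rack x z) * q x z"
  shows "rack_cocycle tetrahedron_rack q"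
  unfolding tetrahedron_rack_def
proof (rule rack_cocycle_conj_rack, unfold tetrahedron_rack_def[symmetric])
  show "group (alt_group 4)" by (rule alt_group_is_group)
  show "finite (carrier (alt_group 4))"
    by (rule finite_subset[of _ "{p. p permutes {1..4}}"]) (auto simp: alt_group_carrier finite_permutations)
  show "t1 \<in> carrier (alt_group 4)" by (rule three_cycle_alt) auto
qed (use assms in \<open>simp add: tetrahedron_carrier del: cycle_of_list.simps One_nat_def\<close>)

section \<open>The cocycle psi and the point spaces of the tetrahedron rack\<close>

lemma psi_tetrahedron:
  "psi \<zeta> t0 y = \<zeta>" "psi \<zeta> x t0 = \<zeta>" "psi \<zeta> x x = \<zeta>"
  "psi \<zeta> t1 t2 = - \<zeta>" "psi \<zeta> t1 t3 = - \<zeta>" "psi \<zeta> t2 t1 = - \<zeta>"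
  "psi \<zeta> t2 t3 = - \<zeta>" "psi \<zeta> t3 t1 = - \<zeta>" "psi \<zeta> t3 t2 = - \<zeta>"
  using tetrahedron_distinct by (auto simp: psi_def simp del: cycle_of_list.simps One_nat_def)

lemma rack_cocycle_psi: "rack_cocycle tetrahedron_rack (psi \<zeta>)"
proof (rule rack_cocycle_tetrahedron)
  fix x y z assume "x \<in> {t0, t1, t2, t3}" "y \<in> {t0, t1, t2, t3}" "z \<in> {t0, t1, t2, t3}"
  then show "psi \<zeta> x (act tetrahedron_rack y z) * psi \<zeta> y z =
      psi \<zeta> (act tetrahedron_rack x y) (act tetrahedron_rack x z) * psi \<zeta> x z"
    by (elim insertE emptyE)
      (simp_all only: tetrahedron_act psi_tetrahedron mult_minus_left mult_minus_right minus_minus)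
qed

lemma tetrahedron_idem: "x \<in> carrier tetrahedron_rack \<Longrightarrow> act tetrahedron_rack x x = x"
  unfolding tetrahedron_carrier by (elim insertE emptyE) (simp_all only: tetrahedron_act)

text \<open>The twelve ordered pairs of distinct elements form four orbits of three pairs; one
  cocycle product per orbit suffices, as it does not depend on the starting pair.\<close>

lemma tetrahedron_braided_pair:
  assumes "rack_cocycle tetrahedron_rack q" "x \<in> carrier tetrahedron_rack" "y \<in> carrier tetrahedron_rack" "x \<noteq> y"
    and "q t0 t1 * q t2 t0 * q t1 t2 = - 1" "q t0 t2 * q t3 t0 * q t2 t3 = - 1"
      "q t0 t3 * q t1 t0 * q t3 t1 = - 1" "q t1 t3 * q t2 t1 * q t3 t2 = - 1"
  shows "rack_cocycle.braided_pair tetrahedron_rack q x y"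
  using assms(2-8)
  unfolding rack_cocycle.braided_pair_def[OF assms(1)] Let_def tetrahedron_carrier
  by (elim insertE emptyE) (simp_all add: tetrahedron_act mult_ac del: cycle_of_list.simps One_nat_def)

lemma point_space_tetrahedron_const:
  assumes "2 \<le> m"
  shows "point_space TYPE('m) m (nichols_algebra tetrahedron_rack (\<lambda>_ _. - 1 :: 'k::field)) = {}"
proof -
  interpret rack_cocycle tetrahedron_rack "\<lambda>_ _. - 1 :: 'k"
    by (rule rack_cocycle_tetrahedron) simp
  show ?thesis
  proof (intro point_space_empty no_point_pair assms)
    fix x y assume "x \<in> carrier tetrahedron_rack" "y \<in> carrier tetrahedron_rack" "x \<noteq> y"
    then have "braided_pair x y" by (rule tetrahedron_braided_pair[OF rack_cocycle_axioms]) simp_all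
    then show "commuting_pair x y \<or> braided_pair x y" ..
  qed (simp add: tetrahedron_idem)
qed

text \<open>An orbit through \<open>t0\<close> contains one pair that avoids \<open>t0\<close>,
  hence one factor -\<zeta>; the fourth orbit has three such factors. Either way the product is
  -\<zeta>^3 = -1, in every characteristic.\<close>

lemma point_space_tetrahedron_psi:
  assumes "primitive_root_of_unity 3 (\<zeta> :: 'k::field)"
  shows "point_space TYPE(nat \<Rightarrow> 'k) 2 (nichols_algebra tetrahedron_rack (psi \<zeta>)) \<noteq> {}"
    and "point_space TYPE('m) 3 (nichols_algebra tetrahedron_rack (psi \<zeta>)) = {}"
proof -
  interpret rack_cocycle tetrahedron_rack "psi \<zeta>" by (rule rack_cocycle_psi)
  note \<zeta> = primitive_cubic_root[OF assms]
  have diag: "psi \<zeta> x x = \<zeta>" for x by (simp add: psi_def)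
  have t0: "t0 \<in> carrier tetrahedron_rack" unfolding tetrahedron_carrier by simp
  show "point_space TYPE(nat \<Rightarrow> 'k) 2 (nichols_algebra tetrahedron_rack (psi \<zeta>)) \<noteq> {}"
    by (rule point_space_two_nonempty[OF t0 tetrahedron_idem[OF t0]]) (simp add: diag \<zeta>)
  show "point_space TYPE('m) 3 (nichols_algebra tetrahedron_rack (psi \<zeta>)) = {}"
  proof (rule point_space_empty_cubic)
    fix x y assume "x \<in> carrier tetrahedron_rack" "y \<in> carrier tetrahedron_rack" "x \<noteq> y"
    then show "braided_pair x y"
      by (rule tetrahedron_braided_pair[OF rack_cocycle_axioms])
        (use \<zeta>(1) in \<open>simp_all only: psi_tetrahedron power3_eq_cube mult_minus_left
          mult_minus_right minus_minus\<close>)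
  next
    show "3 \<le> card (carrier tetrahedron_rack)"
      unfolding tetrahedron_carrier using distinct_card[OF tetrahedron_distinct] by simp
  next
    fix A B assume AB: "support_pair A B"
    show "(\<exists>x. carrier tetrahedron_rack \<inter> A = {x} \<and> carrier tetrahedron_rack \<inter> B = {x}) \<or>
        (\<exists>x. carrier tetrahedron_rack - {x} \<subseteq> A \<inter> B)"
      by (rule support_pair_four[OF tetrahedron_carrier tetrahedron_distinct _ _ _ _ _ _ _ _ _ _ _ _ AB])
        (rule tetrahedron_act)+
  qed (simp add: tetrahedron_idem diag \<zeta>)
qed



section \<open>Truncated point modules of the known Nichols algebras\<close>

theorem theorem1p4:
  shows "
    (point_space TYPE('m) 2 (nichols_algebra (transposition_rack 3) (\<lambda>_ _. - 1 :: 'k::field)) = {} \<and>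
      point_space TYPE('m) 3 (nichols_algebra (transposition_rack 3) (\<lambda>_ _. - 1 :: 'k::field)) = {}) \<and>
    (CHAR('k) = 2 \<longrightarrow> (\<forall>\<zeta> :: 'k::field. primitive_root_of_unity 3 \<zeta> \<longrightarrow>
      point_space TYPE(nat \<Rightarrow> 'k) 2 (nichols_algebra (transposition_rack 3) (\<lambda>_ _. \<zeta>)) \<noteq> {} \<and>
      point_space TYPE('m) 3 (nichols_algebra (transposition_rack 3) (\<lambda>_ _. \<zeta>)) = {})) \<and>
    (CHAR('k) = 2 \<longrightarrow>
      point_space TYPE('m) 2 (nichols_algebra tetrahedron_rack (\<lambda>_ _. 1 :: 'k::field)) = {} \<and>
      point_space TYPE('m) 3 (nichols_algebra tetrahedron_rack (\<lambda>_ _. 1 :: 'k::field)) = {}) \<and>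
    (CHAR('k) \<noteq> 2 \<longrightarrow>
      point_space TYPE('m) 2 (nichols_algebra tetrahedron_rack (\<lambda>_ _. - 1 :: 'k::field)) = {} \<and>
      point_space TYPE('m) 3 (nichols_algebra tetrahedron_rack (\<lambda>_ _. - 1 :: 'k::field)) = {}) \<and>
    ((\<forall>\<zeta> :: 'k::field. primitive_root_of_unity 3 \<zeta> \<longrightarrow>
      point_space TYPE(nat \<Rightarrow> 'k) 2 (nichols_algebra tetrahedron_rack (psi \<zeta>)) \<noteq> {} \<and>
      point_space TYPE('m) 3 (nichols_algebra tetrahedron_rack (psi \<zeta>)) = {})) \<and>
    (point_space TYPE('m) 2 (nichols_algebra (affine_rack 5 2) (\<lambda>_ _. - 1 :: 'k::field)) = {} \<and>
      point_space TYPE('m) 3 (nichols_algebra (affine_rack 5 2) (\<lambda>_ _. - 1 :: 'k::field)) = {}) \<and>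
    (point_space TYPE('m) 2 (nichols_algebra (affine_rack 5 3) (\<lambda>_ _. - 1 :: 'k::field)) = {} \<and>
      point_space TYPE('m) 3 (nichols_algebra (affine_rack 5 3) (\<lambda>_ _. - 1 :: 'k::field)) = {}) \<and>
    (point_space TYPE('m) 2 (nichols_algebra (transposition_rack 4) (\<lambda>\<sigma> \<tau>. chi \<sigma> \<tau> :: 'k::field)) = {} \<and>
      point_space TYPE('m) 3 (nichols_algebra (transposition_rack 4) (\<lambda>\<sigma> \<tau>. chi \<sigma> \<tau> :: 'k::field)) = {}) \<and>
    (point_space TYPE('m) 2 (nichols_algebra (transposition_rack 4) (\<lambda>_ _. - 1 :: 'k::field)) = {} \<and>
      point_space TYPE('m) 3 (nichols_algebra (transposition_rack 4) (\<lambda>_ _. - 1 :: 'k::field)) = {}) \<and>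
    (point_space TYPE('m) 2 (nichols_algebra four_cycle_rack (\<lambda>_ _. - 1 :: 'k::field)) = {} \<and>
      point_space TYPE('m) 3 (nichols_algebra four_cycle_rack (\<lambda>_ _. - 1 :: 'k::field)) = {}) \<and>
    (point_space TYPE('m) 2 (nichols_algebra (affine_rack 7 3) (\<lambda>_ _. - 1 :: 'k::field)) = {} \<and>
      point_space TYPE('m) 3 (nichols_algebra (affine_rack 7 3) (\<lambda>_ _. - 1 :: 'k::field)) = {}) \<and>
    (point_space TYPE('m) 2 (nichols_algebra (affine_rack 7 5) (\<lambda>_ _. - 1 :: 'k::field)) = {} \<and>
      point_space TYPE('m) 3 (nichols_algebra (affine_rack 7 5) (\<lambda>_ _. - 1 :: 'k::field)) = {}) \<and>
    (point_space TYPE('m) 2 (nichols_algebra (transposition_rack 5) (\<lambda>\<sigma> \<tau>. chi \<sigma> \<tau> :: 'k::field)) = {} \<and>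
      point_space TYPE('m) 3 (nichols_algebra (transposition_rack 5) (\<lambda>\<sigma> \<tau>. chi \<sigma> \<tau> :: 'k::field)) = {}) \<and>
    (point_space TYPE('m) 2 (nichols_algebra (transposition_rack 5) (\<lambda>_ _. - 1 :: 'k::field)) = {} \<and>
      point_space TYPE('m) 3 (nichols_algebra (transposition_rack 5) (\<lambda>_ _. - 1 :: 'k::field)) = {})"
proof (intro conjI impI allI)
  assume "CHAR('k) = 2"
  \<comment> \<open>In characteristic two the constant cocycle 1 is the constant -1.\<close>
  note const = point_space_tetrahedron_const[where 'k = 'k and 'm = 'm, unfolded CHAR_two[OF this]]
  show "point_space TYPE('m) 2 (nichols_algebra tetrahedron_rack (\<lambda>_ _. 1 :: 'k::field)) = {}"
    by (rule const) simp
  show "point_space TYPE('m) 3 (nichols_algebra tetrahedron_rack (\<lambda>_ _. 1 :: 'k::field)) = {}"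
    by (rule const) simp
qed (rule point_space_transpositions_const point_space_transpositions_chi point_space_S3_cubic
    point_space_tetrahedron_const point_space_tetrahedron_psi point_space_affine_five
    point_space_affine_seven point_space_four_cycles; simp)+

end
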